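(* There is an embedding $\mathrm{SL}_{\mathbb{C}}(2)\hookrightarrow\mathrm{SC}(\mathbb{P}^{1|1}_{\mathbb{C}})$ of super Lie subgroups. The space of left cosets $$\mathrm{SUSY}=\mathrm{SL}_{\mathbb{C}}(2)\backslash\mathrm{SC}(\mathbb{P}^{1|1}_{\mathbb{C}})$$ is isomorphic to $\mathbb{C}^{0|2}$.
   Context: $B$ denotes a superpoint $\mathbb{R}^{0|s}$ with Grassmann algebra $\mathcal{O}_B$. $\mathbb{P}^{1|1}_{\mathbb{C}}$ is the complex projective superspace with $B$-points $[Z_1:Z_2:\Theta]$ ($Z_i$ even, one of them invertible, $\Theta$ odd), with its super Riemann surface structure, and $\mathrm{SC}(\mathbb{P}^{1|1}_{\mathbb{C}})$ is the complex super Lie group (dimension $3|2$) of its superconformal automorphisms. It equals $\mathrm{Sp}_{\mathbb{C}}(2|1)/\mathbb{Z}_2$ and is realized as the connected component with $e_{red}=1$ of $\mathrm{Sp}_{\mathbb{C}}(2|1)$; that is, $\underline{\mathrm{SC}(\mathbb{P}^{1|1}_{\mathbb{C}})}(B)$ is the group of invertible matrices $$\begin{pmatrix} a & c & \gamma \\ b & d & \delta \\ \alpha & \beta & e \end{pmatrix}$$ with even entries $a,b,c,d,e$ and odd entries $\alpha,\beta,\gamma,\delta$ in $\mathcal{O}_B\otimes\mathbb{C}$ such that $ad-bc-\gamma\delta=1$, $e^2+2\alpha\beta=1$, $c\alpha-a\beta=e\gamma$, $d\alpha-b\beta=e\delta$, and $e_{red}=1$; it acts on $[Z_1:Z_2:\Theta]$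 by right multiplication. $\mathrm{SL}_{\mathbb{C}}(2)$ is the complex Lie group regarded as a super Lie group, and the embedding is $\begin{pmatrix} a & c \\ b & d \end{pmatrix}\mapsto\begin{pmatrix} a & c & 0 \\ b & d & 0 \\ 0 & 0 & 1 \end{pmatrix}$. The coset space is the quotient supermanifold by the left multiplication action of $\mathrm{SL}_{\mathbb{C}}(2)$. *)

theory Defs
  imports "HOL-Analysis.Analysis" "HOL-Algebra.Coset"
begin

section \<open>The complexified Grassmann algebra\<close>

text \<open>
  One type holds the complexified Grassmann algebras of all superpoints at once: an element is a
  finitely supported family of complex coefficients of the monomials
  \<open>\<theta>\<^sub>I = \<theta>\<^sub>i\<^sub>1 \<dots> \<theta>\<^sub>i\<^sub>k\<close>, for \<open>I = {i\<^sub>1 < \<dots> < i\<^sub>k}\<close> a finite set of naturals.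
  For \<open>B = \<real>\<^sup>0\<^sup>|\<^sup>s\<close>, the algebra \<open>O\<^sub>B \<otimes> \<complex>\<close> is the subalgebra \<open>galg s\<close> generated by
  \<open>\<theta>\<^sub>0, \<dots>, \<theta>\<^sub>s\<^sub>-\<^sub>1\<close>.
\<close>

typedef grassmann =
  "{f :: nat set \<Rightarrow> complex. finite {I. f I \<noteq> 0} \<and> (\<forall>I. f I \<noteq> 0 \<longrightarrow> finite I)}"
  morphisms gcoeff Abs_grassmann
  by (rule exI[of _ "\<lambda>_. 0"]) simp

setup_lifting type_definition_grassmann

lemma grassmann_eqI: "(\<And>I. gcoeff x I = gcoeff y I) \<Longrightarrow> x = y"
  by transfer auto

lemma finite_gcoeff: "finite {I. gcoeff x I \<noteq> 0}"
  by transfer auto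

lemma gcoeff_nonzero_finite: "gcoeff x I \<noteq> 0 \<Longrightarrow> finite I"
  by transfer auto

lemma gcoeff_infinite: "infinite I \<Longrightarrow> gcoeff x I = 0"
  by transfer auto

text \<open>\<open>\<theta>\<^sub>I \<theta>\<^sub>J = gsgn I J \<theta>\<^sub>I\<^sub>\<union>\<^sub>J\<close> for disjoint \<open>I\<close>, \<open>J\<close>.\<close>

definition gsgn :: "nat set \<Rightarrow> nat set \<Rightarrow> complex" where
  "gsgn I J = (-1) ^ card {p \<in> I \<times> J. snd p < fst p}"

lemma gsgn_Un_left:
  assumes "finite I" "finite J" "finite K" "I \<inter> J = {}"
  shows "gsgn (I \<union> J) K = gsgn I K * gsgn J K"
proof -
  have "{p \<in> (I \<union> J) \<times> K. snd p < fst p} =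
      {p \<in> I \<times> K. snd p < fst p} \<union> {p \<in> J \<times> K. snd p < fst p}" by blast
  moreover have "{p \<in> I \<times> K. snd p < fst p} \<inter> {p \<in> J \<times> K. snd p < fst p} = {}"
    using assms(4) by blast
  ultimately show ?thesis
    using assms(1-3) by (simp add: gsgn_def card_Un_disjoint power_add)
qed

lemma gsgn_Un_right:
  assumes "finite I" "finite J" "finite K" "J \<inter> K = {}"
  shows "gsgn I (J \<union> K) = gsgn I J * gsgn I K"
proof -
  have "{p \<in> I \<times> (J \<union> K). snd p < fst p} =
      {p \<in> I \<times> J. snd p < fst p} \<union> {p \<in> I \<times> K. snd p < fst p}" by blast
  moreover have "{p \<in> I \<times> J. snd p < fst p} \<inter> {p \<in> I \<times> K. snd p < fst p} = {}"
    using assms(4) by blast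
  ultimately show ?thesis
    using assms(1-3) by (simp add: gsgn_def card_Un_disjoint power_add)
qed

lemma gsgn_empty [simp]: "gsgn {} J = 1" "gsgn I {} = 1"
  by (simp_all add: gsgn_def)

lemma norm_gsgn [simp]: "cmod (gsgn I J) = 1"
  by (simp add: gsgn_def norm_power)

instantiation grassmann :: real_vector
begin
lift_definition zero_grassmann :: grassmann is "\<lambda>_. 0" by simp
lift_definition plus_grassmann :: "grassmann \<Rightarrow> grassmann \<Rightarrow> grassmann" is "\<lambda>f g I. f I + g I"
proof -
  fix f g :: "nat set \<Rightarrow> complex"
  assume f: "finite {I. f I \<noteq> 0} \<and> (\<forall>I. f I \<noteq> 0 \<longrightarrow> finite I)"
    and g: "finite {I. g I \<noteq> 0} \<and> (\<forall>I. g I \<noteq> 0 \<longrightarrow> finite I)"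
  have "finite {I. f I + g I \<noteq> 0}"
    by (rule finite_subset[OF _ finite_UnI[OF conjunct1[OF f] conjunct1[OF g]]]) auto
  moreover have "finite I" if "f I + g I \<noteq> 0" for I
  proof (cases "f I = 0")
    case True
    then show ?thesis using that g by simp
  next
    case False
    then show ?thesis using f by blast
  qed
  ultimately show "finite {I. f I + g I \<noteq> 0} \<and> (\<forall>I. f I + g I \<noteq> 0 \<longrightarrow> finite I)" by blast
qed
lift_definition uminus_grassmann :: "grassmann \<Rightarrow> grassmann" is "\<lambda>f I. - f I" by simp
definition minus_grassmann :: "grassmann \<Rightarrow> grassmann \<Rightarrow> grassmann" where
  "minus_grassmann x y = x + - y"
lift_definition scaleR_grassmann :: "real \<Rightarrow> grassmann \<Rightarrow> grassmann" is "\<lambda>r f I. r *\<^sub>R f I"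
proof -
  fix r :: real and f :: "nat set \<Rightarrow> complex"
  assume f: "finite {I. f I \<noteq> 0} \<and> (\<forall>I. f I \<noteq> 0 \<longrightarrow> finite I)"
  have "finite {I. r *\<^sub>R f I \<noteq> 0}"
    by (rule finite_subset[OF _ conjunct1[OF f]]) auto
  then show "finite {I. r *\<^sub>R f I \<noteq> 0} \<and> (\<forall>I. r *\<^sub>R f I \<noteq> 0 \<longrightarrow> finite I)"
    using f by simp
qed
lemma gcoeff_simps [simp]:
  "gcoeff 0 I = 0" "gcoeff (x + y) I = gcoeff x I + gcoeff y I"
  "gcoeff (- x) I = - gcoeff x I" "gcoeff (x - y) I = gcoeff x I - gcoeff y I"
  "gcoeff (r *\<^sub>R x) I = r *\<^sub>R gcoeff x I"
  by (simp_all add: minus_grassmann_def zero_grassmann.rep_eq plus_grassmann.rep_eq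
      uminus_grassmann.rep_eq scaleR_grassmann.rep_eq)

instance
  by standard (rule grassmann_eqI, simp add: algebra_simps)+
end

instantiation grassmann :: ring_1
begin
lift_definition one_grassmann :: grassmann is "\<lambda>I. if I = {} then 1 else 0" by simp
lift_definition times_grassmann :: "grassmann \<Rightarrow> grassmann \<Rightarrow> grassmann" is
  "\<lambda>f g K. if finite K then \<Sum>I\<in>Pow K. gsgn I (K - I) * f I * g (K - I) else 0"
proof -
  fix f g :: "nat set \<Rightarrow> complex"
  assume f: "finite {I. f I \<noteq> 0} \<and> (\<forall>I. f I \<noteq> 0 \<longrightarrow> finite I)"
    and g: "finite {I. g I \<noteq> 0} \<and> (\<forall>I. g I \<noteq> 0 \<longrightarrow> finite I)"
  let ?h = "\<lambda>K. if finite K then \<Sum>I\<in>Pow K. gsgn I (K - I) * f I * g (K - I) else 0"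
  have "{K. ?h K \<noteq> 0} \<subseteq> (\<lambda>(I, J). I \<union> J) ` ({I. f I \<noteq> 0} \<times> {J. g J \<noteq> 0})"
  proof
    fix K assume "K \<in> {K. ?h K \<noteq> 0}"
    then have "(\<Sum>I\<in>Pow K. gsgn I (K - I) * f I * g (K - I)) \<noteq> 0" by (auto split: if_splits)
    then obtain I where "I \<in> Pow K" "gsgn I (K - I) * f I * g (K - I) \<noteq> 0"
      by (rule sum.not_neutral_contains_not_neutral)
    then show "K \<in> (\<lambda>(I, J). I \<union> J) ` ({I. f I \<noteq> 0} \<times> {J. g J \<noteq> 0})"
      by (intro image_eqI[of _ _ "(I, K - I)"]) auto
  qed
  moreover have "finite ((\<lambda>(I, J). I \<union> J) ` ({I. f I \<noteq> 0} \<times> {J. g J \<noteq> 0}))"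
    using f g by blast
  ultimately show "finite {K. ?h K \<noteq> 0} \<and> (\<forall>K. ?h K \<noteq> 0 \<longrightarrow> finite K)"
    by (intro conjI) (rule finite_subset, assumption+, simp)
qed

lemma gcoeff_times: "gcoeff (x * y) K =
    (if finite K then \<Sum>I\<in>Pow K. gsgn I (K - I) * gcoeff x I * gcoeff y (K - I) else 0)"
  by (simp add: times_grassmann.rep_eq)

lemma gcoeff_one: "gcoeff 1 I = (if I = {} then 1 else 0)"
  by (simp add: one_grassmann.rep_eq)

instance
proof
  fix x y z :: grassmann
  show "x * y * z = x * (y * z)"
  proof (rule grassmann_eqI)
    fix K :: "nat set"
    show "gcoeff (x * y * z) K = gcoeff (x * (y * z)) K"
    proof (cases "finite K")
      case False
      then show ?thesis by (simp add: gcoeff_times)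
    next
      case True
      have fin: "finite I" if "I \<subseteq> K" for I using True that by (rule rev_finite_subset)
      let ?l = "\<lambda>(I, J). gsgn I (K - I) * gsgn J (I - J) *
        (gcoeff x J * gcoeff y (I - J) * gcoeff z (K - I))"
      let ?r = "\<lambda>(J, L). gsgn J (K - J) * gsgn L (K - J - L) *
        (gcoeff x J * gcoeff y L * gcoeff z (K - J - L))"
      have "gcoeff (x * y * z) K = (\<Sum>I\<in>Pow K. \<Sum>J\<in>Pow I. ?l (I, J))"
        using True by (simp add: gcoeff_times fin sum_distrib_left sum_distrib_right mult_ac)
      also have "\<dots> = sum ?l (SIGMA I:Pow K. Pow I)"
        by (subst sum.Sigma) (use True fin in auto)
      also have "\<dots> = sum ?r (SIGMA J:Pow K. Pow (K - J))"
      proof (rule sum.reindex_bij_witness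
          [of _ "\<lambda>(J, L). (J \<union> L, J)" "\<lambda>(I, J). (J, I - J)"], goal_cases)
        case (5 p)
        then obtain I J where p: "p = (I, J)" and sub: "I \<subseteq> K" "J \<subseteq> I" by auto
        define L where "L = I - J"
        define R where "R = K - I"
        have disj: "J \<inter> L = {}" "L \<inter> R = {}" and un: "J \<union> L = I" "L \<union> R = K - J" "K - J - L = R"
          using sub by (auto simp: L_def R_def)
        have fins: "finite J" "finite L" "finite R"
          using sub by (auto intro: fin simp: L_def R_def)
        have "gsgn I R * gsgn J L = gsgn J (K - J) * gsgn L R"
          using gsgn_Un_left[OF fins disj(1)] gsgn_Un_right[OF fins disj(2)] un by simp
        then show ?case
          by (simp add: p un L_def[symmetric] R_def[symmetric])
      qed auto
      also have "\<dots> = (\<Sum>J\<in>Pow K. \<Sum>L\<in>Pow (K - J). ?r (J, L))"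
        by (subst sum.Sigma) (use True fin in auto)
      also have "\<dots> = gcoeff (x * (y * z)) K"
        using True by (simp add: gcoeff_times fin sum_distrib_left sum_distrib_right mult_ac)
      finally show ?thesis .
    qed
  qed
  show "1 * x = x"
  proof (rule grassmann_eqI)
    fix K :: "nat set"
    show "gcoeff (1 * x) K = gcoeff x K"
    proof (cases "finite K")
      case True
      have "gcoeff (1 * x) K = (\<Sum>I\<in>Pow K. if I = {} then gcoeff x K else 0)"
        unfolding gcoeff_times gcoeff_one if_P[OF True]
        by (intro sum.cong) (use True in auto)
      then show ?thesis using True by simp
    qed (simp add: gcoeff_times gcoeff_infinite)
  qed
  show "x * 1 = x"
  proof (rule grassmann_eqI)
    fix K :: "nat set"
    show "gcoeff (x * 1) K = gcoeff x K"
    proof (cases "finite K")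
      case True
      have "gcoeff (x * 1) K = (\<Sum>I\<in>Pow K. if I = K then gcoeff x K else 0)"
        unfolding gcoeff_times gcoeff_one if_P[OF True]
        by (intro sum.cong) (use True in auto)
      then show ?thesis using True by simp
    qed (simp add: gcoeff_times gcoeff_infinite)
  qed
  show "(x + y) * z = x * z + y * z" "x * (y + z) = x * y + x * z"
    by (rule grassmann_eqI, simp add: gcoeff_times distrib_left distrib_right sum.distrib)+
  show "(0::grassmann) \<noteq> 1"
  proof
    assume "(0::grassmann) = 1"
    then have "gcoeff 0 {} = gcoeff 1 {}" by (rule arg_cong)
    then show False by (simp add: gcoeff_one)
  qed
qed
end

instantiation grassmann :: real_normed_vector
begin
definition norm_grassmann :: "grassmann \<Rightarrow> real" where
  "norm x = (\<Sum>I | gcoeff x I \<noteq> 0. cmod (gcoeff x I))"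
definition dist_grassmann :: "grassmann \<Rightarrow> grassmann \<Rightarrow> real" where
  "dist (x::grassmann) y = norm (x - y)"
definition sgn_grassmann :: "grassmann \<Rightarrow> grassmann" where
  "sgn (x::grassmann) = x /\<^sub>R norm x"
definition uniformity_grassmann :: "(grassmann \<times> grassmann) filter" where
  "uniformity = (INF e\<in>{0 <..}. principal {(x::grassmann, y). dist x y < e})"
definition open_grassmann :: "grassmann set \<Rightarrow> bool" where
  "open (U::grassmann set) = (\<forall>x\<in>U. eventually (\<lambda>(x', y). x' = x \<longrightarrow> y \<in> U) uniformity)"

lemma norm_grassmann_superset:
  "finite S \<Longrightarrow> {I. gcoeff x I \<noteq> 0} \<subseteq> S \<Longrightarrow> norm x = (\<Sum>I\<in>S. cmod (gcoeff x I))"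
  unfolding norm_grassmann_def by (rule sum.mono_neutral_left) (assumption, assumption, simp)

instance
proof
  fix x y :: grassmann and a :: real
  show "norm x = 0 \<longleftrightarrow> x = 0"
    unfolding norm_grassmann_def sum_nonneg_eq_0_iff[OF finite_gcoeff norm_ge_zero]
    using grassmann_eqI[of x 0] by (cases "x = 0") (simp_all, blast)
  show "norm (x + y) \<le> norm x + norm y"
  proof -
    let ?S = "{I. gcoeff x I \<noteq> 0} \<union> {I. gcoeff y I \<noteq> 0}"
    have fin: "finite ?S" by (simp add: finite_gcoeff)
    have "norm (x + y) = (\<Sum>I\<in>?S. cmod (gcoeff (x + y) I))"
      by (rule norm_grassmann_superset[OF fin]) auto
    moreover have "norm x = (\<Sum>I\<in>?S. cmod (gcoeff x I))"
      by (rule norm_grassmann_superset[OF fin]) auto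
    moreover have "norm y = (\<Sum>I\<in>?S. cmod (gcoeff y I))"
      by (rule norm_grassmann_superset[OF fin]) auto
    moreover have "(\<Sum>I\<in>?S. cmod (gcoeff (x + y) I)) \<le>
        (\<Sum>I\<in>?S. cmod (gcoeff x I) + cmod (gcoeff y I))"
      by (rule sum_mono) (simp add: norm_triangle_ineq)
    ultimately show ?thesis by (simp only: sum.distrib)
  qed
  show "norm (a *\<^sub>R x) = \<bar>a\<bar> * norm x"
  proof -
    have "norm (a *\<^sub>R x) = (\<Sum>I | gcoeff x I \<noteq> 0. cmod (gcoeff (a *\<^sub>R x) I))"
      by (rule norm_grassmann_superset[OF finite_gcoeff]) (simp add: Collect_mono)
    then show ?thesis unfolding norm_grassmann_def[of x] sum_distrib_left by simp
  qed
qed (fact dist_grassmann_def sgn_grassmann_def uniformity_grassmann_def open_grassmann_def)+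
end

instance grassmann :: real_normed_algebra_1
proof
  fix x y :: grassmann and a :: real
  have "(\<Sum>I\<in>Pow K. gsgn I (K - I) * (a *\<^sub>R gcoeff x I) * gcoeff y (K - I)) =
      a *\<^sub>R (\<Sum>I\<in>Pow K. gsgn I (K - I) * gcoeff x I * gcoeff y (K - I))" for K
    unfolding scaleR_sum_right by (rule sum.cong) simp_all
  then have "gcoeff (a *\<^sub>R x * y) K = gcoeff (a *\<^sub>R (x * y)) K" for K
    by (cases "finite K") (simp_all only: gcoeff_times gcoeff_simps if_True if_False scaleR_zero_right)
  then show "a *\<^sub>R x * y = a *\<^sub>R (x * y)"
    by (rule grassmann_eqI)
  have "(\<Sum>I\<in>Pow K. gsgn I (K - I) * gcoeff x I * (a *\<^sub>R gcoeff y (K - I))) =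
      a *\<^sub>R (\<Sum>I\<in>Pow K. gsgn I (K - I) * gcoeff x I * gcoeff y (K - I))" for K
    unfolding scaleR_sum_right by (rule sum.cong) simp_all
  then have "gcoeff (x * a *\<^sub>R y) K = gcoeff (a *\<^sub>R (x * y)) K" for K
    by (cases "finite K") (simp_all only: gcoeff_times gcoeff_simps if_True if_False scaleR_zero_right)
  then show "x * a *\<^sub>R y = a *\<^sub>R (x * y)"
    by (rule grassmann_eqI)
  show "norm (x * y) \<le> norm x * norm y"
  proof -
    let ?X = "{I. gcoeff x I \<noteq> 0}" and ?Y = "{I. gcoeff y I \<noteq> 0}"
    let ?t = "\<lambda>(K, I). cmod (gcoeff x I) * cmod (gcoeff y (K - I))"
    let ?S = "{K. gcoeff (x * y) K \<noteq> 0}"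
    let ?Z = "{p \<in> (SIGMA K:?S. Pow K). ?t p \<noteq> 0}"
    have finS: "finite ?S" by (rule finite_gcoeff)
    have finK: "finite K" if "K \<in> ?S" for K
      by (rule gcoeff_nonzero_finite[OF CollectD[OF that]])
    have finP: "\<forall>K\<in>?S. finite (Pow K)"
      unfolding finite_Pow_iff by (intro ballI finK)
    have fin: "finite (SIGMA K:?S. Pow K)"
      by (rule finite_SigmaI[OF finS]) (rule bspec[OF finP])
    have "norm (x * y) \<le> (\<Sum>K\<in>?S. \<Sum>I\<in>Pow K. ?t (K, I))"
      unfolding norm_grassmann_def
    proof (rule sum_mono)
      fix K assume "K \<in> ?S"
      then have "finite K" by (rule finK)
      then have "cmod (gcoeff (x * y) K) =
          cmod (\<Sum>I\<in>Pow K. gsgn I (K - I) * gcoeff x I * gcoeff y (K - I))"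
        by (simp only: gcoeff_times if_True)
      also have "\<dots> \<le> (\<Sum>I\<in>Pow K. ?t (K, I))"
        by (rule sum_norm_le) (simp add: norm_mult)
      finally show "cmod (gcoeff (x * y) K) \<le> (\<Sum>I\<in>Pow K. ?t (K, I))" .
    qed
    also have "\<dots> = sum ?t (SIGMA K:?S. Pow K)"
      unfolding sum.Sigma[OF finS finP] by simp
    also have "\<dots> = sum ?t ?Z"
      by (rule sum.mono_neutral_right[OF fin]) blast+
    also have "\<dots> = (\<Sum>(I, J)\<in>(\<lambda>(K, I). (I, K - I)) ` ?Z. cmod (gcoeff x I) * cmod (gcoeff y J))"
      by (subst sum.reindex) (auto simp: inj_on_def intro!: sum.cong)
    also have "\<dots> \<le> (\<Sum>(I, J)\<in>?X \<times> ?Y. cmod (gcoeff x I) * cmod (gcoeff y J))"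
      by (rule sum_mono2) (auto simp: finite_gcoeff)
    also have "\<dots> = norm x * norm y"
      by (simp add: norm_grassmann_def sum_product sum.cartesian_product)
    finally show ?thesis .
  qed
  have "{I. gcoeff (1::grassmann) I \<noteq> 0} = {{}}" by (auto simp: gcoeff_one)
  then show "norm (1::grassmann) = 1" by (simp add: norm_grassmann_def gcoeff_one)
qed

lift_definition gscal :: "complex \<Rightarrow> grassmann" is "\<lambda>c I. if I = {} then c else 0"
  by simp

definition gbody :: "grassmann \<Rightarrow> grassmann" where
  "gbody x = gscal (gcoeff x {})"

definition galg :: "nat \<Rightarrow> grassmann set" where
  "galg s = {x. \<forall>I. gcoeff x I \<noteq> 0 \<longrightarrow> I \<subseteq> {..<s}}"

text \<open>Parities are booleans throughout: \<open>True\<close> is odd.\<close>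

definition gpart :: "bool \<Rightarrow> nat \<Rightarrow> grassmann set" where
  "gpart p s = {x \<in> galg s. \<forall>I. gcoeff x I \<noteq> 0 \<longrightarrow> (odd (card I) \<longleftrightarrow> p)}"

abbreviation "geven \<equiv> gpart False"
abbreviation "godd \<equiv> gpart True"

text \<open>
  A morphism of superpoints \<open>\<real>\<^sup>0\<^sup>|\<^sup>t \<rightarrow> \<real>\<^sup>0\<^sup>|\<^sup>s\<close> is a parity-preserving unital homomorphism of real
  Grassmann algebras in the opposite direction. We take its complex-linear extension; these
  extensions are exactly the complex algebra homomorphisms that preserve elements with
  real coefficients.
\<close>

definition greal :: "grassmann set" where
  "greal = {x. \<forall>I. gcoeff x I \<in> \<real>}"

definition ghom :: "nat \<Rightarrow> nat \<Rightarrow> (grassmann \<Rightarrow> grassmann) set" where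
  "ghom s t = {\<phi> \<in> galg s \<rightarrow>\<^sub>E galg t.
     (\<forall>x\<in>galg s. \<forall>y\<in>galg s. \<phi> (x + y) = \<phi> x + \<phi> y \<and> \<phi> (x * y) = \<phi> x * \<phi> y) \<and>
     (\<forall>c. \<phi> (gscal c) = gscal c) \<and>
     (\<forall>p. \<phi> ` gpart p s \<subseteq> gpart p t) \<and>
     \<phi> ` (galg s \<inter> greal) \<subseteq> greal}"

section \<open>Complex supermanifolds as functors on superpoints\<close>

text \<open>
  A supermanifold is given by its functor of points \<open>B \<mapsto> X(B)\<close> on superpoints
  \<open>B = \<real>\<^sup>0\<^sup>|\<^sup>s\<close> (\<open>pts\<close> on objects, \<open>act\<close> on morphisms, covariant in the Grassmann algebra), a
  topology on the set of \<open>\<real>\<^sup>0\<^sup>|\<^sup>0\<close>-points, and an atlas. The index type \<open>'i\<close> with the parity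
  function \<open>par\<close> records the dimension: the model space has one even or odd coordinate for each
  element of \<open>'i\<close>. A chart \<open>(U, c)\<close> has an open domain \<open>U\<close> in the reduced space, and \<open>c s\<close> is
  its coordinate map on \<open>\<real>\<^sup>0\<^sup>|\<^sup>s\<close>-points over \<open>U\<close>.
\<close>

record ('a, 'i::finite) sman =
  pts :: "nat \<Rightarrow> 'a set"
  act :: "nat \<Rightarrow> nat \<Rightarrow> (grassmann \<Rightarrow> grassmann) \<Rightarrow> 'a \<Rightarrow> 'a"
  base :: "'a topology"
  par :: "'i \<Rightarrow> bool"
  charts :: "('a set \<times> (nat \<Rightarrow> 'a \<Rightarrow> grassmann ^ 'i)) set"

definition over :: "('a, 'i::finite) sman \<Rightarrow> 'a set \<Rightarrow> nat \<Rightarrow> 'a set" where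
  "over X U s = {x \<in> pts X s. act X s 0 (restrict gbody (galg s)) x \<in> U}"

definition open_sub :: "('a, 'i::finite) sman \<Rightarrow> 'a set \<Rightarrow> ('a, 'i) sman" where
  "open_sub X U = X\<lparr>pts := over X U, base := subtopology (base X) U,
     charts := (\<lambda>(W, c). (W \<inter> U, c)) ` charts X\<rparr>"

definition space_pts :: "('i::finite \<Rightarrow> bool) \<Rightarrow> nat \<Rightarrow> (grassmann ^ 'i) set" where
  "space_pts p s = {v. \<forall>i. v $ i \<in> gpart (p i) s}"

text \<open>The affine superspace \<open>\<complex>\<^sup>m\<^sup>|\<^sup>n\<close> with \<open>m\<close>, \<open>n\<close> the numbers of even and odd indices.\<close>

definition superspace :: "('i::finite \<Rightarrow> bool) \<Rightarrow> (grassmann ^ 'i, 'i) sman" where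
  "superspace p = \<lparr>pts = space_pts p, act = (\<lambda>s t \<phi> v. \<chi> i. \<phi> (v $ i)),
     base = top_of_set (space_pts p 0), par = p, charts = {(space_pts p 0, \<lambda>s v. v)}\<rparr>"

text \<open>
  A map between \<open>B\<close>-points of superdomains comes from a holomorphic morphism if it is natural in
  \<open>B\<close> and differentiable with derivative linear over the even part of \<open>O\<^sub>B \<otimes> \<complex>\<close>. That even
  part contains the scalars \<open>\<complex>\<close>, so the derivative is in particular complex linear. Only the
  values of \<open>L\<close> on the model space matter.
\<close>

definition sdiff_at :: "('i::finite \<Rightarrow> bool) \<Rightarrow> nat \<Rightarrow> (grassmann ^ 'i \<Rightarrow> grassmann ^ 'j::finite)
    \<Rightarrow> (grassmann ^ 'i) set \<Rightarrow> grassmann ^ 'i \<Rightarrow> bool" where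
  "sdiff_at p s f A x \<longleftrightarrow> (\<exists>L. (f has_derivative L) (at x within A) \<and>
     (\<forall>k\<in>geven s. \<forall>h\<in>space_pts p s. L (k *s h) = k *s L h))"

definition local_rep :: "('a, 'i::finite) sman \<Rightarrow> (nat \<Rightarrow> 'a \<Rightarrow> 'b)
    \<Rightarrow> 'a set \<Rightarrow> (nat \<Rightarrow> 'a \<Rightarrow> grassmann ^ 'i) \<Rightarrow> (nat \<Rightarrow> 'b \<Rightarrow> grassmann ^ 'j::finite)
    \<Rightarrow> nat \<Rightarrow> grassmann ^ 'i \<Rightarrow> grassmann ^ 'j" where
  "local_rep X f U c d s = (\<lambda>v. d s (f s (inv_into (over X U s) (c s) v)))"

definition local_dom :: "('a, 'i::finite) sman \<Rightarrow> ('b, 'j::finite) sman \<Rightarrow> (nat \<Rightarrow> 'a \<Rightarrow> 'b)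
    \<Rightarrow> 'a set \<Rightarrow> 'b set \<Rightarrow> nat \<Rightarrow> 'a set" where
  "local_dom X Y f U W s = {x \<in> over X U s. f s x \<in> over Y W s}"

definition sdiff_in_charts ::
    "('a, 'i::finite) sman \<Rightarrow> ('b, 'j::finite) sman \<Rightarrow> (nat \<Rightarrow> 'a \<Rightarrow> 'b) \<Rightarrow> bool" where
  "sdiff_in_charts X Y f \<longleftrightarrow> (\<forall>(U, c)\<in>charts X. \<forall>(W, d)\<in>charts Y. \<forall>s. \<forall>x\<in>local_dom X Y f U W s.
     sdiff_at (par X) s (local_rep X f U c d s) (c s ` local_dom X Y f U W s) (c s x))"

definition natural_on :: "(nat \<Rightarrow> 'a set) \<Rightarrow> ('a, 'i::finite) sman \<Rightarrow> ('b, 'j::finite) sman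
    \<Rightarrow> (nat \<Rightarrow> 'a \<Rightarrow> 'b) \<Rightarrow> bool" where
  "natural_on D X Y f \<longleftrightarrow>
     (\<forall>s t. \<forall>\<phi>\<in>ghom s t. \<forall>x\<in>D s. f t (act X s t \<phi> x) = act Y s t \<phi> (f s x))"

definition is_chart ::
    "('a, 'i::finite) sman \<Rightarrow> 'a set \<Rightarrow> (nat \<Rightarrow> 'a \<Rightarrow> grassmann ^ 'i) \<Rightarrow> bool" where
  "is_chart X U c \<longleftrightarrow> openin (base X) U \<and>
     openin (base (superspace (par X))) (c 0 ` U) \<and>
     homeomorphic_map (subtopology (base X) U)
       (subtopology (base (superspace (par X))) (c 0 ` U)) (c 0) \<and>
     (\<forall>s. bij_betw (c s) (over X U s) (over (superspace (par X)) (c 0 ` U) s)) \<and>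
     natural_on (over X U) X (superspace (par X)) c"

definition spoint_functor :: "('a, 'i::finite) sman \<Rightarrow> bool" where
  "spoint_functor X \<longleftrightarrow>
     (\<forall>s t. \<forall>\<phi>\<in>ghom s t. act X s t \<phi> \<in> pts X s \<rightarrow> pts X t) \<and>
     (\<forall>s. \<forall>x\<in>pts X s. act X s s (restrict id (galg s)) x = x) \<and>
     (\<forall>s t u. \<forall>\<phi>\<in>ghom s t. \<forall>\<psi>\<in>ghom t u. \<forall>x\<in>pts X s.
        act X s u (compose (galg s) \<psi> \<phi>) x = act X t u \<psi> (act X s t \<phi> x))"

definition supermanifold :: "('a, 'i::finite) sman \<Rightarrow> bool" where
  "supermanifold X \<longleftrightarrow> spoint_functor X \<and>
     topspace (base X) = pts X 0 \<and> Hausdorff_space (base X) \<and> second_countable (base X) \<and>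
     (\<forall>(U, c)\<in>charts X. is_chart X U c) \<and> (\<Union>(U, c)\<in>charts X. U) = pts X 0 \<and>
     sdiff_in_charts X X (\<lambda>s x. x)"

definition smor ::
    "('a, 'i::finite) sman \<Rightarrow> ('b, 'j::finite) sman \<Rightarrow> (nat \<Rightarrow> 'a \<Rightarrow> 'b) \<Rightarrow> bool" where
  "smor X Y f \<longleftrightarrow> (\<forall>s. f s \<in> pts X s \<rightarrow> pts Y s) \<and> natural_on (pts X) X Y f \<and>
     continuous_map (base X) (base Y) (f 0) \<and> sdiff_in_charts X Y f"

definition sisomorphic :: "('a, 'i::finite) sman \<Rightarrow> ('b, 'j::finite) sman \<Rightarrow> bool" where
  "sisomorphic X Y \<longleftrightarrow> (\<exists>f g. smor X Y f \<and> smor Y X g \<and>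
     (\<forall>s. \<forall>x\<in>pts X s. g s (f s x) = x) \<and> (\<forall>s. \<forall>y\<in>pts Y s. f s (g s y) = y))"

definition simmersion ::
    "('a, 'i::finite) sman \<Rightarrow> ('b, 'j::finite) sman \<Rightarrow> (nat \<Rightarrow> 'a \<Rightarrow> 'b) \<Rightarrow> bool" where
  "simmersion X Y f \<longleftrightarrow> smor X Y f \<and>
     (\<forall>(U, c)\<in>charts X. \<forall>(W, d)\<in>charts Y. \<forall>s. \<forall>x\<in>local_dom X Y f U W s.
        \<exists>L. (local_rep X f U c d s has_derivative L)
              (at (c s x) within c s ` local_dom X Y f U W s) \<and>
            inj_on L (space_pts (par X) s))"

definition ssubmersion ::
    "('a, 'i::finite) sman \<Rightarrow> ('b, 'j::finite) sman \<Rightarrow> (nat \<Rightarrow> 'a \<Rightarrow> 'b) \<Rightarrow> bool" where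
  "ssubmersion X Y f \<longleftrightarrow> smor X Y f \<and>
     (\<forall>(U, c)\<in>charts X. \<forall>(W, d)\<in>charts Y. \<forall>s. \<forall>x\<in>local_dom X Y f U W s.
        \<exists>L. (local_rep X f U c d s has_derivative L)
              (at (c s x) within c s ` local_dom X Y f U W s) \<and>
            L ` space_pts (par X) s = space_pts (par Y) s)"

definition sembedding ::
    "('a, 'i::finite) sman \<Rightarrow> ('b, 'j::finite) sman \<Rightarrow> (nat \<Rightarrow> 'a \<Rightarrow> 'b) \<Rightarrow> bool" where
  "sembedding X Y f \<longleftrightarrow> simmersion X Y f \<and> embedding_map (base X) (base Y) (f 0)"

definition sprod ::
    "('a, 'i::finite) sman \<Rightarrow> ('b, 'j::finite) sman \<Rightarrow> ('a \<times> 'b, 'i + 'j) sman" where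
  "sprod X Y = \<lparr>pts = (\<lambda>s. pts X s \<times> pts Y s),
     act = (\<lambda>s t \<phi> (x, y). (act X s t \<phi> x, act Y s t \<phi> y)),
     base = prod_topology (base X) (base Y), par = case_sum (par X) (par Y),
     charts = {(U \<times> W, \<lambda>s (x, y). \<chi> k. case_sum (\<lambda>i. c s x $ i) (\<lambda>j. d s y $ j) k) | U c W d.
       (U, c) \<in> charts X \<and> (W, d) \<in> charts Y}\<rparr>"

text \<open>
  The structure of an embedded supermanifold of dimension \<open>q\<close> on a subfunctor \<open>P\<close> of the
  superspace \<open>p\<close> (included by the coordinate map \<open>\<kappa>\<close>): its charts are all charts \<open>(U, c)\<close> whose
  inverse is a morphism into the ambient superspace and which extend locally to morphisms
  on open subsets of the ambient superspace.
\<close>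

definition embedded :: "('i::finite \<Rightarrow> bool) \<Rightarrow> ('j::finite \<Rightarrow> bool) \<Rightarrow> ('a \<Rightarrow> grassmann ^ 'j)
    \<Rightarrow> (nat \<Rightarrow> nat \<Rightarrow> (grassmann \<Rightarrow> grassmann) \<Rightarrow> 'a \<Rightarrow> 'a) \<Rightarrow> (nat \<Rightarrow> 'a set) \<Rightarrow> ('a, 'i) sman" where
  "embedded q p \<kappa> a P =
     (let X = \<lparr>pts = P, act = a, base = pullback_topology (P 0) \<kappa> euclidean, par = q, charts = {}\<rparr>
      in X\<lparr>charts := {(U, c). is_chart X U c \<and>
        smor (open_sub (superspace q) (c 0 ` U)) (superspace p)
          (\<lambda>s v. \<kappa> (inv_into (over X U s) (c s) v)) \<and>
        (\<forall>x\<in>U. \<exists>W F. openin (base (superspace p)) W \<and> \<kappa> x \<in> W \<and>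
           smor (open_sub (superspace p) W) (superspace q) F \<and>
           (\<forall>s. \<forall>y\<in>over X U s. \<kappa> y \<in> over (superspace p) W s \<longrightarrow> F s (\<kappa> y) = c s y))}\<rparr>)"

section \<open>Super Lie groups and coset spaces\<close>

definition super_lie_group :: "('a, 'i::finite) sman \<Rightarrow> (nat \<Rightarrow> 'a monoid) \<Rightarrow> bool" where
  "super_lie_group X G \<longleftrightarrow> supermanifold X \<and> (\<forall>s. group (G s) \<and> carrier (G s) = pts X s) \<and>
     smor (sprod X X) X (\<lambda>s (x, y). x \<otimes>\<^bsub>G s\<^esub> y) \<and> smor X X (\<lambda>s. m_inv (G s))"

definition super_lie_embedding :: "('a, 'i::finite) sman \<Rightarrow> (nat \<Rightarrow> 'a monoid)
    \<Rightarrow> ('b, 'j::finite) sman \<Rightarrow> (nat \<Rightarrow> 'b monoid) \<Rightarrow> (nat \<Rightarrow> 'a \<Rightarrow> 'b) \<Rightarrow> bool" where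
  "super_lie_embedding X H Y G \<iota> \<longleftrightarrow> super_lie_group X H \<and> super_lie_group Y G \<and>
     (\<forall>s. \<iota> s \<in> hom (H s) (G s)) \<and> sembedding X Y \<iota>"

definition coset_proj ::
    "(nat \<Rightarrow> 'a monoid) \<Rightarrow> (nat \<Rightarrow> 'b monoid) \<Rightarrow> (nat \<Rightarrow> 'a \<Rightarrow> 'b) \<Rightarrow> nat \<Rightarrow> 'b \<Rightarrow> 'b set" where
  "coset_proj H G \<iota> s g = (\<iota> s ` carrier (H s)) #>\<^bsub>G s\<^esub> g"

definition quotient_topology :: "'a topology \<Rightarrow> ('a \<Rightarrow> 'b) \<Rightarrow> 'b topology" where
  "quotient_topology T f =
     topology (\<lambda>U. U \<subseteq> f ` topspace T \<and> openin T {x \<in> topspace T. f x \<in> U})"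

lemma openin_quotient_topology:
  "openin (quotient_topology T f) U \<longleftrightarrow>
     U \<subseteq> f ` topspace T \<and> openin T {x \<in> topspace T. f x \<in> U}"
proof -
  have "istopology (\<lambda>U. U \<subseteq> f ` topspace T \<and> openin T {x \<in> topspace T. f x \<in> U})"
    unfolding istopology_def
  proof (intro conjI allI impI)
    fix S V assume S: "S \<subseteq> f ` topspace T \<and> openin T {x \<in> topspace T. f x \<in> S}"
      and V: "V \<subseteq> f ` topspace T \<and> openin T {x \<in> topspace T. f x \<in> V}"
    show "S \<inter> V \<subseteq> f ` topspace T" using S by blast
    have "{x \<in> topspace T. f x \<in> S \<inter> V} =
        {x \<in> topspace T. f x \<in> S} \<inter> {x \<in> topspace T. f x \<in> V}" by auto
    then show "openin T {x \<in> topspace T. f x \<in> S \<inter> V}" using S V by auto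
  next
    fix \<K> assume K: "\<forall>K\<in>\<K>. K \<subseteq> f ` topspace T \<and> openin T {x \<in> topspace T. f x \<in> K}"
    show "\<Union>\<K> \<subseteq> f ` topspace T" using K by blast
    have "{x \<in> topspace T. f x \<in> \<Union>\<K>} = (\<Union>K\<in>\<K>. {x \<in> topspace T. f x \<in> K})" by auto
    then show "openin T {x \<in> topspace T. f x \<in> \<Union>\<K>}" using K by auto
  qed
  then show ?thesis by (simp add: quotient_topology_def topology_inverse')
qed

text \<open>
  The quotient of \<open>(Y, G)\<close> by left multiplication by the image of \<open>H\<close>: its \<open>B\<close>-points are the
  cosets \<open>\<iota>(H(B)) g\<close>, its reduced space has the quotient topology, and its charts are those for
  which the coset projection is a morphism and has local sections that are morphisms. This
  is the usual characterisation of the manifold structure on a homogeneous space. The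
  dimension \<open>q\<close> has to be supplied because dimensions are types; for a wrong \<open>q\<close> the charts
  do not cover and the result is not a supermanifold.
\<close>

definition coset_space :: "('k::finite \<Rightarrow> bool) \<Rightarrow> (nat \<Rightarrow> 'a monoid)
    \<Rightarrow> ('b, 'j::finite) sman \<Rightarrow> (nat \<Rightarrow> 'b monoid) \<Rightarrow> (nat \<Rightarrow> 'a \<Rightarrow> 'b) \<Rightarrow> ('b set, 'k) sman" where
  "coset_space q H Y G \<iota> =
     (let \<pi> = coset_proj H G \<iota>;
          X = \<lparr>pts = (\<lambda>s. rcosets\<^bsub>G s\<^esub> (\<iota> s ` carrier (H s))),
               act = (\<lambda>s t \<phi> C. (\<Union>g\<in>C. \<pi> t (act Y s t \<phi> g))),
               base = quotient_topology (base Y) (\<pi> 0), par = q, charts = {}\<rparr>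
      in X\<lparr>charts := {(U, c). is_chart X U c \<and>
        smor (open_sub Y {g \<in> pts Y 0. \<pi> 0 g \<in> U}) (superspace q) (\<lambda>s g. c s (\<pi> s g)) \<and>
        (\<forall>v\<in>c 0 ` U. \<exists>V \<sigma>. openin (base (superspace q)) V \<and> v \<in> V \<and> V \<subseteq> c 0 ` U \<and>
           smor (open_sub (superspace q) V) Y \<sigma> \<and>
           (\<forall>s. \<forall>w\<in>over (superspace q) V s.
              \<pi> s (\<sigma> s w) \<in> over X U s \<and> c s (\<pi> s (\<sigma> s w)) = w))}\<rparr>)"

section \<open>The groups\<close>

definition mat_act :: "nat \<Rightarrow> nat \<Rightarrow> (grassmann \<Rightarrow> grassmann) \<Rightarrow> grassmann ^ 'n ^ 'm
    \<Rightarrow> grassmann ^ 'n ^ 'm" where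
  "mat_act s t \<phi> A = (\<chi> i j. \<phi> (A $ i $ j))"

definition mat_coords :: "grassmann ^ 'n ^ 'm \<Rightarrow> grassmann ^ ('m \<times> 'n)" where
  "mat_coords A = (\<chi> k. A $ fst k $ snd k)"

definition mat_grp :: "(nat \<Rightarrow> (grassmann ^ 'n ^ 'n) set) \<Rightarrow> nat \<Rightarrow> (grassmann ^ 'n ^ 'n) monoid" where
  "mat_grp P s = \<lparr>carrier = P s, monoid.mult = (**), one = mat 1\<rparr>"

definition SL2_pts :: "nat \<Rightarrow> (grassmann ^ 2 ^ 2) set" where
  "SL2_pts s = {vector [vector [a, c], vector [b, d]] | a b c d.
     {a, b, c, d} \<subseteq> geven s \<and> a * d - b * c = 1}"

definition SL2 :: "(grassmann ^ 2 ^ 2, 3) sman" where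
  "SL2 = embedded (\<lambda>_. False) (\<lambda>_. False) mat_coords mat_act SL2_pts"

definition SC_pts :: "nat \<Rightarrow> (grassmann ^ 3 ^ 3) set" where
  "SC_pts s = {M. invertible M \<and> (\<exists>a b c d e \<alpha> \<beta> \<gamma> \<delta>.
     M = vector [vector [a, c, \<gamma>], vector [b, d, \<delta>], vector [\<alpha>, \<beta>, e]] \<and>
     {a, b, c, d, e} \<subseteq> geven s \<and> {\<alpha>, \<beta>, \<gamma>, \<delta>} \<subseteq> godd s \<and>
     a * d - b * c - \<gamma> * \<delta> = 1 \<and> e\<^sup>2 + 2 * \<alpha> * \<beta> = 1 \<and>
     c * \<alpha> - a * \<beta> = e * \<gamma> \<and> d * \<alpha> - b * \<beta> = e * \<delta> \<and> gbody e = 1)}"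

text \<open>An entry of a supermatrix is odd if exactly one of its row and column is the third.\<close>

definition SC :: "(grassmann ^ 3 ^ 3, 3 + 2) sman" where
  "SC = embedded (case_sum (\<lambda>_. False) (\<lambda>_. True)) (\<lambda>(i, j). (i = 3) \<noteq> (j = 3))
     mat_coords mat_act SC_pts"

definition SL2_emb :: "nat \<Rightarrow> grassmann ^ 2 ^ 2 \<Rightarrow> grassmann ^ 3 ^ 3" where
  "SL2_emb s A = vector [vector [A $ 1 $ 1, A $ 1 $ 2, 0], vector [A $ 2 $ 1, A $ 2 $ 2, 0],
     vector [0, 0, 1]]"

abbreviation "SL2_grp \<equiv> mat_grp SL2_pts"
abbreviation "SC_grp \<equiv> mat_grp SC_pts"

definition SUSY :: "((grassmann ^ 3 ^ 3) set, 2) sman" where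
  "SUSY = coset_space (\<lambda>_. True) SL2_grp SC SC_grp SL2_emb"

end

theory Submission
  imports Defs
begin

text \<open>
  Eliminating the defining equations shows that a point of \<open>SC\<close> is determined by its even
  \<open>2 \<times> 2\<close> block \<open>(a, c; b, d)\<close> and its third row \<open>(\<alpha>, \<beta>)\<close>, subject only to
  \<open>ad - bc = 1 + \<alpha>\<beta>\<close>; the other entries are \<open>e = 1 - \<alpha>\<beta>\<close>, \<open>\<gamma> = c\<alpha> - a\<beta>\<close>, \<open>\<delta> = d\<alpha> - b\<beta>\<close>. So \<open>SC\<close> and \<open>SL2\<close>
  are covered by graphs over the loci where \<open>a\<close> or \<open>b\<close> is invertible. Left multiplication by \<open>SL2\<close>
  does not change the third row, and two points of \<open>SC\<close> with the same third row differ by an element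
  of \<open>SL2\<close>. Hence \<open>(\<alpha>, \<beta>)\<close> is a global coordinate on the quotient, with the
  global section that sends \<open>(\<alpha>, \<beta>)\<close> to the point with \<open>a = 1\<close>, \<open>b = c = 0\<close>, \<open>d = 1 + \<alpha>\<beta>\<close>.
\<close>

text \<open>\<open>embedded\<close> and \<open>coset_space\<close> admit every chart that meets a
  condition, so each smoothness claim quantifies over unknown charts. Two transfer principles cope
  with this. A map into an embedded supermanifold is a morphism as soon as its matrix entries are
  smooth (\<open>smor_into_embedded\<close>), because charts extend locally to the ambient space. A
  map on the quotient is smooth as soon as its composite with the projection is
  (\<open>sdat_descend\<close>), because charts have local sections. What remains concerns scalar
  functions (\<open>sfun\<close>) built from entries by ring operations and inverses. Derivatives
  are taken within \<open>space_pts p s\<close>, a subspace of an infinite-dimensional space, so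
  uniqueness is available only in directions of that subspace. The value of e is the root of e^2 = 1
  - 2\<alpha>\<beta> with body 1; multiplying by its inverse 1 + \<alpha>\<beta> yields \<gamma> and
  \<delta>. The body of ad - bc is 1, so a and b cannot both have zero body. Over
  \<open>s = 0\<close> there are no odd elements, so the reduced quotient is a single point.\<close>

section \<open>Signs and supports of products in the Grassmann algebra\<close>

text \<open>For disjoint sets each pair in \<open>I \<times> J\<close> is an inversion either of (I,
  J) or, after swapping, of (J, I), so the two inversion numbers add up to the product of the
  cardinalities.\<close>

lemma gsgn_commute:
  assumes "finite I" "finite J" "I \<inter> J = {}"
  shows "gsgn I J = (-1) ^ (card I * card J) * gsgn J I"
proof -
  let ?A = "{p \<in> I \<times> J. snd p < fst p}" and ?B = "{p \<in> J \<times> I. snd p < fst p}"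
  have "I \<times> J = ?A \<union> prod.swap ` ?B"
    using assms(3) by (auto simp: image_iff intro: linorder_neqE_nat)
  then have "card I * card J = card (?A \<union> prod.swap ` ?B)"
    by (metis card_cartesian_product)
  also have "\<dots> = card ?A + card (prod.swap ` ?B)"
    using assms by (intro card_Un_disjoint) auto
  also have "card (prod.swap ` ?B) = card ?B"
    by (rule card_image) (auto simp: inj_on_def)
  finally show ?thesis
    by (simp add: gsgn_def power_add mult.assoc flip: power_mult_distrib)
qed

text \<open>A monomial that occurs in a product splits into a monomial of each factor. The grading
  of products and the degree bound behind nilpotency are read off from this splitting.\<close>

lemma gcoeff_times_nonzeroE:
  assumes "gcoeff (x * y) K \<noteq> 0"
  obtains I where "finite K" "I \<subseteq> K" "gcoeff x I \<noteq> 0" "gcoeff y (K - I) \<noteq> 0"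
proof -
  have K: "finite K" by (rule gcoeff_nonzero_finite[OF assms])
  then have "(\<Sum>I\<in>Pow K. gsgn I (K - I) * gcoeff x I * gcoeff y (K - I)) \<noteq> 0"
    using assms by (simp add: gcoeff_times)
  then obtain I where "I \<in> Pow K" "gsgn I (K - I) * gcoeff x I * gcoeff y (K - I) \<noteq> 0"
    by (rule sum.not_neutral_contains_not_neutral)
  then show thesis using K that[of I] by auto
qed

lemma gcoeff_gscal: "gcoeff (gscal c) I = (if I = {} then c else 0)"
  by (simp add: gscal.rep_eq)

lemma gscal_simps [simp]: "gscal 0 = 0" "gscal 1 = 1"
  by (rule grassmann_eqI, simp add: gcoeff_gscal gcoeff_one)+

lemma gscal_add: "gscal (a + b) = gscal a + gscal b"
  and gscal_minus: "gscal (- a) = - gscal a"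
  by (rule grassmann_eqI, simp add: gcoeff_gscal)+

lemma gcoeff_times_empty: "gcoeff (x * y) {} = gcoeff x {} * gcoeff y {}"
  by (simp add: gcoeff_times)

lemma gcoeff_gscal_times: "gcoeff (gscal c * x) K = c * gcoeff x K"
proof (cases "finite K")
  case True
  have "gcoeff (gscal c * x) K = (\<Sum>I\<in>Pow K. if I = {} then c * gcoeff x K else 0)"
    unfolding gcoeff_times gcoeff_gscal if_P[OF True]
    by (intro sum.cong) (use True in auto)
  then show ?thesis using True by simp
qed (simp add: gcoeff_infinite)

lemma gscal_mult: "gscal (a * b) = gscal a * gscal b"
  by (rule grassmann_eqI) (simp add: gcoeff_gscal_times gcoeff_gscal)

lemma gbody_simps [simp]:
  "gbody (x + y) = gbody x + gbody y" "gbody (- x) = - gbody x" "gbody (x - y) = gbody x - gbody y"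
  "gbody (x * y) = gbody x * gbody y" "gbody (gscal c) = gscal c" "gbody 0 = 0" "gbody 1 = 1"
  "gbody (gbody x) = gbody x" "gcoeff (gbody x) {} = gcoeff x {}"
proof -
  show "gbody (x - y) = gbody x - gbody y"
    by (rule grassmann_eqI) (simp add: gbody_def gcoeff_gscal)
qed (simp_all add: gbody_def gcoeff_gscal gscal_add gscal_minus gscal_mult gcoeff_times_empty
    gcoeff_one)

section \<open>Parity subspaces and graded commutativity\<close>

lemma gpart_galg: "x \<in> gpart p s \<Longrightarrow> x \<in> galg s"
  by (simp add: gpart_def)

lemma gpart_zero [simp]: "0 \<in> gpart p s"
  by (simp add: gpart_def galg_def)

lemma gpart_add [intro]: "x \<in> gpart p s \<Longrightarrow> y \<in> gpart p s \<Longrightarrow> x + y \<in> gpart p s"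
  unfolding gpart_def galg_def mem_Collect_eq gcoeff_simps by (metis add.right_neutral)

lemma gpart_minus [intro]: "x \<in> gpart p s \<Longrightarrow> - x \<in> gpart p s"
  by (simp add: gpart_def galg_def)

lemma gpart_diff [intro]: "x \<in> gpart p s \<Longrightarrow> y \<in> gpart p s \<Longrightarrow> x - y \<in> gpart p s"
  using gpart_add[of x p s "- y"] gpart_minus by simp

lemma gpart_scaleR [intro]: "x \<in> gpart p s \<Longrightarrow> r *\<^sub>R x \<in> gpart p s"
  by (simp add: gpart_def galg_def)

lemma gscal_geven [simp]: "gscal c \<in> geven s"
  by (simp add: gpart_def galg_def gcoeff_gscal)

lemma one_geven [simp]: "1 \<in> geven s"
  using gscal_geven[of 1] by simp

lemma gbody_geven [simp]: "gbody x \<in> geven s"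
  by (simp add: gbody_def)

lemma galg_add: "x \<in> galg s \<Longrightarrow> y \<in> galg s \<Longrightarrow> x + y \<in> galg s"
  unfolding galg_def mem_Collect_eq gcoeff_simps by (metis add.right_neutral)

lemma galg_minus: "x \<in> galg s \<Longrightarrow> - x \<in> galg s"
  by (simp add: galg_def)

lemma galg_mult: "x \<in> galg s \<Longrightarrow> y \<in> galg s \<Longrightarrow> x * y \<in> galg s"
  unfolding galg_def mem_Collect_eq
  by (metis Diff_partition Un_least gcoeff_times_nonzeroE)

lemma gpart_mult:
  assumes "x \<in> gpart p s" "y \<in> gpart q s"
  shows "x * y \<in> gpart (p \<noteq> q) s"
  unfolding gpart_def mem_Collect_eq
proof (intro conjI allI impI)
  show "x * y \<in> galg s" using assms by (intro galg_mult gpart_galg)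
  fix K assume "gcoeff (x * y) K \<noteq> 0"
  then obtain I where I: "finite K" "I \<subseteq> K" "gcoeff x I \<noteq> 0" "gcoeff y (K - I) \<noteq> 0"
    by (rule gcoeff_times_nonzeroE)
  have "odd (card I) = p" "odd (card (K - I)) = q" using assms I by (auto simp: gpart_def)
  moreover have "card K = card I + card (K - I)"
    using I by (metis card_Diff_subset card_mono finite_subset le_add_diff_inverse)
  ultimately show "odd (card K) = (p \<noteq> q)" by auto
qed

lemma gpart_mult_even_odd [intro]:
  "x \<in> geven s \<Longrightarrow> y \<in> geven s \<Longrightarrow> x * y \<in> geven s"
  "x \<in> geven s \<Longrightarrow> y \<in> godd s \<Longrightarrow> x * y \<in> godd s"
  "x \<in> godd s \<Longrightarrow> y \<in> geven s \<Longrightarrow> x * y \<in> godd s"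
  "x \<in> godd s \<Longrightarrow> y \<in> godd s \<Longrightarrow> x * y \<in> geven s"
  using gpart_mult[of x _ s y] by force+

text \<open>The substitution of \<open>K - I\<close> for \<open>I\<close> turns the convolution sum
  of one product into that of the other. Where both coefficients are nonzero, the parities fix the
  sign of \<open>gsgn_commute\<close>, the same for all terms; the remaining terms vanish on both
  sides.\<close>

lemma gpart_commute:
  assumes "x \<in> gpart p s" "y \<in> gpart q s"
  shows "x * y = (if p \<and> q then - (y * x) else y * x)"
proof (rule grassmann_eqI)
  fix K
  show "gcoeff (x * y) K = gcoeff (if p \<and> q then - (y * x) else y * x) K"
  proof (cases "finite K")
    case False
    then show ?thesis by (simp add: gcoeff_infinite)
  next
    case True
    let ?\<epsilon> = "if p \<and> q then - 1 else 1 :: complex"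
    have "gcoeff (x * y) K = (\<Sum>I\<in>Pow K. gsgn I (K - I) * gcoeff x I * gcoeff y (K - I))"
      using True by (simp add: gcoeff_times)
    also have "\<dots> = (\<Sum>J\<in>Pow K. ?\<epsilon> * (gsgn J (K - J) * gcoeff y J * gcoeff x (K - J)))"
    proof (rule sum.reindex_bij_witness[of _ "\<lambda>J. K - J" "\<lambda>I. K - I"], goal_cases)
      case (5 I)
      then have I: "I \<subseteq> K" "K - (K - I) = I" by auto
      show ?case
      proof (cases "gcoeff x I = 0 \<or> gcoeff y (K - I) = 0")
        case False
        then have "odd (card I) = p" "odd (card (K - I)) = q"
          using assms by (auto simp: gpart_def)
        then have "(-1::complex) ^ (card I * card (K - I)) = ?\<epsilon>" by auto
        then have "gsgn I (K - I) = ?\<epsilon> * gsgn (K - I) I"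
          using gsgn_commute[of I "K - I"] True I finite_subset by force
        then show ?thesis by (simp add: I)
      qed (auto simp: I)
    qed auto
    also have "\<dots> = ?\<epsilon> * gcoeff (y * x) K"
      using True by (simp add: gcoeff_times sum_distrib_left)
    finally show ?thesis by simp
  qed
qed

lemma geven_commute: "x \<in> geven s \<Longrightarrow> y \<in> gpart p s \<Longrightarrow> x * y = y * x"
  using gpart_commute[of x False s y p] by simp

lemma godd_anticommute: "x \<in> godd s \<Longrightarrow> y \<in> godd s \<Longrightarrow> x * y = - (y * x)"
  using gpart_commute[of x True s y True] by simp

lemma gcoeff_godd_empty: "x \<in> godd s \<Longrightarrow> gcoeff x {} = 0"
  by (force simp: gpart_def)

lemma godd_square: 
  assumes "x \<in> godd s" shows "x * x = 0"
proof -
  have "x * x = - (x * x)" by (rule godd_anticommute[OF assms assms])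
  then have "gcoeff (x * x) I = - gcoeff (x * x) I" for I by (metis gcoeff_simps(3))
  then show ?thesis by (intro grassmann_eqI) (simp add: eq_neg_iff_add_eq_0)
qed

subsection \<open>Inverses of even elements\<close>

text \<open>The ring is not commutative, so a two-sided inverse is chosen; this makes the choice
  unique whenever one exists. Elsewhere the value is arbitrary.\<close>

definition ginv :: "grassmann \<Rightarrow> grassmann" where
  "ginv x = (SOME y. x * y = 1 \<and> y * x = 1)"

lemma ginv_unique:
  assumes "x * y = 1" "y * x = 1"
  shows "ginv x = y"
proof -
  have "x * ginv x = 1 \<and> ginv x * x = 1"
    unfolding ginv_def by (rule someI[where x = y]) (use assms in simp)
  then show ?thesis by (metis assms(2) mult.assoc mult_1_left mult_1_right)
qed

text \<open>Each factor of the power contributes a nonempty set of generators, and the sets of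
  different factors are disjoint.\<close>

lemma gcoeff_power_card:
  assumes "gcoeff n {} = 0" "gcoeff (n ^ k) I \<noteq> 0"
  shows "k \<le> card I"
  using assms(2)
proof (induction k arbitrary: I)
  case (Suc k)
  then have "gcoeff (n * n ^ k) I \<noteq> 0" by simp
  then obtain J where J: "finite I" "J \<subseteq> I" "gcoeff n J \<noteq> 0" "gcoeff (n ^ k) (I - J) \<noteq> 0"
    by (rule gcoeff_times_nonzeroE)
  have "J \<noteq> {}" using J assms(1) by auto
  then have "card (I - J) < card I" using J by (intro psubset_card_mono) auto
  then show ?case using Suc.IH[OF J(4)] by simp
qed simp

lemma galg_power: "x \<in> galg s \<Longrightarrow> x ^ k \<in> galg s"
  by (induction k) (auto simp: galg_mult gpart_galg[OF one_geven])

text \<open>Only \<open>s\<close> generators are available, while a monomial of the power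
  \<open>Suc s\<close> would need at least \<open>s + 1\<close> of them.\<close>

lemma galg_nilpotent:
  assumes "n \<in> galg s" "gcoeff n {} = 0"
  shows "n ^ Suc s = 0"
proof (rule grassmann_eqI, rule ccontr)
  fix I assume "gcoeff (n ^ Suc s) I \<noteq> gcoeff 0 I"
  then have I: "gcoeff (n ^ Suc s) I \<noteq> 0" by (simp only: gcoeff_simps) simp
  then have "I \<subseteq> {..<s}"
    using galg_power[OF assms(1), of "Suc s"] unfolding galg_def by blast
  then have "card I \<le> s" using card_mono[of "{..<s}" I] by simp
  then show False using gcoeff_power_card[OF assms(2) I] by simp
qed

lemma gpart_sum: "(\<And>i. i \<in> A \<Longrightarrow> f i \<in> gpart p s) \<Longrightarrow> sum f A \<in> gpart p s"
  by (induction A rule: infinite_finite_induct) auto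

lemma geven_power: "x \<in> geven s \<Longrightarrow> x ^ k \<in> geven s"
  by (induction k) auto

text \<open>After division by the body the element is 1 - n with n nilpotent, so the geometric
  series terminates and gives the inverse, again even.\<close>

lemma geven_inverse_exists:
  assumes "x \<in> geven s" "gcoeff x {} \<noteq> 0"
  shows "\<exists>y\<in>geven s. x * y = 1 \<and> y * x = 1"
proof -
  define b where "b = gscal (1 / gcoeff x {})"
  define n where "n = 1 - b * x"
  define y where "y = b * (\<Sum>i<Suc s. n ^ i)"
  have b: "b \<in> geven s" by (simp add: b_def)
  have n: "n \<in> geven s" unfolding n_def using assms b by (intro gpart_diff gpart_mult_even_odd) auto
  have n0: "gcoeff n {} = 0"
    using assms(2) by (simp add: n_def b_def gcoeff_gscal_times gcoeff_one)
  have "n ^ Suc s = 0" by (rule galg_nilpotent[OF gpart_galg[OF n] n0])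
  have geo: "(1 - n) * (\<Sum>i<k. n ^ i) = 1 - n ^ k" for k
  proof (induction k)
    case (Suc k)
    have "(1 - n) * (\<Sum>i<Suc k. n ^ i) = (1 - n) * (\<Sum>i<k. n ^ i) + (1 - n) * n ^ k"
      by (simp add: distrib_left)
    then show ?case by (simp only: Suc.IH) (simp add: algebra_simps)
  qed simp
  have y: "y \<in> geven s"
    unfolding y_def using b n by (intro gpart_mult_even_odd gpart_sum geven_power)
  have "x * y = b * x * (\<Sum>i<Suc s. n ^ i)"
    using geven_commute[OF assms(1) b] by (simp only: y_def mult.assoc[symmetric])
  also have "\<dots> = 1" using geo[of "Suc s"] \<open>n ^ Suc s = 0\<close> by (simp add: n_def)
  finally show ?thesis using y geven_commute[OF assms(1) y] by auto
qed

lemma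
  assumes "x \<in> geven s" "gcoeff x {} \<noteq> 0"
  shows ginv_right: "x * ginv x = 1" and ginv_left: "ginv x * x = 1" and ginv_geven: "ginv x \<in> geven s"
proof -
  obtain y where "y \<in> geven s" "x * y = 1" "y * x = 1"
    using geven_inverse_exists[OF assms] by blast
  moreover from this have "ginv x = y" by (intro ginv_unique)
  ultimately show "x * ginv x = 1" "ginv x * x = 1" "ginv x \<in> geven s" by simp_all
qed

subsection \<open>Homomorphisms of Grassmann algebras\<close>

lemma ghomD:
  assumes "\<phi> \<in> ghom s t"
  shows "x \<in> galg s \<Longrightarrow> \<phi> x \<in> galg t"
    "x \<in> galg s \<Longrightarrow> y \<in> galg s \<Longrightarrow> \<phi> (x + y) = \<phi> x + \<phi> y"
    "x \<in> galg s \<Longrightarrow> y \<in> galg s \<Longrightarrow> \<phi> (x * y) = \<phi> x * \<phi> y"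
    "\<phi> (gscal c) = gscal c" "x \<in> gpart p s \<Longrightarrow> \<phi> x \<in> gpart p t"
  using assms unfolding ghom_def by blast+

lemma ghom_minus:
  assumes "\<phi> \<in> ghom s t" "x \<in> galg s"
  shows "\<phi> (- x) = - \<phi> x"
proof -
  have "\<phi> (x + - x) = \<phi> x + \<phi> (- x)"
    using assms by (intro ghomD(2)[OF assms(1)] galg_minus)
  moreover have "\<phi> 0 = 0" using ghomD(4)[OF assms(1), of 0] by simp
  ultimately show ?thesis by (simp add: eq_neg_iff_add_eq_0 add.commute)
qed

lemma ghom_diff:
  "\<phi> \<in> ghom s t \<Longrightarrow> x \<in> galg s \<Longrightarrow> y \<in> galg s \<Longrightarrow> \<phi> (x - y) = \<phi> x - \<phi> y"
  using ghomD(2)[of \<phi> s t x "- y"] ghom_minus[of \<phi> s t y] galg_minus by simp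

lemma ghom_ginv:
  assumes "\<phi> \<in> ghom s t" "x \<in> geven s" "gcoeff x {} \<noteq> 0"
  shows "\<phi> (ginv x) = ginv (\<phi> x)"
proof -
  have "x \<in> galg s" "ginv x \<in> galg s"
    using assms ginv_geven gpart_galg by blast+
  then have "\<phi> x * \<phi> (ginv x) = 1" "\<phi> (ginv x) * \<phi> x = 1"
    using ginv_right[OF assms(2,3)] ginv_left[OF assms(2,3)] ghomD(3,4)[OF assms(1)]
    by (metis gscal_simps(2))+
  then show ?thesis by (rule ginv_unique[symmetric])
qed

lemma gbody_odd: "x \<in> godd s \<Longrightarrow> gbody x = 0"
  by (simp add: gbody_def gcoeff_godd_empty)

abbreviation bodyhom :: "nat \<Rightarrow> grassmann \<Rightarrow> grassmann" where
  "bodyhom s \<equiv> restrict gbody (galg s)"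

text \<open>The body map lands in the scalars, which lie in every \<open>galg t\<close>, and it
  kills odd elements, so it respects both parities. For \<open>t = 0\<close> it is the reduction
  used in \<open>over\<close>.\<close>

lemma bodyhom_ghom: "bodyhom s \<in> ghom s t"
proof -
  have "gbody ` gpart p s \<subseteq> gpart p t" for p
    by (cases p) (auto simp: gbody_odd)
  moreover have "gbody ` (galg s \<inter> greal) \<subseteq> greal"
    by (auto simp: greal_def gbody_def gcoeff_gscal)
  moreover have "gscal c \<in> galg s" for c by (rule gpart_galg[OF gscal_geven])
  moreover have "gbody x \<in> galg t" for x by (rule gpart_galg[OF gbody_geven])
  ultimately show ?thesis
    unfolding ghom_def by (auto simp: gpart_galg galg_add galg_mult image_subset_iff)
qed

lemma galg_0: "x \<in> galg 0 \<Longrightarrow> gbody x = x"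
  by (rule grassmann_eqI) (auto simp: gbody_def gcoeff_gscal galg_def)

lemma bodyhom_0: "bodyhom 0 = restrict id (galg 0)"
  by (auto simp: restrict_def galg_0)

lemma godd_0: "x \<in> godd 0 \<Longrightarrow> x = 0"
  using galg_0 gbody_odd gpart_galg by metis

lemma ghom_compose:
  assumes "\<phi> \<in> ghom s t" "\<psi> \<in> ghom t u"
  shows "compose (galg s) \<psi> \<phi> \<in> ghom s u"
proof -
  have "gscal c \<in> galg s" for c by (rule gpart_galg[OF gscal_geven])
  moreover have "\<phi> x \<in> greal" if "x \<in> galg s" "x \<in> greal" for x
    using assms(1) that unfolding ghom_def by blast
  moreover have "\<psi> x \<in> greal" if "x \<in> galg t" "x \<in> greal" for x
    using assms(2) that unfolding ghom_def by blast
  ultimately show ?thesis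
    using ghomD[OF assms(1)] ghomD[OF assms(2)]
    by (subst ghom_def) (auto simp: compose_def gpart_galg galg_add galg_mult)
qed

subsection \<open>Topology of the Grassmann algebra\<close>

lemma norm_gcoeff_le: "cmod (gcoeff x I) \<le> norm x"
proof (cases "gcoeff x I = 0")
  case False
  then show ?thesis unfolding norm_grassmann_def
    by (intro member_le_sum) (auto simp: finite_gcoeff)
qed simp

lemma bounded_linear_gcoeff: "bounded_linear (\<lambda>x. gcoeff x I)"
  by (rule bounded_linear_intro[where K = 1]) (simp_all add: norm_gcoeff_le)

lemma norm_gscal: "norm (gscal c) = cmod c"
  by (subst norm_grassmann_superset[of "{{}}"]) (auto simp: gcoeff_gscal split: if_splits)

lemma bounded_linear_gscal: "bounded_linear gscal"
  by (rule bounded_linear_intro[where K = 1])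
    (auto simp: gscal_add norm_gscal gcoeff_gscal intro: grassmann_eqI)

lemma bounded_linear_gbody: "bounded_linear gbody"
  unfolding gbody_def by (rule bounded_linear_compose[OF bounded_linear_gscal bounded_linear_gcoeff])

section \<open>Differentiation over the even part\<close>

text \<open>Restriction to the line \<open>x + t *\<^sub>R h\<close>, which stays in
  \<open>S\<close>, reduces the claim to uniqueness of derivatives at a real number. This works even
  if \<open>S\<close> has empty interior.\<close>

lemma has_derivative_unique_on_subspace:
  assumes f: "(f has_derivative L) (at x within S)" "(f has_derivative L') (at x within S)"
    and S: "subspace S" "x \<in> S" "h \<in> S"
  shows "L h = L' h"
proof -
  let ?g = "\<lambda>t::real. x + t *\<^sub>R h"
  have g: "(?g has_derivative (\<lambda>t. t *\<^sub>R h)) (at 0)"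
    by (auto intro!: derivative_eq_intros)
  have "range ?g \<subseteq> S"
    using S by (auto intro!: subspace_add subspace_scale)
  then have "((f \<circ> ?g) has_derivative (M \<circ> (\<lambda>t. t *\<^sub>R h))) (at 0)"
    if "(f has_derivative M) (at x within S)" for M
    using g that by (intro diff_chain_within) (auto intro: has_derivative_subset)
  from has_derivative_unique[OF this[OF f(1)] this[OF f(2)]]
  show ?thesis by (metis comp_apply scaleR_one)
qed

lemma norm_axis_vec: "norm (axis i x) = norm x"
proof -
  have "(\<Sum>j\<in>UNIV. (norm (axis i x $ j))\<^sup>2) = (\<Sum>j\<in>UNIV. if j = i then (norm x)\<^sup>2 else 0)"
    by (rule sum.cong) (auto simp: axis_def)
  then show ?thesis by (simp add: norm_vec_def L2_set_def)
qed

lemma bounded_linear_axis: "bounded_linear (axis i :: 'a::real_normed_vector \<Rightarrow> 'a ^ 'n::finite)"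
  by (rule bounded_linear_intro[where K = 1]) (auto simp: norm_axis_vec, auto simp: axis_def vec_eq_iff)

lemma vec_lambda_sum_axis:
  fixes f :: "'n::finite \<Rightarrow> 'a::real_normed_vector"
  shows "(\<chi> i. f i) = (\<Sum>i\<in>UNIV. axis i (f i))"
  by (simp add: vec_eq_iff axis_def)

text \<open>A vector is the finite sum of its components under the bounded linear inclusions
  \<open>axis i\<close>; the components may lie in any real normed space.\<close>

lemma has_derivative_vec_lambda:
  fixes f :: "'n::finite \<Rightarrow> 'a::real_normed_vector \<Rightarrow> 'b::real_normed_vector"
  assumes "\<And>i. (f i has_derivative f' i) F"
  shows "((\<lambda>x. \<chi> i. f i x) has_derivative (\<lambda>h. \<chi> i. f' i h)) F"
  unfolding vec_lambda_sum_axis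
  by (intro has_derivative_sum bounded_linear.has_derivative[OF bounded_linear_axis] assms)

lemma bounded_linear_vec_lambda:
  fixes f :: "'n::finite \<Rightarrow> 'a::real_normed_vector \<Rightarrow> 'b::real_normed_vector"
  assumes "\<And>i. bounded_linear (f i)"
  shows "bounded_linear (\<lambda>x. \<chi> i. f i x)"
  unfolding vec_lambda_sum_axis
  by (intro bounded_linear_sum bounded_linear_compose[OF bounded_linear_axis] assms)

subsection \<open>Superspaces\<close>

lemma space_pts_nth: "v \<in> space_pts p s \<Longrightarrow> v $ i \<in> gpart (p i) s"
  by (simp add: space_pts_def)

lemma subspace_space_pts: "subspace (space_pts p s)"
  by (auto simp: subspace_def space_pts_def)

definition sbody :: "grassmann ^ 'i::finite \<Rightarrow> grassmann ^ 'i" where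
  "sbody v = (\<chi> i. gbody (v $ i))"

lemma sbody_nth [simp]: "sbody v $ i = gbody (v $ i)"
  by (simp add: sbody_def)

lemma sbody_space_pts: 
  assumes "v \<in> space_pts p s" shows "sbody v \<in> space_pts p t"
proof -
  have "gbody (v $ i) \<in> gpart (p i) t" for i
    using space_pts_nth[OF assms, of i] by (cases "p i") (auto simp: gbody_odd)
  then show ?thesis by (simp add: space_pts_def)
qed

lemma bounded_linear_sbody: "bounded_linear sbody"
  unfolding sbody_def
  by (intro bounded_linear_vec_lambda bounded_linear_compose[OF bounded_linear_gbody]
      bounded_linear_vec_nth)

lemma sbody_0: "v \<in> space_pts p 0 \<Longrightarrow> sbody v = v"
  using galg_0[OF gpart_galg[OF space_pts_nth]] by (metis sbody_nth vec_eq_iff)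

lemma superspace_simps [simp]:
  "pts (superspace p) = space_pts p" "base (superspace p) = top_of_set (space_pts p 0)"
  "par (superspace p) = p" "charts (superspace p) = {(space_pts p 0, \<lambda>s v. v)}"
  "act (superspace p) s t \<phi> v = (\<chi> i. \<phi> (v $ i))"
  by (simp_all add: superspace_def)

lemma act_superspace_body:
  "v \<in> space_pts p s \<Longrightarrow> act (superspace p) s t (bodyhom s) v = sbody v"
  using gpart_galg[OF space_pts_nth, of v p s] by (simp add: vec_eq_iff)

lemma over_superspace: "over (superspace p) V s = {v \<in> space_pts p s. sbody v \<in> V}"
  unfolding over_def superspace_simps(1) by (rule Collect_cong) (metis act_superspace_body)

lemma over_superspace_space_pts [simp]: "over (superspace p) (space_pts p 0) s = space_pts p s"
  unfolding over_superspace using sbody_space_pts by (metis (no_types, lifting) Collect_cong Collect_mem_eq)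

lemma over_superspace_0:
  assumes "V \<subseteq> space_pts p 0" shows "over (superspace p) V 0 = V"
proof -
  have "sbody v = v" if "v \<in> space_pts p 0" for v by (rule sbody_0[OF that])
  then show ?thesis unfolding over_superspace using assms by auto
qed

abbreviation sopen :: "('i::finite \<Rightarrow> bool) \<Rightarrow> nat \<Rightarrow> (grassmann ^ 'i) set \<Rightarrow> bool" where
  "sopen p s A \<equiv> openin (top_of_set (space_pts p s)) A"

text \<open>The points over \<open>V\<close> form the preimage of \<open>V\<close> under the body
  map, which is continuous.\<close>

lemma sopen_over_superspace:
  assumes "sopen p 0 V"
  shows "sopen p s (over (superspace p) V s)"
proof -
  have "continuous_on (space_pts p s) sbody"
    by (intro bounded_linear.continuous_on[OF bounded_linear_sbody] continuous_on_id)
  then have "sopen p s (space_pts p s \<inter> sbody -` V)"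
    using assms sbody_space_pts[of _ p s 0] by (intro continuous_openin_preimage) auto
  moreover have "space_pts p s \<inter> sbody -` V = over (superspace p) V s"
    by (auto simp: over_superspace)
  ultimately show ?thesis by simp
qed

lemma at_within_openin:
  assumes "openin (top_of_set S) A" "x \<in> A"
  shows "at x within A = at x within S"
proof -
  obtain T where "open T" "A = S \<inter> T" using assms(1) by (auto simp: openin_open)
  then show ?thesis using assms(2) by (intro at_within_nhd[of x T]) auto
qed

subsection \<open>Super derivatives\<close>

text \<open>In contrast to \<open>sdiff_at\<close>, the filter is always that of the whole model
  space, so derivatives found on different chart domains can be compared and composed; on relatively
  open domains the two notions agree. The derivative is kept as an argument because injectivity and
  surjectivity are later read off from it.\<close>

definition sderiv :: "('i::finite \<Rightarrow> bool) \<Rightarrow> nat \<Rightarrow> (grassmann ^ 'i \<Rightarrow> grassmann ^ 'j::finite)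
    \<Rightarrow> grassmann ^ 'i \<Rightarrow> (grassmann ^ 'i \<Rightarrow> grassmann ^ 'j) \<Rightarrow> bool" where
  "sderiv p s f x L \<longleftrightarrow> (f has_derivative L) (at x within space_pts p s) \<and>
     (\<forall>k\<in>geven s. \<forall>h\<in>space_pts p s. L (k *s h) = k *s L h)"

definition sdiff1 :: "('i::finite \<Rightarrow> bool) \<Rightarrow> nat \<Rightarrow> (grassmann ^ 'i \<Rightarrow> grassmann)
    \<Rightarrow> grassmann ^ 'i \<Rightarrow> bool" where
  "sdiff1 p s f x \<longleftrightarrow> (\<exists>L. (f has_derivative L) (at x within space_pts p s) \<and>
     (\<forall>k\<in>geven s. \<forall>h\<in>space_pts p s. L (k *s h) = k * L h))"

lemma sderivD:
  assumes "sderiv p s f x L"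
  shows "(f has_derivative L) (at x within space_pts p s)"
    "k \<in> geven s \<Longrightarrow> h \<in> space_pts p s \<Longrightarrow> L (k *s h) = k *s L h"
  using assms unfolding sderiv_def by blast+

lemma sdiff_at_iff_sderiv:
  "sopen p s A \<Longrightarrow> x \<in> A \<Longrightarrow> sdiff_at p s f A x \<longleftrightarrow> (\<exists>L. sderiv p s f x L)"
  unfolding sdiff_at_def sderiv_def by (simp add: at_within_openin)

lemma has_derivative_cong_openin:
  assumes "openin (top_of_set S) A" "x \<in> A" "\<And>v. v \<in> A \<Longrightarrow> f v = g v"
  shows "(f has_derivative L) (at x within S) \<longleftrightarrow> (g has_derivative L) (at x within S)"
proof -
  have "(f has_derivative L) (at x within A) \<longleftrightarrow> (g has_derivative L) (at x within A)"
    using has_derivative_transform[OF assms(2), of f g] has_derivative_transform[OF assms(2), of g f]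
      assms(3) by auto
  then show ?thesis using at_within_openin[OF assms(1,2)] by simp
qed

lemma sderiv_cong:
  assumes "sopen p s A" "x \<in> A" "\<And>v. v \<in> A \<Longrightarrow> f v = g v"
  shows "sderiv p s f x L \<longleftrightarrow> sderiv p s g x L"
  using has_derivative_cong_openin[OF assms] by (auto simp: sderiv_def)

lemma sderiv_iff_sdiff1: "(\<exists>L. sderiv p s f x L) \<longleftrightarrow> (\<forall>i. sdiff1 p s (\<lambda>v. f v $ i) x)"
proof
  assume "\<exists>L. sderiv p s f x L"
  then obtain L where L: "sderiv p s f x L" by blast
  show "\<forall>i. sdiff1 p s (\<lambda>v. f v $ i) x"
  proof
    fix i
    have "((\<lambda>v. f v $ i) has_derivative (\<lambda>h. L h $ i)) (at x within space_pts p s)"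
      using bounded_linear.has_derivative[OF bounded_linear_vec_nth sderivD(1)[OF L]] .
    moreover have "L (k *s h) $ i = k * L h $ i" if "k \<in> geven s" "h \<in> space_pts p s" for k h
      using sderivD(2)[OF L that] by (simp add: vector_scalar_mult_def)
    ultimately show "sdiff1 p s (\<lambda>v. f v $ i) x"
      unfolding sdiff1_def by blast
  qed
next
  assume "\<forall>i. sdiff1 p s (\<lambda>v. f v $ i) x"
  then obtain L where L: "\<And>i. ((\<lambda>v. f v $ i) has_derivative L i) (at x within space_pts p s)"
    "\<And>i k h. k \<in> geven s \<Longrightarrow> h \<in> space_pts p s \<Longrightarrow> L i (k *s h) = k * L i h"
    unfolding sdiff1_def by metis
  from has_derivative_vec_lambda[of "\<lambda>i v. f v $ i", OF L(1)] L(2)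
  have "sderiv p s f x (\<lambda>h. \<chi> i. L i h)"
    by (simp add: sderiv_def vec_eq_iff)
  then show "\<exists>L. sderiv p s f x L" by blast
qed

lemma sderiv_continuous: "sderiv p s f x L \<Longrightarrow> continuous (at x within space_pts p s) f"
  by (rule has_derivative_continuous[OF sderivD(1)])

lemma sderiv_unique:
  "sderiv p s f x L \<Longrightarrow> sderiv p s f x L' \<Longrightarrow> x \<in> space_pts p s \<Longrightarrow> h \<in> space_pts p s \<Longrightarrow> L h = L' h"
  by (rule has_derivative_unique_on_subspace[OF sderivD(1) sderivD(1) subspace_space_pts])

text \<open>The model space is cut out by the vanishing of certain coefficients. Those coefficients
  of \<open>f\<close> are identically zero near \<open>x\<close>, so by uniqueness along the
  subspace their derivatives vanish too. Tangent vectors are thus mapped to tangent vectors.\<close>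

lemma sderiv_space_pts:
  assumes "sderiv p s f x L" "sopen p s A" "x \<in> A" "\<And>v. v \<in> A \<Longrightarrow> f v \<in> space_pts q s"
    "h \<in> space_pts p s"
  shows "L h \<in> space_pts q s"
proof -
  have x: "x \<in> space_pts p s" using assms openin_imp_subset by blast
  have "gcoeff (L h $ i) I = 0" if bad: "\<not> (I \<subseteq> {..<s} \<and> odd (card I) = q i)" for i I
  proof -
    have 1: "((\<lambda>v. gcoeff (f v $ i) I) has_derivative (\<lambda>h. gcoeff (L h $ i) I)) (at x within space_pts p s)"
      using bounded_linear.has_derivative[OF bounded_linear_compose[OF bounded_linear_gcoeff
            bounded_linear_vec_nth] sderivD(1)[OF assms(1)]] .
    have 2: "((\<lambda>v. gcoeff (f v $ i) I) has_derivative (\<lambda>h. 0)) (at x within space_pts p s)"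
    proof (subst has_derivative_cong_openin[OF assms(2,3)])
      fix v assume "v \<in> A"
      then have "f v $ i \<in> gpart (q i) s" using assms(4) space_pts_nth by blast
      then show "gcoeff (f v $ i) I = 0" using bad by (auto simp: gpart_def galg_def)
    qed simp
    show ?thesis
      by (rule has_derivative_unique_on_subspace[OF 1 2 subspace_space_pts x assms(5)])
  qed
  then have "L h $ i \<in> gpart (q i) s" for i
    unfolding gpart_def galg_def mem_Collect_eq by blast
  then show ?thesis by (simp add: space_pts_def)
qed

text \<open>Linearity of the composite over the even part uses that \<open>L\<close> maps into the
  model space of \<open>q\<close>, because \<open>M\<close> is known to be linear only
  there.\<close>

lemma sderiv_chain:
  assumes f: "sderiv p s f x L" and A: "sopen p s A" "x \<in> A" "\<And>v. v \<in> A \<Longrightarrow> f v \<in> space_pts q s"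
    and g: "sderiv q s g (f x) M"
  shows "sderiv p s (\<lambda>v. g (f v)) x (\<lambda>h. M (L h))"
proof -
  have "(f has_derivative L) (at x within A)"
    using f at_within_openin[OF A(1,2)] by (simp add: sderiv_def)
  moreover have "(g has_derivative M) (at (f x) within f ` A)"
    using g A(3) unfolding sderiv_def by (blast intro: has_derivative_subset)
  ultimately have "(g \<circ> f has_derivative M \<circ> L) (at x within A)"
    by (rule diff_chain_within)
  then show ?thesis
    using f g sderiv_space_pts[OF f A] at_within_openin[OF A(1,2)]
    by (simp add: sderiv_def comp_def)
qed

lemma sderiv_linear:
  assumes "bounded_linear T" "\<And>k h. k \<in> geven s \<Longrightarrow> h \<in> space_pts p s \<Longrightarrow> T (k *s h) = k *s T h"
  shows "sderiv p s T x T"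
  unfolding sderiv_def using bounded_linear_imp_has_derivative[OF assms(1)] assms(2) by blast

lemma sderiv_id: "sderiv p s (\<lambda>v. v) x (\<lambda>h. h)"
  by (rule sderiv_linear) (simp_all add: bounded_linear_ident)

lemma sdiff1_const: "sdiff1 p s (\<lambda>_. c) x"
  unfolding sdiff1_def by (rule exI[of _ "\<lambda>_. 0"]) simp

lemma sdiff1I:
  assumes "(f has_derivative L) (at x within space_pts p s)"
    "\<And>k h. k \<in> geven s \<Longrightarrow> h \<in> space_pts p s \<Longrightarrow> L (k *s h) = k * L h"
  shows "sdiff1 p s f x"
  using assms unfolding sdiff1_def by blast

lemma sdiff1_add: 
  assumes "sdiff1 p s f x" "sdiff1 p s g x"
  shows "sdiff1 p s (\<lambda>v. f v + g v) x"
proof -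
  obtain L where L: "(f has_derivative L) (at x within space_pts p s)"
    "\<And>k h. k \<in> geven s \<Longrightarrow> h \<in> space_pts p s \<Longrightarrow> L (k *s h) = k * L h"
    using assms(1) unfolding sdiff1_def by blast
  obtain M where M: "(g has_derivative M) (at x within space_pts p s)"
    "\<And>k h. k \<in> geven s \<Longrightarrow> h \<in> space_pts p s \<Longrightarrow> M (k *s h) = k * M h"
    using assms(2) unfolding sdiff1_def by blast
  show ?thesis
    by (rule sdiff1I[OF has_derivative_add[OF L(1) M(1)]]) (simp only: L(2) M(2) distrib_left)
qed

lemma sdiff1_minus: 
  assumes "sdiff1 p s f x" shows "sdiff1 p s (\<lambda>v. - f v) x"
proof -
  obtain L where L: "(f has_derivative L) (at x within space_pts p s)"
    "\<And>k h. k \<in> geven s \<Longrightarrow> h \<in> space_pts p s \<Longrightarrow> L (k *s h) = k * L h"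
    using assms(1) unfolding sdiff1_def by blast
  show ?thesis
    by (rule sdiff1I[OF has_derivative_minus[OF L(1)]]) (simp only: L(2) mult_minus_right)
qed

text \<open>The product rule gives the derivative; homogeneity of \<open>f x\<close> allows an even
  scalar to be moved past it, which keeps the derivative linear over the even part.\<close>

lemma sdiff1_mult:
  assumes f: "sdiff1 p s f x" and g: "sdiff1 p s g x" and fx: "f x \<in> gpart b s"
  shows "sdiff1 p s (\<lambda>v. f v * g v) x"
proof -
  obtain L where L: "(f has_derivative L) (at x within space_pts p s)"
    "\<forall>k\<in>geven s. \<forall>h\<in>space_pts p s. L (k *s h) = k * L h"
    using f unfolding sdiff1_def by blast
  obtain M where M: "(g has_derivative M) (at x within space_pts p s)"
    "\<forall>k\<in>geven s. \<forall>h\<in>space_pts p s. M (k *s h) = k * M h"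
    using g unfolding sdiff1_def by blast
  have comm: "f x * (k * y) = k * (f x * y)" if "k \<in> geven s" for k y
    using geven_commute[OF that fx] by (metis mult.assoc)
  have "f x * M (k *s h) + L (k *s h) * g x = k * (f x * M h + L h * g x)"
    if "k \<in> geven s" "h \<in> space_pts p s" for k h
  proof -
    have "f x * M (k *s h) + L (k *s h) * g x = f x * (k * M h) + k * L h * g x"
      using L(2) M(2) that by simp
    then show ?thesis by (simp add: comm[OF that(1), of "M h"] distrib_left mult.assoc)
  qed
  then show ?thesis
    unfolding sdiff1_def using has_derivative_mult[OF L(1) M(1)] by blast
qed

text \<open>The estimate for inversion in a normed algebra, restricted to even elements, where a
  nonzero body guarantees that \<open>ginv\<close> is an inverse.\<close>

lemma has_derivative_ginv:
  assumes a: "a \<in> geven s" "gcoeff a {} \<noteq> 0"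
  shows "(ginv has_derivative (\<lambda>h. - (ginv a * h * ginv a))) (at a within geven s)"
proof -
  define c where "c = norm (ginv a)"
  \<comment> \<open>The first bound keeps the body of \<open>y\<close> nonzero, so \<open>y\<close>
    is invertible. The second makes \<open>c * norm (y - a)\<close> at most 1/2;
    \<open>c + 1\<close> keeps the denominator positive.\<close>
  define e where "e = min (cmod (gcoeff a {})) (1 / (2 * (c + 1)))"
  have "c \<ge> 0" by (simp add: c_def)
  then have "e > 0" using a(2) by (simp add: e_def)
  then show ?thesis
  proof (rule has_derivativeI_sandwich)
    show "bounded_linear (\<lambda>h. - (ginv a * h * ginv a))"
      by (intro bounded_linear_minus bounded_linear_mult_const bounded_linear_const_mult bounded_linear_ident)
    fix y assume y: "y \<in> geven s" "y \<noteq> a" "dist y a < e"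
    have "cmod (gcoeff (y - a) {}) \<le> norm (y - a)" by (rule norm_gcoeff_le)
    then have "cmod (gcoeff y {} - gcoeff a {}) < cmod (gcoeff a {})"
      using y(3) by (simp add: e_def dist_norm)
    then have y0: "gcoeff y {} \<noteq> 0" by auto
    note inv = ginv_left[OF a] ginv_right[OF a] ginv_left[OF y(1) y0] ginv_right[OF y(1) y0]
    \<comment> \<open>The resolvent identity, with the factors in the order that noncommutativity
      dictates.\<close>
    have d: "ginv y - ginv a = - (ginv a * (y - a) * ginv y)"
    proof -
      have "ginv a * (y - a) * ginv y = ginv a * (y * ginv y) - ginv a * a * ginv y"
        by (simp add: right_diff_distrib left_diff_distrib mult.assoc)
      then show ?thesis by (simp add: inv)
    qed
    have small: "c * norm (y - a) \<le> 1 / 2"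
    proof -
      have "norm (y - a) \<le> 1 / (2 * (c + 1))" using y(3) by (simp add: e_def dist_norm)
      then have "c * norm (y - a) \<le> c * (1 / (2 * (c + 1)))"
        using \<open>c \<ge> 0\<close> by (rule mult_left_mono)
      also have "\<dots> \<le> 1 / 2" using \<open>c \<ge> 0\<close> by (simp add: field_simps)
      finally show ?thesis .
    qed
    have norm3: "norm (u * v * w) \<le> norm u * norm v * norm w" for u v w :: grassmann
      by (meson norm_ge_zero norm_mult_ineq mult_right_mono order_trans)
    have "norm (ginv y - ginv a) \<le> c * norm (y - a) * norm (ginv y)"
      unfolding d c_def norm_minus_cancel by (rule norm3)
    also have "\<dots> \<le> c * norm (y - a) * (2 * c)"
    proof (rule mult_left_mono)
      \<comment> \<open>Absorption: the last summand is at most half of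
        \<open>norm (ginv y)\<close>, which is moved to the left and gives the bound
        \<open>2 * c\<close>.\<close>
      have "norm (ginv y) \<le> norm (ginv a) + norm (ginv y - ginv a)"
        using norm_triangle_ineq[of "ginv a" "ginv y - ginv a"] by simp
      also have "norm (ginv y - ginv a) \<le> c * norm (y - a) * norm (ginv y)" by fact
      also have "\<dots> \<le> 1 / 2 * norm (ginv y)" by (rule mult_right_mono[OF small]) simp
      finally show "norm (ginv y) \<le> 2 * c" by (simp add: c_def)
    qed (use \<open>c \<ge> 0\<close> in simp)
    finally have d2: "norm (ginv y - ginv a) \<le> c * norm (y - a) * (2 * c)" .
    \<comment> \<open>The remainder contains the factor \<open>y - a\<close> and the difference of
      the inverses, which is itself of first order. Hence it is quadratic, with constant
      \<open>2 * c ^ 3\<close>.\<close>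
    have "ginv y - ginv a - (- (ginv a * (y - a) * ginv a)) = - (ginv a * (y - a) * (ginv y - ginv a))"
      by (subst (1) d) (simp add: algebra_simps)
    then have "norm (ginv y - ginv a - (- (ginv a * (y - a) * ginv a)))
        \<le> c * norm (y - a) * norm (ginv y - ginv a)"
      using norm3[of "ginv a" "y - a" "ginv y - ginv a"] by (simp add: c_def)
    also have "\<dots> \<le> c * norm (y - a) * (c * norm (y - a) * (2 * c))"
      by (rule mult_left_mono[OF d2]) (use \<open>c \<ge> 0\<close> in simp)
    finally show "norm (ginv y - ginv a - (- (ginv a * (y - a) * ginv a))) / norm (y - a)
        \<le> 2 * c ^ 3 * norm (y - a)"
      using y(2) by (simp add: divide_le_eq power3_eq_cube algebra_simps)
  next
    show "((\<lambda>y. 2 * c ^ 3 * norm (y - a)) \<longlongrightarrow> 0) (at a within geven s)"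
      by (rule tendsto_eq_intros | simp)+
  qed
qed

lemma sdiff1_ginv:
  assumes f: "sdiff1 p s f x" and A: "sopen p s A" "x \<in> A" "\<And>v. v \<in> A \<Longrightarrow> f v \<in> geven s"
    and fx: "gcoeff (f x) {} \<noteq> 0"
  shows "sdiff1 p s (\<lambda>v. ginv (f v)) x"
proof -
  obtain L where L: "(f has_derivative L) (at x within space_pts p s)"
    "\<forall>k\<in>geven s. \<forall>h\<in>space_pts p s. L (k *s h) = k * L h"
    using f unfolding sdiff1_def by blast
  have fx': "f x \<in> geven s" using A by blast
  have "(ginv has_derivative (\<lambda>h. - (ginv (f x) * h * ginv (f x)))) (at (f x) within f ` A)"
    by (rule has_derivative_subset[OF has_derivative_ginv[OF fx' fx]]) (use A in auto)
  with L(1) have "(ginv \<circ> f has_derivative (\<lambda>h. - (ginv (f x) * h * ginv (f x))) \<circ> L) (at x within A)"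
    using at_within_openin[OF A(1,2)] by (intro diff_chain_within) simp_all
  then have der: "((\<lambda>v. ginv (f v)) has_derivative (\<lambda>h. - (ginv (f x) * L h * ginv (f x))))
      (at x within space_pts p s)"
    using at_within_openin[OF A(1,2)] by (simp add: comp_def)
  have comm: "ginv (f x) * (k * y) = k * (ginv (f x) * y)" if "k \<in> geven s" for k y
    using geven_commute[OF that ginv_geven[OF fx' fx]] by (metis mult.assoc)
  have lin: "- (ginv (f x) * L (k *s h) * ginv (f x)) = k * - (ginv (f x) * L h * ginv (f x))"
    if "k \<in> geven s" "h \<in> space_pts p s" for k h
    using L(2) that comm[OF that(1), of "L h * ginv (f x)"] by (simp add: mult.assoc)
  from der lin show ?thesis unfolding sdiff1_def by blast
qed

section \<open>Supermanifolds and morphisms\<close>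

subsection \<open>Reduction to bodies\<close>

lemma gcoeff_power_empty: "gcoeff (x ^ k) {} = gcoeff x {} ^ k"
  by (induction k) (simp_all add: gcoeff_one gcoeff_times_empty)

text \<open>The element minus its body is nilpotent, hence so is its image; the body of a nilpotent
  element is a nilpotent complex number and therefore 0. Morphisms of superpoints thus never move
  the reduced point.\<close>

lemma ghom_gbody:
  assumes "\<phi> \<in> ghom s t" "x \<in> galg s"
  shows "gbody (\<phi> x) = gbody x"
proof -
  define n where "n = x - gbody x"
  have b: "gbody x \<in> galg s" by (rule gpart_galg[OF gbody_geven])
  have n: "n \<in> galg s" "gcoeff n {} = 0"
    using galg_add[OF assms(2) galg_minus[OF b]] by (simp_all add: n_def)
  have pow: "\<phi> (n ^ k) = \<phi> n ^ k" for k
  proof (induction k)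
    case 0
    then show ?case using ghomD(4)[OF assms(1), of 1] by simp
  next
    case (Suc k)
    then show ?case using ghomD(3)[OF assms(1) n(1) galg_power[OF n(1)]] by simp
  qed
  have "\<phi> n ^ Suc s = 0"
    using pow[of "Suc s"] galg_nilpotent[OF n] ghomD(4)[OF assms(1), of 0] by (simp only: gscal_simps)
  then have "gcoeff (\<phi> n) {} ^ Suc s = 0"
    by (metis gcoeff_power_empty gcoeff_simps(1))
  then have "gcoeff (\<phi> n) {} = 0" by (metis power_eq_0_iff)
  moreover have "\<phi> x = \<phi> n + gbody x"
    using ghomD(2)[OF assms(1) n(1) b] ghomD(4)[OF assms(1)] by (simp add: n_def gbody_def)
  ultimately show ?thesis by (simp add: gbody_def gcoeff_gscal)
qed

lemma compose_bodyhom: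
  assumes "\<phi> \<in> ghom s t"
  shows "compose (galg s) (bodyhom t) \<phi> = bodyhom s"
proof (rule ext)
  fix x
  show "compose (galg s) (bodyhom t) \<phi> x = bodyhom s x"
    by (cases "x \<in> galg s") (simp_all add: compose_def ghom_gbody[OF assms] ghomD(1)[OF assms])
qed

subsection \<open>Charts\<close>

text \<open>The part of \<open>supermanifold\<close> that single charts need, without covering,
  separation or smooth transitions. It passes to open subspaces and products, and it is available
  before the smoothness of the transitions is known.\<close>

definition satlas :: "('a, 'i::finite) sman \<Rightarrow> bool" where
  "satlas X \<longleftrightarrow> spoint_functor X \<and> topspace (base X) = pts X 0 \<and>
     (\<forall>(U, c)\<in>charts X. is_chart X U c)"

abbreviation body_pt :: "('a, 'i::finite) sman \<Rightarrow> nat \<Rightarrow> 'a \<Rightarrow> 'a" where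
  "body_pt X s x \<equiv> act X s 0 (bodyhom s) x"

lemma supermanifold_satlas: "supermanifold X \<Longrightarrow> satlas X"
  unfolding supermanifold_def satlas_def by blast

lemma spoint_functorD:
  assumes "spoint_functor X"
  shows "\<phi> \<in> ghom s t \<Longrightarrow> x \<in> pts X s \<Longrightarrow> act X s t \<phi> x \<in> pts X t"
    "x \<in> pts X s \<Longrightarrow> act X s s (restrict id (galg s)) x = x"
    "\<phi> \<in> ghom s t \<Longrightarrow> \<psi> \<in> ghom t u \<Longrightarrow> x \<in> pts X s \<Longrightarrow>
      act X s u (compose (galg s) \<psi> \<phi>) x = act X t u \<psi> (act X s t \<phi> x)"
  using assms unfolding spoint_functor_def by (elim conjE, simp add: Pi_iff)+

lemma satlasD:
  assumes "satlas X"
  shows "spoint_functor X" "topspace (base X) = pts X 0" "(U, c) \<in> charts X \<Longrightarrow> is_chart X U c"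
  using assms unfolding satlas_def by blast+

lemma over_pts: "x \<in> over X U s \<Longrightarrow> x \<in> pts X s"
  by (simp add: over_def)

lemma over_mono: "U \<subseteq> V \<Longrightarrow> over X U s \<subseteq> over X V s"
  by (auto simp: over_def)

lemma body_pt_0: "spoint_functor X \<Longrightarrow> x \<in> pts X 0 \<Longrightarrow> body_pt X 0 x = x"
  using spoint_functorD(2) bodyhom_0 by metis

lemma over_0: 
  assumes "spoint_functor X" "U \<subseteq> pts X 0" shows "over X U 0 = U"
proof -
  have "x \<in> over X U 0 \<longleftrightarrow> x \<in> U" for x
    using body_pt_0[OF assms(1)] assms(2) unfolding over_def mem_Collect_eq by (metis subsetD)
  then show ?thesis by blast
qed

lemma body_pt_pts: "spoint_functor X \<Longrightarrow> x \<in> pts X s \<Longrightarrow> body_pt X s x \<in> pts X 0"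
  by (rule spoint_functorD(1)[OF _ bodyhom_ghom])

lemma body_pt_act:
  "spoint_functor X \<Longrightarrow> \<phi> \<in> ghom s t \<Longrightarrow> x \<in> pts X s \<Longrightarrow> body_pt X t (act X s t \<phi> x) = body_pt X s x"
  using spoint_functorD(3)[of X \<phi> s t "bodyhom t" 0 x] compose_bodyhom bodyhom_ghom by metis

lemma over_act:
  "spoint_functor X \<Longrightarrow> \<phi> \<in> ghom s t \<Longrightarrow> x \<in> over X U s \<Longrightarrow> act X s t \<phi> x \<in> over X U t"
  unfolding over_def mem_Collect_eq using body_pt_act spoint_functorD(1) by metis

lemma over_all: "spoint_functor X \<Longrightarrow> over X (pts X 0) s = pts X s"
  by (auto simp: over_def body_pt_pts)

context
  fixes X :: "('a, 'i::finite) sman" and U c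
  assumes X: "satlas X" and c: "is_chart X U c"
begin

lemma chart_openin: "openin (base X) U"
  and chart_bij: "bij_betw (c s) (over X U s) (over (superspace (par X)) (c 0 ` U) s)"
  and chart_homeo: "homeomorphic_map (subtopology (base X) U)
       (subtopology (top_of_set (space_pts (par X) 0)) (c 0 ` U)) (c 0)"
  and chart_image_open: "sopen (par X) 0 (c 0 ` U)"
  using c unfolding is_chart_def superspace_simps(2) by blast+

lemma chart_subset: "U \<subseteq> pts X 0"
  using openin_subset[OF chart_openin] satlasD(2)[OF X] by simp

lemma chart_space_pts: "x \<in> over X U s \<Longrightarrow> c s x \<in> space_pts (par X) s"
  using bij_betwE[OF chart_bij[of s]] over_pts[of _ "superspace (par X)"] by auto

lemma chart_natural:
  "\<phi> \<in> ghom s t \<Longrightarrow> x \<in> over X U s \<Longrightarrow> c t (act X s t \<phi> x) = (\<chi> i. \<phi> (c s x $ i))"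
  using c unfolding is_chart_def natural_on_def by auto

lemma chart_body: 
  assumes "x \<in> over X U s" shows "sbody (c s x) = c 0 (body_pt X s x)"
  using chart_natural[OF bodyhom_ghom assms, of 0] act_superspace_body[OF chart_space_pts[OF assms], of 0]
  by simp

lemma chart_inj_0: "inj_on (c 0) U"
  using bij_betw_imp_inj_on[OF chart_bij[of 0]] over_0[OF satlasD(1)[OF X] chart_subset] by simp

lemma chart_inv: "x \<in> over X U s \<Longrightarrow> inv_into (over X U s) (c s) (c s x) = x"
  using chart_bij by (metis bij_betw_inv_into_left)

text \<open>Whether a point lies over \<open>U'\<close> depends only on its body, and charts commute
  with bodies; since \<open>c 0\<close> is injective on \<open>U\<close>, membership of the body can
  be tested after applying the chart.\<close>

lemma chart_image_over:
  assumes "U' \<subseteq> U"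
  shows "c s ` over X U' s = over (superspace (par X)) (c 0 ` U') s"
proof (intro equalityI subsetI)
  fix v assume "v \<in> c s ` over X U' s"
  then obtain x where x: "v = c s x" "x \<in> over X U' s" by blast
  then have x': "x \<in> over X U s" using over_mono[OF assms] by blast
  show "v \<in> over (superspace (par X)) (c 0 ` U') s"
    using chart_space_pts[OF x'] chart_body[OF x'] x(2) unfolding x(1) over_superspace
    by (simp add: over_def)
next
  fix v assume v: "v \<in> over (superspace (par X)) (c 0 ` U') s"
  then have "v \<in> over (superspace (par X)) (c 0 ` U) s"
    using over_mono[OF image_mono[OF assms, of "c 0"], of "superspace (par X)" s] by blast
  then obtain x where x: "x \<in> over X U s" "v = c s x"
    using bij_betw_imp_surj_on[OF chart_bij] by blast
  have b: "body_pt X s x \<in> U" using x by (simp add: over_def)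
  have "c 0 (body_pt X s x) \<in> c 0 ` U'"
    using v chart_body[OF x(1)] x(2) by (simp add: over_superspace)
  then have "body_pt X s x \<in> U'"
    using inj_on_image_mem_iff[OF chart_inj_0 b assms] by simp
  then show "v \<in> c s ` over X U' s" using x by (auto simp: over_def)
qed

lemma chart_image_sopen_0:
  assumes "openin (base X) U'" "U' \<subseteq> U"
  shows "sopen (par X) 0 (c 0 ` U')"
proof -
  have "openin (subtopology (base X) U) U'"
    using assms chart_openin by (simp add: openin_open_subtopology)
  then have "openin (subtopology (top_of_set (space_pts (par X) 0)) (c 0 ` U)) (c 0 ` U')"
    using homeomorphic_map_openness_eq[OF chart_homeo] by blast
  then show ?thesis using chart_image_open openin_trans_full by blast
qed

lemma chart_image_sopen:
  assumes "openin (base X) U'" "U' \<subseteq> U"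
  shows "sopen (par X) s (c s ` over X U' s)"
  unfolding chart_image_over[OF assms(2)]
  by (rule sopen_over_superspace[OF chart_image_sopen_0[OF assms]])

end

text \<open>By naturality the body of \<open>f s x\<close> is the image of the body of
  \<open>x\<close>, so the condition on the value is a condition on the reduced point. This makes
  chart images of local domains relatively open.\<close>

lemma local_dom_eq:
  assumes X: "satlas X" and Y: "spoint_functor Y"
    and f: "\<And>s. f s \<in> pts X s \<rightarrow> pts Y s" "natural_on (pts X) X Y f"
  shows "local_dom X Y f U W s = over X (U \<inter> {x \<in> pts X 0. f 0 x \<in> W}) s"
proof -
  have "f s x \<in> over Y W s \<longleftrightarrow> f 0 (body_pt X s x) \<in> W" if "x \<in> pts X s" for x
  proof -
    have "body_pt Y s (f s x) = f 0 (body_pt X s x)"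
      using f(2) that bodyhom_ghom unfolding natural_on_def by metis
    then show ?thesis using f(1)[of s] that by (auto simp: over_def)
  qed
  then show ?thesis
    using body_pt_pts[OF satlasD(1)[OF X]] by (auto simp: local_dom_def over_def)
qed

lemma local_dom_sopen:
  assumes X: "satlas X" and Y: "satlas Y"
    and f: "\<And>s. f s \<in> pts X s \<rightarrow> pts Y s" "natural_on (pts X) X Y f" "continuous_map (base X) (base Y) (f 0)"
    and c: "is_chart X U c" and W: "openin (base Y) W"
  shows "sopen (par X) s (c s ` local_dom X Y f U W s)"
proof -
  have "openin (base X) {x \<in> pts X 0. f 0 x \<in> W}"
    using openin_continuous_map_preimage[OF f(3) W] satlasD(2)[OF X] by simp
  then have "openin (base X) (U \<inter> {x \<in> pts X 0. f 0 x \<in> W})"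
    using chart_openin[OF X c] by blast
  then show ?thesis
    unfolding local_dom_eq[OF X satlasD(1)[OF Y] f(1,2)]
    by (rule chart_image_sopen[OF X c]) blast
qed

text \<open>Smoothness at one point over one superpoint. Only the component \<open>f s\<close>
  enters, so composition and descent can be argued one point at a time.\<close>

definition sdat :: "('a, 'i::finite) sman \<Rightarrow> ('b, 'j::finite) sman \<Rightarrow> (nat \<Rightarrow> 'a \<Rightarrow> 'b)
    \<Rightarrow> nat \<Rightarrow> 'a \<Rightarrow> bool" where
  "sdat X Y f s x \<longleftrightarrow> (\<forall>U c W d. (U, c) \<in> charts X \<longrightarrow> (W, d) \<in> charts Y \<longrightarrow>
     x \<in> over X U s \<longrightarrow> f s x \<in> over Y W s \<longrightarrow>
     (\<exists>L. sderiv (par X) s (local_rep X f U c d s) (c s x) L))"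

lemma sdiff_in_charts_iff:
  assumes X: "satlas X" and Y: "satlas Y"
    and f: "\<And>s. f s \<in> pts X s \<rightarrow> pts Y s" "natural_on (pts X) X Y f" "continuous_map (base X) (base Y) (f 0)"
  shows "sdiff_in_charts X Y f \<longleftrightarrow> (\<forall>s. \<forall>x\<in>pts X s. sdat X Y f s x)"
proof -
  have *: "sdiff_at (par X) s (local_rep X f U c d s) (c s ` local_dom X Y f U W s) (c s x) \<longleftrightarrow>
      (\<exists>L. sderiv (par X) s (local_rep X f U c d s) (c s x) L)"
    if "(U, c) \<in> charts X" "(W, d) \<in> charts Y" "x \<in> local_dom X Y f U W s" for U c W d s x
    using local_dom_sopen[OF X Y f satlasD(3)[OF X that(1)] chart_openin[OF Y satlasD(3)[OF Y that(2)]]] that(3)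
    by (intro sdiff_at_iff_sderiv) auto
  have "sdiff_in_charts X Y f \<longleftrightarrow> (\<forall>U c W d s x. (U, c) \<in> charts X \<longrightarrow> (W, d) \<in> charts Y \<longrightarrow>
      x \<in> local_dom X Y f U W s \<longrightarrow> (\<exists>L. sderiv (par X) s (local_rep X f U c d s) (c s x) L))"
    using * by (fastforce simp: sdiff_in_charts_def)
  then show ?thesis
    unfolding sdat_def local_dom_def using over_pts[of _ X] by blast
qed

lemma smor_iff_sdat:
  assumes X: "satlas X" and Y: "satlas Y"
  shows "smor X Y f \<longleftrightarrow> (\<forall>s. f s \<in> pts X s \<rightarrow> pts Y s) \<and> natural_on (pts X) X Y f \<and>
     continuous_map (base X) (base Y) (f 0) \<and> (\<forall>s. \<forall>x\<in>pts X s. sdat X Y f s x)"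
  unfolding smor_def using sdiff_in_charts_iff[OF assms, of f] by blast

lemma charts_at:
  assumes "(\<Union>(U, c)\<in>charts X. U) = pts X 0" "spoint_functor X" "x \<in> pts X s"
  obtains U c where "(U, c) \<in> charts X" "x \<in> over X U s"
proof -
  have "body_pt X s x \<in> (\<Union>(U, c)\<in>charts X. U)"
    unfolding assms(1) by (rule body_pt_pts[OF assms(2,3)])
  then obtain U c where "(U, c) \<in> charts X" "body_pt X s x \<in> U" by blast
  then show thesis using that assms(3) by (auto simp: over_def)
qed

text \<open>The chain rule through a chart of \<open>Y\<close> around \<open>f s x\<close>, which
  exists because the charts of \<open>Y\<close> cover. Of \<open>g\<close>, only smoothness at this
  one value is used.\<close>

lemma sdat_comp:
  assumes X: "satlas X" and Y: "satlas Y" "(\<Union>(U, c)\<in>charts Y. U) = pts Y 0"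
    and f: "smor X Y f" and x: "x \<in> pts X s" and g: "sdat Y Z g s (f s x)"
  shows "sdat X Z (\<lambda>s x. g s (f s x)) s x"
  unfolding sdat_def
proof (intro allI impI)
  fix U c V e
  assume U: "(U, c) \<in> charts X" and V: "(V, e) \<in> charts Z"
    and xU: "x \<in> over X U s" and gV: "g s (f s x) \<in> over Z V s"
  have f': "\<And>s. f s \<in> pts X s \<rightarrow> pts Y s" "natural_on (pts X) X Y f"
    "continuous_map (base X) (base Y) (f 0)" "sdat X Y f s x"
    using f x unfolding smor_iff_sdat[OF X Y(1)] by blast+
  have "f s x \<in> pts Y s" using f'(1) x by blast
  then obtain W d where W: "(W, d) \<in> charts Y" "f s x \<in> over Y W s"
    by (rule charts_at[OF Y(2) satlasD(1)[OF Y(1)]])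
  note cU = satlasD(3)[OF X U] and dW = satlasD(3)[OF Y(1) W(1)]
  let ?A = "c s ` local_dom X Y f U W s"
  have A: "sopen (par X) s ?A"
    by (rule local_dom_sopen[OF X Y(1) f'(1-3) cU chart_openin[OF Y(1) dW]])
  have xA: "c s x \<in> ?A" using xU W(2) by (simp add: local_dom_def)
  have inv: "inv_into (over X U s) (c s) (c s y) = y" "f s y \<in> over Y W s" if "y \<in> local_dom X Y f U W s" for y
    using that chart_inv[OF X cU] by (auto simp: local_dom_def)
  obtain L where L: "sderiv (par X) s (local_rep X f U c d s) (c s x) L"
    using f'(4) U W xU unfolding sdat_def by blast
  obtain M where M: "sderiv (par Y) s (local_rep Y g W d e s) (d s (f s x)) M"
    using g W V gV unfolding sdat_def by blast
  have "sderiv (par X) s (\<lambda>v. local_rep Y g W d e s (local_rep X f U c d s v)) (c s x) (\<lambda>h. M (L h))"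
  proof (rule sderiv_chain[OF L A xA])
    fix v assume "v \<in> ?A"
    then show "local_rep X f U c d s v \<in> space_pts (par Y) s"
      using inv chart_space_pts[OF Y(1) dW] by (auto simp: local_rep_def)
  next
    show "sderiv (par Y) s (local_rep Y g W d e s) (local_rep X f U c d s (c s x)) M"
      using M chart_inv[OF X cU xU] by (simp add: local_rep_def)
  qed
  then have "sderiv (par X) s (local_rep X (\<lambda>s x. g s (f s x)) U c e s) (c s x) (\<lambda>h. M (L h))"
  proof (subst sderiv_cong[OF A xA])
    fix v assume "v \<in> ?A"
    then show "local_rep X (\<lambda>s x. g s (f s x)) U c e s v =
        local_rep Y g W d e s (local_rep X f U c d s v)"
      using inv chart_inv[OF Y(1) dW] by (auto simp: local_rep_def)
  qed
  then show "\<exists>L. sderiv (par X) s (local_rep X (\<lambda>s x. g s (f s x)) U c e s) (c s x) L" by blast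
qed

subsection \<open>Open submanifolds\<close>

lemma open_sub_simps [simp]:
  "pts (open_sub X U) = over X U" "act (open_sub X U) = act X" "par (open_sub X U) = par X"
  "base (open_sub X U) = subtopology (base X) U" "charts (open_sub X U) = (\<lambda>(W, c). (W \<inter> U, c)) ` charts X"
  by (simp_all add: open_sub_def)

lemma over_open_sub: "over (open_sub X U) W s = over X (W \<inter> U) s"
  by (auto simp: over_def)

lemma is_chart_open_sub:
  assumes X: "satlas X" and c: "is_chart X W c" and U: "openin (base X) U"
  shows "is_chart (open_sub X U) (W \<inter> U) c"
proof -
  have sub: "W \<inter> U \<subseteq> W" by simp
  have op: "openin (base X) (W \<inter> U)" using chart_openin[OF X c] U by blast
  have "homeomorphic_map (subtopology (subtopology (base X) W) (W \<inter> U))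
      (subtopology (subtopology (top_of_set (space_pts (par X) 0)) (c 0 ` W)) (c 0 ` (W \<inter> U))) (c 0)"
  proof (rule homeomorphic_map_subtopologies[OF chart_homeo[OF X c]])
    have "topspace (subtopology (base X) W) = W"
      using chart_openin[OF X c] openin_subset by fastforce
    moreover have "topspace (subtopology (top_of_set (space_pts (par X) 0)) (c 0 ` W)) = c 0 ` W"
      using chart_image_open[OF X c] openin_imp_subset by fastforce
    ultimately show "c 0 ` (topspace (subtopology (base X) W) \<inter> (W \<inter> U)) =
      topspace (subtopology (top_of_set (space_pts (par X) 0)) (c 0 ` W)) \<inter> c 0 ` (W \<inter> U)"
      by auto
  qed
  moreover have "subtopology (subtopology (base X) W) (W \<inter> U) = subtopology (base (open_sub X U)) (W \<inter> U)"
    unfolding open_sub_simps subtopology_subtopology by (rule arg_cong[where f = "subtopology _"]) auto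
  moreover have "subtopology (subtopology (top_of_set (space_pts (par X) 0)) (c 0 ` W)) (c 0 ` (W \<inter> U)) =
      subtopology (top_of_set (space_pts (par X) 0)) (c 0 ` (W \<inter> U))"
    unfolding subtopology_subtopology[of _ "c 0 ` W"] by (rule arg_cong[where f = "subtopology _"]) auto
  ultimately have "homeomorphic_map (subtopology (base (open_sub X U)) (W \<inter> U))
      (subtopology (top_of_set (space_pts (par X) 0)) (c 0 ` (W \<inter> U))) (c 0)"
    by simp
  moreover have "bij_betw (c s) (over X (W \<inter> U) s) (over (superspace (par X)) (c 0 ` (W \<inter> U)) s)" for s
    unfolding chart_image_over[OF X c sub, symmetric] 
    using bij_betw_subset[OF chart_bij[OF X c] over_mono[OF sub]] by simp
  moreover have "natural_on (over X (W \<inter> U)) X (superspace (par X)) c"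
    using c over_mono[OF sub] unfolding is_chart_def natural_on_def by blast
  then have "natural_on (over (open_sub X U) (W \<inter> U)) (open_sub X U) (superspace (par X)) c"
    by (simp add: natural_on_def over_open_sub Int_assoc)
  moreover have "openin (base (open_sub X U)) (W \<inter> U)"
    using op by (simp add: openin_subtopology_Int2 openin_open_subtopology U)
  ultimately show ?thesis
    unfolding is_chart_def using chart_image_sopen_0[OF X c op sub]
    by (simp add: over_open_sub Int_assoc)
qed

lemma satlas_open_sub:
  assumes X: "satlas X" and U: "openin (base X) U"
  shows "satlas (open_sub X U)"
proof -
  have UX: "U \<subseteq> pts X 0" using openin_subset[OF U] satlasD(2)[OF X] by simp
  have "spoint_functor (open_sub X U)"
    unfolding spoint_functor_def open_sub_simps
    using over_act[OF satlasD(1)[OF X]] spoint_functorD(2,3)[OF satlasD(1)[OF X]] over_pts[of _ X U]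
    by blast
  moreover have "topspace (base (open_sub X U)) = pts (open_sub X U) 0"
    using UX over_0[OF satlasD(1)[OF X] UX] satlasD(2)[OF X] by auto
  ultimately show ?thesis
    unfolding satlas_def using is_chart_open_sub[OF X satlasD(3)[OF X] U] by auto
qed

lemma open_sub_cover:
  assumes "satlas X" "(\<Union>(U, c)\<in>charts X. U) = pts X 0" "openin (base X) U"
  shows "(\<Union>(U, c)\<in>charts (open_sub X U). U) = pts (open_sub X U) 0"
proof -
  have UX: "U \<subseteq> pts X 0" using openin_subset[OF assms(3)] satlasD(2)[OF assms(1)] by simp
  have "(\<Union>(U, c)\<in>charts (open_sub X U). U) = (\<Union>(U, c)\<in>charts X. U) \<inter> U" by auto
  then show ?thesis using over_0[OF satlasD(1)[OF assms(1)] UX] UX assms(2) by auto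
qed

text \<open>On the smaller domain the restricted chart has the same inverse, and derivatives depend
  only on a relatively open neighbourhood.\<close>

lemma sdat_open_sub:
  assumes Y: "satlas Y" and U: "openin (base Y) U" and y: "y \<in> over Y U s"
  shows "sdat (open_sub Y U) Z g s y \<longleftrightarrow> sdat Y Z g s y"
proof -
  have *: "(\<exists>L. sderiv (par Y) s (local_rep (open_sub Y U) g (W \<inter> U) c e s) (c s y) L) \<longleftrightarrow>
      (\<exists>L. sderiv (par Y) s (local_rep Y g W c e s) (c s y) L)"
    if W: "(W, c) \<in> charts Y" and yW: "y \<in> over Y W s" for W c and e :: "nat \<Rightarrow> 'c \<Rightarrow> grassmann ^ 'd::finite"
  proof -
    note cW = satlasD(3)[OF Y W]
    have op: "openin (base Y) (W \<inter> U)" using chart_openin[OF Y cW] U by blast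
    have yA: "c s y \<in> c s ` over Y (W \<inter> U) s" using y yW by (auto simp: over_def)
    have sub: "over Y (W \<inter> U) s \<subseteq> over Y W s" by (rule over_mono) simp
    have "local_rep (open_sub Y U) g (W \<inter> U) c e s v = local_rep Y g W c e s v"
      if v: "v \<in> c s ` over Y (W \<inter> U) s" for v
    proof -
      obtain z where z: "v = c s z" "z \<in> over Y (W \<inter> U) s" using v by blast
      have "inv_into (over Y (W \<inter> U) s) (c s) v = z"
        using z sub bij_betw_imp_inj_on[OF chart_bij[OF Y cW]] inv_into_f_f inj_on_subset by metis
      moreover have "inv_into (over Y W s) (c s) v = z"
        using z sub chart_inv[OF Y cW] by blast
      ultimately show ?thesis by (simp add: local_rep_def over_open_sub Int_assoc)
    qed
    from sderiv_cong[OF chart_image_sopen[OF Y cW op Int_lower1] yA this] show ?thesis by simp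
  qed
  have over_iff: "y \<in> over (open_sub Y U) (W \<inter> U) s \<longleftrightarrow> y \<in> over Y W s" for W
    using y by (auto simp: over_def)
  show ?thesis
  proof
    assume h: "sdat (open_sub Y U) Z g s y"
    show "sdat Y Z g s y" unfolding sdat_def
    proof (intro allI impI)
      fix W c V e assume a: "(W, c) \<in> charts Y" "(V, e) \<in> charts Z" "y \<in> over Y W s" "g s y \<in> over Z V s"
      have "(W \<inter> U, c) \<in> charts (open_sub Y U)" using a(1) by (auto intro!: image_eqI[of _ _ "(W, c)"])
      then have "\<exists>L. sderiv (par (open_sub Y U)) s (local_rep (open_sub Y U) g (W \<inter> U) c e s) (c s y) L"
        using h a over_iff unfolding sdat_def by blast
      then show "\<exists>L. sderiv (par Y) s (local_rep Y g W c e s) (c s y) L" using *[OF a(1,3)] by simp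
    qed
  next
    assume h: "sdat Y Z g s y"
    show "sdat (open_sub Y U) Z g s y" unfolding sdat_def
    proof (intro allI impI)
      fix W' c V e assume a: "(W', c) \<in> charts (open_sub Y U)" "(V, e) \<in> charts Z"
        "y \<in> over (open_sub Y U) W' s" "g s y \<in> over Z V s"
      then obtain W where W: "W' = W \<inter> U" "(W, c) \<in> charts Y" by auto
      have "y \<in> over Y W s" using a(3) over_iff W by simp
      then have "\<exists>L. sderiv (par Y) s (local_rep Y g W c e s) (c s y) L"
        using h a W unfolding sdat_def by blast
      then show "\<exists>L. sderiv (par (open_sub Y U)) s (local_rep (open_sub Y U) g W' c e s) (c s y) L"
        using *[OF W(2) \<open>y \<in> over Y W s\<close>] W by simp
    qed
  qed
qed

subsection \<open>Superspaces as supermanifolds\<close>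

lemma spoint_functor_superspace: "spoint_functor (superspace p)"
proof -
  have "(\<chi> i. \<phi> (x $ i)) \<in> space_pts p t" if "\<phi> \<in> ghom s t" "x \<in> space_pts p s" for \<phi> s t x
    using ghomD(5)[OF that(1) space_pts_nth[OF that(2)]] by (simp add: space_pts_def)
  moreover have "restrict id (galg s) (x $ i) = x $ i" if "x \<in> space_pts p s" for x s i
    using gpart_galg[OF space_pts_nth[OF that]] by simp
  moreover have "compose (galg s) \<psi> \<phi> (x $ i) = \<psi> (\<phi> (x $ i))" if "x \<in> space_pts p s"
    for x s i and \<phi> \<psi> :: "grassmann \<Rightarrow> grassmann"
    using gpart_galg[OF space_pts_nth[OF that]] by (simp add: compose_def)
  ultimately show ?thesis
    unfolding spoint_functor_def superspace_simps by (simp add: vec_eq_iff)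
qed

lemma is_chart_superspace: "is_chart (superspace p) (space_pts p 0) (\<lambda>s v. v)"
proof -
  have "homeomorphic_map (top_of_set (space_pts p 0)) (top_of_set (space_pts p 0)) (\<lambda>v. v)"
    using homeomorphic_map_id[of "top_of_set (space_pts p 0)"] by (simp add: id_def)
  then show ?thesis
    unfolding is_chart_def natural_on_def
    by (simp add: bij_betw_def subtopology_subtopology del: superspace_simps(5))
qed

lemma satlas_superspace: "satlas (superspace p)"
  unfolding satlas_def by (simp add: spoint_functor_superspace is_chart_superspace)

lemma superspace_cover: "(\<Union>(U, c)\<in>charts (superspace p). U) = pts (superspace p) 0"
  by simp

lemma Hausdorff_superspace: "Hausdorff_space (base (superspace p))"
  by (simp add: Hausdorff_space_subtopology)

lemma second_countable_euclidean:
  "second_countable (euclidean :: 'a::second_countable_topology topology)"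
proof -
  obtain B :: "'a set set" where "countable B" "topological_basis B"
    using ex_countable_basis by blast
  then show ?thesis
    unfolding second_countable_def
    by (intro exI[of _ B]) (metis open_openin topological_basisE topological_basis_open)
qed

text \<open>Over \<open>s = 0\<close> only scalars survive, and odd coordinates vanish. The reduced
  space is therefore homeomorphic to a linear subspace of a finite-dimensional complex space,
  although the ambient type is infinite-dimensional.\<close>

lemma second_countable_superspace: "second_countable (base (superspace (p :: 'i::finite \<Rightarrow> bool)))"
proof -
  let ?f = "\<lambda>v :: complex ^ 'i. \<chi> i. gscal (v $ i)" and ?g = "\<lambda>w :: grassmann ^ 'i. \<chi> i. gcoeff (w $ i) {}"
  let ?S = "{v :: complex ^ 'i. \<forall>i. p i \<longrightarrow> v $ i = 0}"
  have cf: "continuous_on A ?f" and cg: "continuous_on B ?g" for A B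
    by (intro continuous_on_vec_lambda bounded_linear.continuous_on[OF bounded_linear_gscal]
        bounded_linear.continuous_on[OF bounded_linear_gcoeff] continuous_on_component continuous_on_id)+
  have f: "?f v \<in> space_pts p 0" if "v \<in> ?S" for v
  proof -
    have "gscal (v $ i) \<in> gpart (p i) 0" for i
      using that by (cases "p i") auto
    then show ?thesis by (simp add: space_pts_def)
  qed
  have g: "?g w \<in> ?S" "?f (?g w) = w" if "w \<in> space_pts p 0" for w
  proof -
    have *: "w $ i \<in> gpart (p i) 0" for i by (rule space_pts_nth[OF that])
    show "?g w \<in> ?S" using * by (auto intro: gcoeff_godd_empty) (metis (full_types) gcoeff_godd_empty)
    have "gscal (gcoeff (w $ i) {}) = w $ i" for i
      using galg_0[OF gpart_galg[OF *]] by (simp add: gbody_def)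
    then show "?f (?g w) = w" by (simp add: vec_eq_iff)
  qed
  have "homeomorphic_maps (top_of_set ?S) (top_of_set (space_pts p 0)) ?f ?g"
    unfolding homeomorphic_maps_def using cf cg f g by (auto simp: gcoeff_gscal vec_eq_iff)
  then have "top_of_set ?S homeomorphic_space top_of_set (space_pts p 0)"
    unfolding homeomorphic_space_def by blast
  moreover have "second_countable (top_of_set ?S)"
    by (rule second_countable_subtopology[OF second_countable_euclidean])
  ultimately have "second_countable (top_of_set (space_pts p 0))"
    using homeomorphic_space_second_countability by blast
  then show ?thesis by simp
qed

lemma sdat_superspaces:
  assumes "v \<in> space_pts q s" "g s v \<in> space_pts p s"
  shows "sdat (superspace q) (superspace p) g s v \<longleftrightarrow> (\<exists>L. sderiv q s (g s) v L)"
proof -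
  have inv: "inv_into (space_pts q s) (\<lambda>v. v) w = w" if "w \<in> space_pts q s" for w
    using inv_into_f_f[of "\<lambda>v. v" "space_pts q s" w] that by (simp add: inj_on_def)
  have "local_rep (superspace q) g (space_pts q 0) (\<lambda>s v. v) (\<lambda>s v. v) s w = g s w"
    if "w \<in> space_pts q s" for w
    using inv[OF that] by (simp add: local_rep_def)
  then have "sderiv q s (local_rep (superspace q) g (space_pts q 0) (\<lambda>s v. v) (\<lambda>s v. v) s) v L
      \<longleftrightarrow> sderiv q s (g s) v L" for L
    by (intro sderiv_cong[OF _ assms(1)]) auto
  then have "sderiv q s (local_rep (superspace q) g (space_pts q 0) (\<lambda>s v. v) (\<lambda>s v. v) s) v =
      sderiv q s (g s) v" by (intro ext)
  then show ?thesis unfolding sdat_def using assms by simp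
qed

lemma sdat_to_superspace:
  assumes "\<And>x. x \<in> pts X s \<Longrightarrow> f s x \<in> space_pts p s"
  shows "sdat X (superspace p) f s x \<longleftrightarrow> (\<forall>U c. (U, c) \<in> charts X \<longrightarrow> x \<in> over X U s \<longrightarrow>
     (\<exists>L. sderiv (par X) s (\<lambda>v. f s (inv_into (over X U s) (c s) v)) (c s x) L))"
  unfolding sdat_def local_rep_def using assms over_pts[of x X] by auto

subsection \<open>Scalar functions\<close>

text \<open>A superfunction of parity \<open>b\<close> in the language of points, that is, a
  coordinate of a morphism into a superspace. Continuity is not a clause here because, for covering
  charts, it follows from differentiability in the charts.\<close>

definition sfun :: "('a, 'i::finite) sman \<Rightarrow> bool \<Rightarrow> (nat \<Rightarrow> 'a \<Rightarrow> grassmann) \<Rightarrow> bool" where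
  "sfun X b f \<longleftrightarrow> (\<forall>s. \<forall>x\<in>pts X s. f s x \<in> gpart b s) \<and>
     (\<forall>s t. \<forall>\<phi>\<in>ghom s t. \<forall>x\<in>pts X s. f t (act X s t \<phi> x) = \<phi> (f s x)) \<and>
     (\<forall>U c s x. (U, c) \<in> charts X \<longrightarrow> x \<in> over X U s \<longrightarrow>
       sdiff1 (par X) s (\<lambda>v. f s (inv_into (over X U s) (c s) v)) (c s x))"

lemma sfunI:
  assumes "\<And>s x. x \<in> pts X s \<Longrightarrow> f s x \<in> gpart b s"
    "\<And>s t \<phi> x. \<phi> \<in> ghom s t \<Longrightarrow> x \<in> pts X s \<Longrightarrow> f t (act X s t \<phi> x) = \<phi> (f s x)"
    "\<And>U c s x. (U, c) \<in> charts X \<Longrightarrow> x \<in> over X U s \<Longrightarrow>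
       sdiff1 (par X) s (\<lambda>v. f s (inv_into (over X U s) (c s) v)) (c s x)"
  shows "sfun X b f"
  using assms unfolding sfun_def by blast

lemma sfunD:
  assumes "sfun X b f"
  shows "x \<in> pts X s \<Longrightarrow> f s x \<in> gpart b s"
    "\<phi> \<in> ghom s t \<Longrightarrow> x \<in> pts X s \<Longrightarrow> f t (act X s t \<phi> x) = \<phi> (f s x)"
    "(U, c) \<in> charts X \<Longrightarrow> x \<in> over X U s \<Longrightarrow>
       sdiff1 (par X) s (\<lambda>v. f s (inv_into (over X U s) (c s) v)) (c s x)"
  using assms unfolding sfun_def by blast+

text \<open>Differentiability over \<open>s = 0\<close> gives continuity of the chart expression,
  and \<open>c 0\<close> is a homeomorphism onto its image; the charts cover, so this is enough near
  every point.\<close>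

lemma continuous_map_of_sderiv:
  fixes f :: "'a \<Rightarrow> grassmann ^ 'j::finite"
  assumes X: "satlas X" "(\<Union>(U, c)\<in>charts X. U) = pts X 0"
    and f: "\<And>x. x \<in> pts X 0 \<Longrightarrow> f x \<in> space_pts p 0"
    and D: "\<And>U c x. (U, c) \<in> charts X \<Longrightarrow> x \<in> over X U 0 \<Longrightarrow>
       \<exists>L. sderiv (par X) 0 (\<lambda>v. f (inv_into (over X U 0) (c 0) v)) (c 0 x) L"
  shows "continuous_map (base X) (top_of_set (space_pts p 0)) f"
  unfolding continuous_map_eq_topcontinuous_at topcontinuous_at_def
proof (intro ballI conjI allI impI)
  fix x assume x: "x \<in> topspace (base X)"
  then have x0: "x \<in> pts X 0" using satlasD(2)[OF X(1)] by simp
  show "x \<in> topspace (base X)" by fact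
  show "f \<in> topspace (base X) \<rightarrow> topspace (top_of_set (space_pts p 0))"
    using f satlasD(2)[OF X(1)] by auto
  fix V assume V: "openin (top_of_set (space_pts p 0)) V \<and> f x \<in> V"
  obtain T where T: "open T" "V = space_pts p 0 \<inter> T" using V by (auto simp: openin_open)
  obtain U c where U: "(U, c) \<in> charts X" "x \<in> over X U 0"
    by (rule charts_at[OF X(2) satlasD(1)[OF X(1)] x0])
  note c = satlasD(3)[OF X(1) U(1)]
  have UX: "U \<subseteq> pts X 0" by (rule chart_subset[OF X(1) c])
  have o0: "over X U 0 = U" by (rule over_0[OF satlasD(1)[OF X(1)] UX])
  let ?g = "\<lambda>v. f (inv_into (over X U 0) (c 0) v)"
  have cim: "sopen (par X) 0 (c 0 ` U)" by (rule chart_image_open[OF X(1) c])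
  have "continuous (at v within c 0 ` U) ?g" if v: "v \<in> c 0 ` U" for v
  proof -
    obtain y where y: "y \<in> over X U 0" "v = c 0 y" using v unfolding o0 by blast
    obtain L where "sderiv (par X) 0 ?g v L" using D[OF U(1) y(1)] y(2) by blast
    from sderiv_continuous[OF this] show ?thesis by (simp add: at_within_openin[OF cim v])
  qed
  then have "continuous_on (c 0 ` U) ?g" by (simp add: continuous_on_eq_continuous_within)
  then have "openin (top_of_set (c 0 ` U)) (c 0 ` U \<inter> ?g -` T)"
    using T(1) by (simp add: continuous_openin_preimage_gen)
  then have o: "openin (subtopology (top_of_set (space_pts (par X) 0)) (c 0 ` U)) (c 0 ` U \<inter> ?g -` T)"
    using openin_imp_subset[OF cim] by (simp add: subtopology_subtopology Int_absorb1)
  let ?W = "{y \<in> topspace (subtopology (base X) U). c 0 y \<in> c 0 ` U \<inter> ?g -` T}"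
  have "openin (subtopology (base X) U) ?W"
    by (rule openin_continuous_map_preimage[OF homeomorphic_imp_continuous_map[OF chart_homeo[OF X(1) c]] o])
  then have "openin (base X) ?W" using openin_trans_full chart_openin[OF X(1) c] by blast
  moreover have inv: "?g (c 0 y) = f y" if "y \<in> U" for y
    using chart_inv[OF X(1) c, of y 0] that o0 by simp
  have "x \<in> ?W" using U(2) o0 x V T inv by auto
  moreover have "\<forall>y\<in>?W. f y \<in> V"
  proof
    fix y assume "y \<in> ?W"
    then have "y \<in> U" "?g (c 0 y) \<in> T" by simp_all
    then show "f y \<in> V" using inv[of y] T(2) f UX by auto
  qed
  ultimately show "\<exists>U. openin (base X) U \<and> x \<in> U \<and> (\<forall>y\<in>U. f y \<in> V)" by blast
qed

lemma smor_superspace_iff: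
  assumes X: "satlas X" "(\<Union>(U, c)\<in>charts X. U) = pts X 0"
  shows "smor X (superspace p) f \<longleftrightarrow> (\<forall>i. sfun X (p i) (\<lambda>s x. f s x $ i))"
proof
  assume "smor X (superspace p) f"
  then have f: "\<And>s x. x \<in> pts X s \<Longrightarrow> f s x \<in> space_pts p s" "natural_on (pts X) X (superspace p) f"
    "\<And>s x. x \<in> pts X s \<Longrightarrow> sdat X (superspace p) f s x"
    unfolding smor_iff_sdat[OF X(1) satlas_superspace] by auto
  show "\<forall>i. sfun X (p i) (\<lambda>s x. f s x $ i)"
  proof (intro allI sfunI)
    fix i s x assume "x \<in> pts X s"
    then show "f s x $ i \<in> gpart (p i) s" using f(1) space_pts_nth by blast
  next
    fix i s t \<phi> x assume "\<phi> \<in> ghom s t" "x \<in> pts X s"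
    then show "f t (act X s t \<phi> x) $ i = \<phi> (f s x $ i)"
      using f(2) unfolding natural_on_def by simp
  next
    fix i U c s x assume U: "(U, c) \<in> charts X" "x \<in> over X U s"
    have "\<exists>L. sderiv (par X) s (\<lambda>v. f s (inv_into (over X U s) (c s) v)) (c s x) L"
      using f(3)[OF over_pts[OF U(2)]] U sdat_to_superspace[of X s f p x] f(1) by blast
    then show "sdiff1 (par X) s (\<lambda>v. f s (inv_into (over X U s) (c s) v) $ i) (c s x)"
      unfolding sderiv_iff_sdiff1 by blast
  qed
next
  assume h: "\<forall>i. sfun X (p i) (\<lambda>s x. f s x $ i)"
  have pts: "f s x \<in> space_pts p s" if "x \<in> pts X s" for s x
    using h sfunD(1) that by (fastforce simp: space_pts_def)
  have nat: "natural_on (pts X) X (superspace p) f"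
    unfolding natural_on_def
  proof (intro allI ballI)
    fix s t \<phi> x assume a: "\<phi> \<in> ghom s t" "x \<in> pts X s"
    have "f t (act X s t \<phi> x) $ i = \<phi> (f s x $ i)" for i
      using sfunD(2)[OF spec[OF h] a] .
    then show "f t (act X s t \<phi> x) = act (superspace p) s t \<phi> (f s x)" by (simp add: vec_eq_iff)
  qed
  have D: "\<exists>L. sderiv (par X) s (\<lambda>v. f s (inv_into (over X U s) (c s) v)) (c s x) L"
    if "(U, c) \<in> charts X" "x \<in> over X U s" for U c s x
    unfolding sderiv_iff_sdiff1 using sfunD(3)[OF spec[OF h] that] by blast
  have "continuous_map (base X) (top_of_set (space_pts p 0)) (f 0)"
  proof (rule continuous_map_of_sderiv[OF X])
    show "f 0 x \<in> space_pts p 0" if "x \<in> pts X 0" for x by (rule pts[OF that])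
    show "\<exists>L. sderiv (par X) 0 (\<lambda>v. f 0 (inv_into (over X U 0) (c 0) v)) (c 0 x) L"
      if "(U, c) \<in> charts X" "x \<in> over X U 0" for U c x
      by (rule D[OF that])
  qed
  moreover have "sdat X (superspace p) f s x" for s x
  proof (rule iffD2[OF sdat_to_superspace])
    show "f s x \<in> space_pts p s" if "x \<in> pts X s" for x by (rule pts[OF that])
  qed (intro allI impI D)
  ultimately show "smor X (superspace p) f"
    unfolding smor_iff_sdat[OF X(1) satlas_superspace] using pts nat by auto
qed

lemma sfun_cong:
  assumes X: "satlas X" and f: "sfun X b f" and eq: "\<And>s x. x \<in> pts X s \<Longrightarrow> g s x = f s x"
  shows "sfun X b g"
proof (rule sfunI)
  show "g s x \<in> gpart b s" if "x \<in> pts X s" for s x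
    using sfunD(1)[OF f that] eq[OF that] by simp
  show "g t (act X s t \<phi> x) = \<phi> (g s x)" if "\<phi> \<in> ghom s t" "x \<in> pts X s" for s t \<phi> x
    using sfunD(2)[OF f that] eq[OF that(2)] eq[OF spoint_functorD(1)[OF satlasD(1)[OF X] that]] by simp
  fix U c s x assume U: "(U, c) \<in> charts X" "x \<in> over X U s"
  note c = satlasD(3)[OF X U(1)]
  have A: "sopen (par X) s (c s ` over X U s)"
    by (rule chart_image_sopen[OF X c chart_openin[OF X c] order_refl])
  have x: "c s x \<in> c s ` over X U s" using U by blast
  obtain L where L: "((\<lambda>v. f s (inv_into (over X U s) (c s) v)) has_derivative L)
      (at (c s x) within space_pts (par X) s)"
    "\<forall>k\<in>geven s. \<forall>h\<in>space_pts (par X) s. L (k *s h) = k * L h"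
    using sfunD(3)[OF f U] unfolding sdiff1_def by blast
  have eq': "g s (inv_into (over X U s) (c s) v) = f s (inv_into (over X U s) (c s) v)"
    if "v \<in> c s ` over X U s" for v
    using eq[OF over_pts[OF inv_into_into[OF that]]] .
  have "((\<lambda>v. g s (inv_into (over X U s) (c s) v)) has_derivative L) (at (c s x) within space_pts (par X) s)"
    using L(1) has_derivative_cong_openin[where f = "\<lambda>v. g s (inv_into (over X U s) (c s) v)"
        and g = "\<lambda>v. f s (inv_into (over X U s) (c s) v)", OF A x eq'] by blast
  with L(2) show "sdiff1 (par X) s (\<lambda>v. g s (inv_into (over X U s) (c s) v)) (c s x)"
    unfolding sdiff1_def by blast
qed

lemma sfun_gscal: "sfun X False (\<lambda>s x. gscal c)"
  by (rule sfunI) (auto simp: ghomD(4) sdiff1_const)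

lemma sfun_one: "sfun X False (\<lambda>s x. 1)"
  using sfun_gscal[of X 1] by simp

lemma sfun_zero: "sfun X b (\<lambda>s x. 0)"
  by (rule sfunI) (use ghomD(4)[of _ _ _ 0] in \<open>auto simp: sdiff1_const\<close>)

lemma sfun_add: 
  assumes f: "sfun X b f" and g: "sfun X b g"
  shows "sfun X b (\<lambda>s x. f s x + g s x)"
proof (rule sfunI)
  show "f s x + g s x \<in> gpart b s" if "x \<in> pts X s" for s x
    using sfunD(1)[OF f that] sfunD(1)[OF g that] by (rule gpart_add)
  show "f t (act X s t \<phi> x) + g t (act X s t \<phi> x) = \<phi> (f s x + g s x)"
    if "\<phi> \<in> ghom s t" "x \<in> pts X s" for s t \<phi> x
    using sfunD(1,2)[OF f] sfunD(1,2)[OF g] ghomD(2)[OF that(1)] that gpart_galg by metis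
qed (intro sdiff1_add sfunD(3)[OF f] sfunD(3)[OF g])

lemma sfun_minus: 
  assumes f: "sfun X b f"
  shows "sfun X b (\<lambda>s x. - f s x)"
proof (rule sfunI)
  show "- f s x \<in> gpart b s" if "x \<in> pts X s" for s x
    using sfunD(1)[OF f that] by (rule gpart_minus)
  show "- f t (act X s t \<phi> x) = \<phi> (- f s x)"
    if "\<phi> \<in> ghom s t" "x \<in> pts X s" for s t \<phi> x
    using sfunD(1,2)[OF f] ghom_minus[OF that(1)] that gpart_galg by metis
qed (intro sdiff1_minus sfunD(3)[OF f])

lemma sfun_diff: "sfun X b f \<Longrightarrow> sfun X b g \<Longrightarrow> sfun X b (\<lambda>s x. f s x - g s x)"
  unfolding diff_conv_add_uminus by (intro sfun_add sfun_minus)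

lemma sfun_mult: 
  assumes X: "satlas X" and f: "sfun X b f" and g: "sfun X b' g" and "b'' = (b \<noteq> b')"
  shows "sfun X b'' (\<lambda>s x. f s x * g s x)"
proof (rule sfunI)
  show "f s x * g s x \<in> gpart b'' s" if "x \<in> pts X s" for s x
    using gpart_mult[OF sfunD(1)[OF f that] sfunD(1)[OF g that]] assms(4) by simp
  show "f t (act X s t \<phi> x) * g t (act X s t \<phi> x) = \<phi> (f s x * g s x)"
    if "\<phi> \<in> ghom s t" "x \<in> pts X s" for s t \<phi> x
    using sfunD(1,2)[OF f] sfunD(1,2)[OF g] ghomD(3)[OF that(1)] that gpart_galg by metis
  fix U c s x assume U: "(U, c) \<in> charts X" "x \<in> over X U s"
  have "inv_into (over X U s) (c s) (c s x) = x" by (rule chart_inv[OF X satlasD(3)[OF X U(1)] U(2)])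
  then show "sdiff1 (par X) s (\<lambda>v. f s (inv_into (over X U s) (c s) v) * g s (inv_into (over X U s) (c s) v)) (c s x)"
    using sdiff1_mult[OF sfunD(3)[OF f U] sfunD(3)[OF g U]] sfunD(1)[OF f over_pts[OF U(2)]] by simp
qed

lemma sfun_ginv: 
  assumes X: "satlas X" and f: "sfun X False f" and nz: "\<And>s x. x \<in> pts X s \<Longrightarrow> gcoeff (f s x) {} \<noteq> 0"
  shows "sfun X False (\<lambda>s x. ginv (f s x))"
proof (rule sfunI)
  show "ginv (f s x) \<in> geven s" if "x \<in> pts X s" for s x
    by (rule ginv_geven[OF sfunD(1)[OF f that] nz[OF that]])
  show "ginv (f t (act X s t \<phi> x)) = \<phi> (ginv (f s x))"
    if "\<phi> \<in> ghom s t" "x \<in> pts X s" for s t \<phi> x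
    using sfunD(2)[OF f that] ghom_ginv[OF that(1) sfunD(1)[OF f that(2)] nz[OF that(2)]] by simp
  fix U c s x assume U: "(U, c) \<in> charts X" "x \<in> over X U s"
  note c = satlasD(3)[OF X U(1)]
  have inv: "inv_into (over X U s) (c s) (c s x) = x" by (rule chart_inv[OF X c U(2)])
  show "sdiff1 (par X) s (\<lambda>v. ginv (f s (inv_into (over X U s) (c s) v))) (c s x)"
  proof (rule sdiff1_ginv[OF sfunD(3)[OF f U]])
    show "sopen (par X) s (c s ` over X U s)"
      by (rule chart_image_sopen[OF X c chart_openin[OF X c] order_refl])
    show "f s (inv_into (over X U s) (c s) v) \<in> geven s" if "v \<in> c s ` over X U s" for v
      using sfunD(1)[OF f over_pts[OF inv_into_into[OF that]]] .
    show "gcoeff (f s (inv_into (over X U s) (c s) (c s x))) {} \<noteq> 0"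
      unfolding inv by (rule nz[OF over_pts[OF U(2)]])
  qed (use U in blast)
qed

lemma sfun_comp:
  fixes f :: "nat \<Rightarrow> 'a \<Rightarrow> 'b"
  assumes X: "satlas X" "(\<Union>(U, c)\<in>charts X. U) = pts X 0" and Y: "satlas Y" "(\<Union>(U, c)\<in>charts Y. U) = pts Y 0"
    and f: "smor X Y f" and g: "sfun Y b g"
  shows "sfun X b (\<lambda>s x. g s (f s x))"
proof (rule sfunI)
  have f': "\<And>s x. x \<in> pts X s \<Longrightarrow> f s x \<in> pts Y s" "natural_on (pts X) X Y f"
    using f unfolding smor_def by blast+
  show "g s (f s x) \<in> gpart b s" if "x \<in> pts X s" for s x
    by (rule sfunD(1)[OF g f'(1)[OF that]])
  show "g t (f t (act X s t \<phi> x)) = \<phi> (g s (f s x))" if "\<phi> \<in> ghom s t" "x \<in> pts X s" for s t \<phi> x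
    using sfunD(2)[OF g that(1) f'(1)[OF that(2)]] f'(2) that unfolding natural_on_def by metis
  fix U c s x assume U: "(U, c) \<in> charts X" "x \<in> over X U s"
  \<comment> \<open>A scalar function is read as a morphism into a superspace with one coordinate,
    so that the chain rule for vector-valued maps applies.\<close>
  let ?g = "\<lambda>s y. (\<chi> i::1. g s y)"
  have "smor Y (superspace (\<lambda>_. b)) ?g"
    unfolding smor_superspace_iff[OF Y] using g by simp
  then have g': "\<And>s y. y \<in> pts Y s \<Longrightarrow> ?g s y \<in> space_pts (\<lambda>_. b) s"
    "\<And>s y. y \<in> pts Y s \<Longrightarrow> sdat Y (superspace (\<lambda>_. b)) ?g s y"
    unfolding smor_iff_sdat[OF Y(1) satlas_superspace] by auto
  have "sdat X (superspace (\<lambda>_::1. b)) (\<lambda>s x. ?g s (f s x)) s x"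
    by (rule sdat_comp[OF X(1) Y f over_pts[OF U(2)] g'(2)[OF f'(1)[OF over_pts[OF U(2)]]]])
  then have "\<exists>L. sderiv (par X) s (\<lambda>v. ?g s (f s (inv_into (over X U s) (c s) v))) (c s x) L"
    using sdat_to_superspace[of X s "\<lambda>s x. ?g s (f s x)" "\<lambda>_. b" x] g'(1) f'(1) U by blast
  then show "sdiff1 (par X) s (\<lambda>v. g s (f s (inv_into (over X U s) (c s) v))) (c s x)"
    unfolding sderiv_iff_sdiff1 by simp
qed

lemma smor_open_sub_incl:
  assumes X: "satlas X" and U: "openin (base X) U" and f: "smor X Y f" and Y: "satlas Y"
  shows "smor (open_sub X U) Y f"
proof -
  have f': "\<And>s x. x \<in> pts X s \<Longrightarrow> f s x \<in> pts Y s" "natural_on (pts X) X Y f"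
    "continuous_map (base X) (base Y) (f 0)" "\<And>s x. x \<in> pts X s \<Longrightarrow> sdat X Y f s x"
    using f unfolding smor_iff_sdat[OF X Y] by blast+
  have "natural_on (over X U) (open_sub X U) Y f"
    using f'(2) over_pts[of _ X U] unfolding natural_on_def by simp
  moreover have "sdat (open_sub X U) Y f s x" if "x \<in> over X U s" for s x
    using sdat_open_sub[OF X U that, of Y f] f'(4)[OF over_pts[OF that]] by simp
  ultimately show ?thesis
    unfolding smor_iff_sdat[OF satlas_open_sub[OF X U] Y] using f'(1,3) over_pts[of _ X U]
    by (auto intro: continuous_map_from_subtopology)
qed

lemma sfun_nth: "sfun (superspace p) (p i) (\<lambda>s v. v $ i)"
proof -
  have "natural_on (pts (superspace p)) (superspace p) (superspace p) (\<lambda>s v. v)"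
    by (simp add: natural_on_def)
  moreover have "sdat (superspace p) (superspace p) (\<lambda>s v. v) s x" if "x \<in> space_pts p s" for s x
    using sdat_superspaces[OF that, of "\<lambda>s v. v" p] that sderiv_id by blast
  moreover have "continuous_map (top_of_set (space_pts p 0)) (top_of_set (space_pts p 0)) (\<lambda>v. v)"
    by (simp add: continuous_map_id[unfolded id_def])
  ultimately have "smor (superspace p) (superspace p) (\<lambda>s v. v)"
    unfolding smor_iff_sdat[OF satlas_superspace satlas_superspace] by simp
  then show ?thesis
    unfolding smor_superspace_iff[OF satlas_superspace superspace_cover] by blast
qed

lemma sfun_open_sub:
  assumes X: "satlas X" "(\<Union>(U, c)\<in>charts X. U) = pts X 0" and U: "openin (base X) U" and f: "sfun X b f"
  shows "sfun (open_sub X U) b f"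
proof -
  have "smor X (superspace (\<lambda>_::1. b)) (\<lambda>s y. (\<chi> i. f s y))"
    unfolding smor_superspace_iff[OF X] using f by simp
  then have "smor (open_sub X U) (superspace (\<lambda>_::1. b)) (\<lambda>s y. (\<chi> i. f s y))"
    by (rule smor_open_sub_incl[OF X(1) U _ satlas_superspace])
  then show ?thesis
    unfolding smor_superspace_iff[OF satlas_open_sub[OF X(1) U] open_sub_cover[OF X U]] by simp
qed

subsection \<open>Embedded supermanifolds of matrices\<close>

lemma mat_coords_nth [simp]: "mat_coords M $ k = M $ fst k $ snd k"
  by (simp add: mat_coords_def)

lemma mat_act_nth [simp]: "mat_act s t \<phi> M $ i $ j = \<phi> (M $ i $ j)"
  by (simp add: mat_act_def)

text \<open>The coordinate map of a graph chart: \<open>k\<close> lists the matrix positions that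
  serve as independent coordinates.\<close>

definition entries :: "('i \<Rightarrow> 'm \<times> 'n) \<Rightarrow> 'a ^ 'n::finite ^ 'm::finite \<Rightarrow> 'a ^ 'i::finite" where
  "entries k M = (\<chi> i. M $ fst (k i) $ snd (k i))"

lemma entries_nth [simp]: "entries k M $ i = M $ fst (k i) $ snd (k i)"
  by (simp add: entries_def)

lemma inj_mat_coords: "mat_coords M = mat_coords N \<longleftrightarrow> M = N"
  by (auto simp: vec_eq_iff)

context
  fixes q :: "'i::finite \<Rightarrow> bool" and p :: "'m::finite \<times> 'n::finite \<Rightarrow> bool"
    and P :: "nat \<Rightarrow> (grassmann ^ 'n ^ 'm) set" and E
  assumes pts: "\<And>s M. M \<in> P s \<Longrightarrow> mat_coords M \<in> space_pts p s"
    and act: "\<And>s t \<phi> M. \<phi> \<in> ghom s t \<Longrightarrow> M \<in> P s \<Longrightarrow> mat_act s t \<phi> M \<in> P t"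
    and E: "E = embedded q p mat_coords mat_act P"
begin

lemma embedded_simps:
  "sman.pts E = P" "sman.act E = mat_act" "base E = pullback_topology (P 0) mat_coords euclidean"
  "par E = q"
  by (simp_all add: E embedded_def Let_def)

lemma embedded_charts: "(U, c) \<in> charts E \<longleftrightarrow> is_chart E U c \<and>
        smor (open_sub (superspace q) (c 0 ` U)) (superspace p)
          (\<lambda>s v. mat_coords (inv_into (over E U s) (c s) v)) \<and>
        (\<forall>x\<in>U. \<exists>W F. sopen p 0 W \<and> mat_coords x \<in> W \<and>
           smor (open_sub (superspace p) W) (superspace q) F \<and>
           (\<forall>s. \<forall>y\<in>over E U s. mat_coords y \<in> over (superspace p) W s \<longrightarrow> F s (mat_coords y) = c s y))"
  by (simp add: E embedded_def Let_def is_chart_def over_def natural_on_def del: superspace_simps(5))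

lemma embedded_extend:
  "(U, c) \<in> charts E \<Longrightarrow> x \<in> U \<Longrightarrow> \<exists>W F. sopen p 0 W \<and> mat_coords x \<in> W \<and>
     smor (open_sub (superspace p) W) (superspace q) F \<and>
     (\<forall>s. \<forall>y\<in>over E U s. mat_coords y \<in> over (superspace p) W s \<longrightarrow> F s (mat_coords y) = c s y)"
  unfolding embedded_charts by (elim conjE) (erule bspec)

lemma embedded_entry: "M \<in> P s \<Longrightarrow> M $ i $ j \<in> gpart (p (i, j)) s"
  using space_pts_nth[OF pts, of M s "(i, j)"] by simp

lemma embedded_topspace: "topspace (base E) = P 0"
  by (simp add: embedded_simps topspace_pullback_topology)

lemma spoint_functor_embedded: "spoint_functor E"
proof -
  have ent: "M $ i $ j \<in> galg s" if "M \<in> P s" for M s i j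
    using gpart_galg[OF embedded_entry[OF that]] .
  have "mat_act s s (restrict id (galg s)) M = M" if "M \<in> P s" for M s
    using ent[OF that] by (simp add: vec_eq_iff)
  moreover have "mat_act s u (compose (galg s) \<psi> \<phi>) M = mat_act t u \<psi> (mat_act s t \<phi> M)"
    if "M \<in> P s" for M s t u \<phi> \<psi>
    using ent[OF that] by (simp add: vec_eq_iff compose_def)
  ultimately show ?thesis
    unfolding spoint_functor_def embedded_simps using act by auto
qed

lemma satlas_embedded: "satlas E"
  unfolding satlas_def using spoint_functor_embedded embedded_topspace embedded_simps embedded_charts
  by auto

text \<open>Charts of an embedded supermanifold are required to have inverses that are morphisms
  into the ambient superspace; an entry in such a chart is a component of that inverse.\<close>

lemma embedded_sfun_entry: "sfun E (p (i, j)) (\<lambda>s M. M $ i $ j)"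
proof (rule sfunI)
  show "M $ i $ j \<in> gpart (p (i, j)) s" if "M \<in> sman.pts E s" for s M
    using embedded_entry that by (simp add: embedded_simps)
  show "sman.act E s t \<phi> M $ i $ j = \<phi> (M $ i $ j)" for s t \<phi> M
    by (simp add: embedded_simps)
  fix U c s M assume U: "(U, c) \<in> charts E" "M \<in> over E U s"
  let ?g = "\<lambda>s v. mat_coords (inv_into (over E U s) (c s) v)"
  note c = satlasD(3)[OF satlas_embedded U(1)]
  have op: "openin (base (superspace q)) (c 0 ` U)"
    using chart_image_open[OF satlas_embedded c] by (simp add: embedded_simps)
  have sm: "smor (open_sub (superspace q) (c 0 ` U)) (superspace p) ?g"
    using U(1) embedded_charts by blast
  have v: "c s M \<in> over (superspace q) (c 0 ` U) s"
    using bij_betwE[OF chart_bij[OF satlas_embedded c, of s]] U(2) by (simp add: embedded_simps)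
  then have "sdat (open_sub (superspace q) (c 0 ` U)) (superspace p) ?g s (c s M)"
    "?g s (c s M) \<in> space_pts p s"
    using sm unfolding smor_iff_sdat[OF satlas_open_sub[OF satlas_superspace op] satlas_superspace]
    by auto
  then have "\<exists>L. sderiv q s (?g s) (c s M) L"
    using sdat_open_sub[OF satlas_superspace op v, of "superspace p" ?g] sdat_superspaces[of "c s M" q s ?g p]
      over_pts[OF v] by simp
  then show "sdiff1 (par E) s (\<lambda>v. inv_into (over E U s) (c s) v $ i $ j) (c s M)"
    unfolding sderiv_iff_sdiff1 by (simp add: embedded_simps)
qed

lemma body_mat_coords:
  assumes "M \<in> P s" shows "sbody (mat_coords M) = mat_coords (body_pt E s M)"
  using gpart_galg[OF embedded_entry[OF assms]] by (simp add: vec_eq_iff embedded_simps)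

text \<open>The local extension of a chart, brought to the points over one superpoint: near
  \<open>x\<close> the chart is the restriction of a differentiable map on an ambient open
  set.\<close>

lemma embedded_chart_smooth:
  assumes U: "(U, c) \<in> charts E" and x: "x \<in> over E U s"
  obtains F M A where "sopen p s A" "mat_coords x \<in> A"
    "\<And>y. y \<in> P s \<Longrightarrow> mat_coords y \<in> A \<Longrightarrow> y \<in> over E U s \<and> F (mat_coords y) = c s y"
    "sderiv p s F (mat_coords x) M"
proof -
  have b: "body_pt E s x \<in> U" and xP: "x \<in> P s" using x by (simp_all add: over_def embedded_simps)
  obtain W F where F: "sopen p 0 W" "mat_coords (body_pt E s x) \<in> W"
    "smor (open_sub (superspace p) W) (superspace q) F"
    "\<forall>s. \<forall>y\<in>over E U s. mat_coords y \<in> over (superspace p) W s \<longrightarrow> F s (mat_coords y) = c s y"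
    using embedded_extend[OF U b] by blast
  have Wo: "openin (base (superspace p)) W" using F(1) by simp
  have "openin (pullback_topology (P 0) mat_coords euclidean) U"
    using chart_openin[OF satlas_embedded satlasD(3)[OF satlas_embedded U]]
    by (simp add: embedded_simps(3))
  then obtain T where T: "open T" "U = mat_coords -` T \<inter> P 0"
    by (auto simp: openin_pullback_topology)
  \<comment> \<open>\<open>T\<close> comes from the pullback topology and cuts out \<open>U\<close>.
    After this intersection, membership of \<open>mat_coords y\<close> alone forces \<open>y\<close>
    to lie over \<open>U\<close>.\<close>
  let ?W = "W \<inter> (space_pts p 0 \<inter> T)"
  let ?A = "over (superspace p) ?W s"
  have "sopen p 0 ?W" using F(1) T(1) by (intro openin_Int openin_open_Int)
  then have A: "sopen p s ?A" by (rule sopen_over_superspace)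
  have xb: "sbody (mat_coords x) = mat_coords (body_pt E s x)" by (rule body_mat_coords[OF xP])
  have "sbody (mat_coords x) \<in> ?W"
    unfolding xb using F(2) b T(2) pts by auto
  then have xA: "mat_coords x \<in> ?A" using pts[OF xP] by (simp add: over_superspace)
  have sub: "?A \<subseteq> over (superspace p) W s" by (rule over_mono) simp
  have "sdat (open_sub (superspace p) W) (superspace q) F s (mat_coords x)" "F s (mat_coords x) \<in> space_pts q s"
    using F(3) sub xA unfolding smor_iff_sdat[OF satlas_open_sub[OF satlas_superspace Wo] satlas_superspace]
    by auto
  then obtain M where M: "sderiv p s (F s) (mat_coords x) M"
    using sdat_open_sub[OF satlas_superspace Wo, of "mat_coords x" s "superspace q" F] sub xA
      sdat_superspaces[of "mat_coords x" p s F q] pts[OF xP] by auto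
  show thesis
  proof (rule that[OF A xA _ M])
    fix y assume y: "y \<in> P s" "mat_coords y \<in> ?A"
    have "mat_coords (body_pt E s y) \<in> T"
    proof -
      have "sbody (mat_coords y) \<in> T" using y(2) by (simp add: over_superspace)
      then show ?thesis by (metis body_mat_coords[OF y(1)])
    qed
    moreover have "body_pt E s y \<in> P 0"
      using act[OF bodyhom_ghom y(1)] by (simp add: embedded_simps)
    ultimately have "y \<in> over E U s" using y(1) T(2) by (simp add: over_def embedded_simps)
    then show "y \<in> over E U s \<and> F s (mat_coords y) = c s y" using F(4) sub y(2) by blast
  qed
qed

text \<open>A map that is differentiable as an ambient map stays differentiable when read in a
  chart, by composition with the local extension. \<open>\<phi>\<close> is given over one superpoint
  only and need not be part of a natural family; the inverse of a chart and a translated section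
  will both be inserted. The derivative factors through \<open>K\<close>.\<close>

lemma embedded_chart_comp:
  assumes U: "(U, c) \<in> charts E"
    and D: "sopen r s D" "w0 \<in> D" and \<phi>: "\<And>w. w \<in> D \<Longrightarrow> \<phi> w \<in> P s"
    and K: "sderiv r s (\<lambda>w. mat_coords (\<phi> w)) w0 K"
    and cont: "\<And>w. w \<in> D \<Longrightarrow> \<exists>K. sderiv r s (\<lambda>w. mat_coords (\<phi> w)) w K"
    and x: "\<phi> w0 \<in> over E U s"
  obtains A M where "sopen r s A" "w0 \<in> A" "A \<subseteq> D" "\<And>w. w \<in> A \<Longrightarrow> \<phi> w \<in> over E U s"
    "sderiv r s (\<lambda>w. c s (\<phi> w)) w0 (\<lambda>h. M (K h))"
proof -
  obtain F M A where F: "sopen p s A" "mat_coords (\<phi> w0) \<in> A"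
    "\<And>y. y \<in> P s \<Longrightarrow> mat_coords y \<in> A \<Longrightarrow> y \<in> over E U s \<and> F (mat_coords y) = c s y"
    "sderiv p s F (mat_coords (\<phi> w0)) M"
    by (rule embedded_chart_smooth[OF U x], rule that)
  have "continuous (at w within D) (\<lambda>w. mat_coords (\<phi> w))" if "w \<in> D" for w
    using cont[OF that] sderiv_continuous at_within_openin[OF D(1) that] by metis
  then have "continuous_on D (\<lambda>w. mat_coords (\<phi> w))"
    by (simp add: continuous_on_eq_continuous_within)
  then have "openin (top_of_set D) (D \<inter> (\<lambda>w. mat_coords (\<phi> w)) -` A)"
    by (rule continuous_openin_preimage[OF _ _ F(1)]) (use pts \<phi> in auto)
  then have A': "sopen r s (D \<inter> (\<lambda>w. mat_coords (\<phi> w)) -` A)"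
    using openin_trans D(1) by blast
  have w0: "w0 \<in> D \<inter> (\<lambda>w. mat_coords (\<phi> w)) -` A" using D(2) F(2) by simp
  have "sderiv r s (\<lambda>w. F (mat_coords (\<phi> w))) w0 (\<lambda>h. M (K h))"
    by (rule sderiv_chain[OF K D pts[OF \<phi>] F(4)])
  then have "sderiv r s (\<lambda>w. c s (\<phi> w)) w0 (\<lambda>h. M (K h))"
    by (subst sderiv_cong[OF A' w0]) (use F(3) \<phi> in auto)
  then show thesis
    by (intro that[OF A' w0]) (use F(3) \<phi> in auto)
qed

text \<open>The universal property of an embedded supermanifold: smooth entries give a smooth
  ambient map, the local extensions of charts make it smooth in every chart, and the pullback
  topology makes it continuous.\<close>

lemma smor_into_embedded:
  assumes X: "satlas X" "(\<Union>(U, c)\<in>charts X. U) = sman.pts X 0"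
    and f: "\<And>s x. x \<in> sman.pts X s \<Longrightarrow> f s x \<in> P s"
    and ent: "\<And>i j. sfun X (p (i, j)) (\<lambda>s x. f s x $ i $ j)"
  shows "smor X E f"
proof -
  let ?k = "\<lambda>s x. mat_coords (f s x)"
  have k: "smor X (superspace p) ?k"
    unfolding smor_superspace_iff[OF X] using ent by simp
  then have k': "\<And>s. ?k s \<in> sman.pts X s \<rightarrow> sman.pts (superspace p) s" "natural_on (sman.pts X) X (superspace p) ?k"
    "continuous_map (base X) (base (superspace p)) (?k 0)" "\<And>s x. x \<in> sman.pts X s \<Longrightarrow> sdat X (superspace p) ?k s x"
    unfolding smor_iff_sdat[OF X(1) satlas_superspace] by blast+
  have f': "\<And>s. f s \<in> sman.pts X s \<rightarrow> sman.pts E s"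
    using f by (auto simp: embedded_simps)
  have nat: "natural_on (sman.pts X) X E f"
    unfolding natural_on_def using sfunD(2)[OF ent] by (simp add: embedded_simps vec_eq_iff)
  have cont: "continuous_map (base X) (base E) (f 0)"
    unfolding embedded_simps
  proof (rule continuous_map_pullback')
    have "continuous_map (base X) euclidean (?k 0)"
      using k'(3) continuous_map_into_fulltopology by auto
    then show "continuous_map (base X) euclidean (mat_coords \<circ> f 0)" by (simp add: comp_def)
    show "topspace (base X) \<subseteq> f 0 -` P 0" using f satlasD(2)[OF X(1)] by auto
  qed
  have "sdat X E f s x" if x: "x \<in> sman.pts X s" for s x
    unfolding sdat_def
  proof (intro allI impI)
    fix U c W d
    assume U: "(U, c) \<in> charts X" and W: "(W, d) \<in> charts E"
      and xU: "x \<in> over X U s" and fW: "f s x \<in> over E W s"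
    note c = satlasD(3)[OF X(1) U] and d = satlasD(3)[OF satlas_embedded W]
    let ?D = "c s ` over X U s"
    have D: "sopen (par X) s ?D"
      by (rule chart_image_sopen[OF X(1) c chart_openin[OF X(1) c] order_refl])
    have K: "\<exists>K. sderiv (par X) s (\<lambda>v. ?k s (inv_into (over X U s) (c s) v)) v K" if v: "v \<in> ?D" for v
    proof -
      obtain y where y: "v = c s y" "y \<in> over X U s" using v by blast
      then show ?thesis
        using k'(4)[OF over_pts[OF y(2)]] U sdat_to_superspace[of X s ?k p y] k'(1) by auto
    qed
    then obtain L where L: "sderiv (par X) s (\<lambda>v. ?k s (inv_into (over X U s) (c s) v)) (c s x) L"
      using xU by blast
    obtain N where "sderiv (par X) s (\<lambda>v. d s (f s (inv_into (over X U s) (c s) v))) (c s x) N"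
    proof (rule embedded_chart_comp[OF W D _ _ L])
      show "f s (inv_into (over X U s) (c s) v) \<in> P s" if "v \<in> ?D" for v
        by (rule f[OF over_pts[OF inv_into_into[OF that]]])
      show "f s (inv_into (over X U s) (c s) (c s x)) \<in> over E W s"
        using fW chart_inv[OF X(1) c xU] by simp
    qed (use K xU that in blast)+
    then show "\<exists>L. sderiv (par X) s (local_rep X f U c d s) (c s x) L"
      unfolding local_rep_def by blast
  qed
  then show ?thesis
    unfolding smor_iff_sdat[OF X(1) satlas_embedded] using f' nat cont by blast
qed

lemma embedded_param_sderiv:
  assumes U: "(U, c) \<in> charts E" and x: "x \<in> over E U s"
  shows "\<exists>K. sderiv q s (\<lambda>v. mat_coords (inv_into (over E U s) (c s) v)) (c s x) K"
  unfolding sderiv_iff_sdiff1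
proof
  fix k
  show "sdiff1 q s (\<lambda>v. mat_coords (inv_into (over E U s) (c s) v) $ k) (c s x)"
    using sfunD(3)[OF embedded_sfun_entry U x, of "fst k" "snd k"] by (simp add: embedded_simps)
qed

text \<open>The chart composed with its inverse is the identity, so differentiation yields a left
  inverse \<open>M\<close> of \<open>K\<close> on the model space.\<close>

lemma embedded_param_inj:
  assumes U: "(U, c) \<in> charts E" and x: "x \<in> over E U s"
    and K: "sderiv q s (\<lambda>v. mat_coords (inv_into (over E U s) (c s) v)) (c s x) K"
  shows "inj_on K (space_pts q s)"
proof -
  note at = satlas_embedded
  note c = satlasD(3)[OF at U]
  let ?D = "c s ` over E U s"
  have D: "sopen q s ?D"
    using chart_image_sopen[OF at c chart_openin[OF at c] order_refl] by (simp add: embedded_simps)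
  have inD: "inv_into (over E U s) (c s) w \<in> over E U s" if "w \<in> ?D" for w
    by (rule inv_into_into[OF that])
  obtain A M where A: "sopen q s A" "c s x \<in> A" "A \<subseteq> ?D"
    "sderiv q s (\<lambda>w. c s (inv_into (over E U s) (c s) w)) (c s x) (\<lambda>h. M (K h))"
  proof (rule embedded_chart_comp[OF U D _ _ K])
    show "c s x \<in> ?D" using x by blast
    show "inv_into (over E U s) (c s) w \<in> P s" if "w \<in> ?D" for w
      using over_pts[OF inD[OF that]] by (simp add: embedded_simps)
    show "\<exists>K. sderiv q s (\<lambda>w. mat_coords (inv_into (over E U s) (c s) w)) w K" if "w \<in> ?D" for w
      using that embedded_param_sderiv[OF U] by blast
    show "inv_into (over E U s) (c s) (c s x) \<in> over E U s" using inD x by blast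
  qed
  have "c s (inv_into (over E U s) (c s) w) = w" if "w \<in> A" for w
    using that A(3) by (auto simp: f_inv_into_f)
  then have "sderiv q s (\<lambda>w. w) (c s x) (\<lambda>h. M (K h))"
    using A(4) sderiv_cong[OF A(1,2), of "\<lambda>w. c s (inv_into (over E U s) (c s) w)" "\<lambda>w. w"] by blast
  then have "M (K h) = h" if "h \<in> space_pts q s" for h
    using sderiv_unique[OF _ sderiv_id _ that] openin_imp_subset[OF A(1)] A(2) by blast
  then show ?thesis by (rule inj_on_inverseI)
qed

text \<open>\<open>\<Gamma>\<close> reconstructs a matrix from its selected entries, so over
  \<open>V\<close> the functor is a graph. Smoothness of \<open>\<Gamma>\<close> gives the condition
  on the inverse, and the selection of entries is defined on all matrices, which gives the
  extension.\<close>

lemma embedded_graph_chart: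
  fixes k :: "'i \<Rightarrow> 'm \<times> 'n" and \<Gamma> :: "nat \<Rightarrow> grassmann ^ 'i \<Rightarrow> grassmann ^ 'n ^ 'm"
  assumes k: "\<And>i. p (k i) = q i" and V: "sopen q 0 V"
    and \<Gamma>: "\<And>s v. v \<in> over (superspace q) V s \<Longrightarrow> \<Gamma> s v \<in> P s"
      "\<And>s v. v \<in> over (superspace q) V s \<Longrightarrow> entries k (\<Gamma> s v) = v"
      "\<And>s M. M \<in> P s \<Longrightarrow> entries k M \<in> over (superspace q) V s \<Longrightarrow> \<Gamma> s (entries k M) = M"
      "\<And>i j. sfun (open_sub (superspace q) V) (p (i, j)) (\<lambda>s v. \<Gamma> s v $ i $ j)"
  shows "({M \<in> P 0. entries k M \<in> V}, \<lambda>s. entries k) \<in> charts E"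
proof -
  let ?U = "{M \<in> P 0. entries k M \<in> V}" and ?O = "open_sub (superspace q) V"
  have Vo: "openin (base (superspace q)) V" using V by simp
  have O: "satlas ?O" "(\<Union>(U, c)\<in>charts ?O. U) = sman.pts ?O 0"
    by (rule satlas_open_sub[OF satlas_superspace Vo], rule open_sub_cover[OF satlas_superspace superspace_cover Vo])
  have VS: "V \<subseteq> space_pts q 0" by (rule openin_imp_subset[OF V])
  have V0: "over (superspace q) V 0 = V" by (rule over_superspace_0[OF VS])
  have entS: "entries k M \<in> space_pts q s" if "M \<in> P s" for M s
  proof -
    have "M $ fst (k i) $ snd (k i) \<in> gpart (q i) s" for i
      using space_pts_nth[OF pts[OF that], of "k i"] k[of i] by simp
    then show ?thesis by (simp add: space_pts_def)
  qed
  have ent_act: "entries k (mat_act s t \<phi> M) = (\<chi> i. \<phi> (entries k M $ i))" for s t \<phi> M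
    by (simp add: vec_eq_iff)
  have overU: "M \<in> over E ?U s \<longleftrightarrow> M \<in> P s \<and> entries k M \<in> over (superspace q) V s" for M s
  proof (cases "M \<in> P s")
    case True
    have "entries k (mat_act s 0 (bodyhom s) M) = sbody (entries k M)"
      using gpart_galg[OF embedded_entry[OF True]] by (simp add: vec_eq_iff)
    then show ?thesis
      using True entS[OF True] act[OF bodyhom_ghom True, of 0]
      by (simp add: over_def[of E] embedded_simps over_superspace)
  qed (simp add: over_def embedded_simps)
  have smG: "smor ?O E \<Gamma>"
    by (rule smor_into_embedded[OF O]) (use \<Gamma> in auto)
  have bij: "bij_betw (entries k) (over E ?U s) (over (superspace q) V s)" for s
    by (rule bij_betw_byWitness[of _ "\<Gamma> s"]) (use overU \<Gamma> in auto)
  have imU: "entries k ` ?U = V"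
  proof -
    have "over E ?U 0 = ?U" using overU V0 by auto
    then show ?thesis using bij_betw_imp_surj_on[OF bij[of 0]] V0 by simp
  qed
  let ?T = "\<lambda>w :: grassmann ^ ('m \<times> 'n). \<chi> i. w $ k i"
  have T: "continuous_on A ?T" for A
    by (intro continuous_on_vec_lambda continuous_on_component continuous_on_id)
  have entT: "entries k M = ?T (mat_coords M)" for M by (simp add: vec_eq_iff)
  have cont_ent: "continuous_map (base E) euclidean (entries k)"
  proof -
    have "continuous_map (base E) euclidean (?T \<circ> mat_coords)"
      unfolding embedded_simps by (rule continuous_map_pullback) (use T in auto)
    then show ?thesis by (simp add: comp_def entT[abs_def])
  qed
  have Uop: "openin (base E) ?U"
  proof -
    obtain T' where "open T'" "V = space_pts q 0 \<inter> T'" using V by (auto simp: openin_open)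
    then have "?U = {M \<in> topspace (base E). entries k M \<in> T'}"
      using entS embedded_topspace by auto
    then show ?thesis
      using openin_continuous_map_preimage[OF cont_ent, of T'] \<open>open T'\<close> by simp
  qed
  have homeo: "homeomorphic_map (subtopology (base E) ?U) (subtopology (top_of_set (space_pts q 0)) V) (entries k)"
  proof -
    have "homeomorphic_maps (subtopology (base E) ?U) (subtopology (top_of_set (space_pts q 0)) V) (entries k) (\<Gamma> 0)"
      unfolding homeomorphic_maps_def
    proof (intro conjI ballI)
      show "continuous_map (subtopology (base E) ?U) (subtopology (top_of_set (space_pts q 0)) V) (entries k)"
        using continuous_map_from_subtopology[OF cont_ent] VS
        by (auto simp: continuous_map_in_subtopology)
      have "continuous_map (subtopology (top_of_set (space_pts q 0)) V) (base E) (\<Gamma> 0)"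
        using smG unfolding smor_def by simp
      then show "continuous_map (subtopology (top_of_set (space_pts q 0)) V) (subtopology (base E) ?U) (\<Gamma> 0)"
        using \<Gamma>(1,2)[of _ 0] V0 by (auto simp: continuous_map_in_subtopology)
    qed (use \<Gamma>(2,3)[of _ 0] V0 in auto)
    then show ?thesis by (rule homeomorphic_maps_imp_map)
  qed
  have chart: "is_chart E ?U (\<lambda>s. entries k)"
    unfolding is_chart_def embedded_simps(4) imU
  proof (intro conjI allI)
    show "natural_on (over E ?U) E (superspace q) (\<lambda>s. entries k)"
      unfolding natural_on_def by (simp add: embedded_simps ent_act)
  qed (use Uop Vo homeo bij in auto)
  have "smor ?O (superspace p) (\<lambda>s v. mat_coords (inv_into (over E ?U s) (entries k) v))"
    unfolding smor_superspace_iff[OF O]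
  proof
    fix ij
    have inv: "inv_into (over E ?U s) (entries k) v = \<Gamma> s v" if "v \<in> over (superspace q) V s" for s v
    proof -
      have "\<Gamma> s v \<in> over E ?U s" using that overU \<Gamma>(1,2) by simp
      then have "inv_into (over E ?U s) (entries k) (entries k (\<Gamma> s v)) = \<Gamma> s v"
        by (rule inv_into_f_f[OF bij_betw_imp_inj_on[OF bij]])
      then show ?thesis by (simp only: \<Gamma>(2)[OF that])
    qed
    have "sfun ?O (p ij) (\<lambda>s v. \<Gamma> s v $ fst ij $ snd ij)" using \<Gamma>(4)[of "fst ij" "snd ij"] by simp
    then show "sfun ?O (p ij) (\<lambda>s v. mat_coords (inv_into (over E ?U s) (entries k) v) $ ij)"
      by (rule sfun_cong[OF O(1)]) (simp add: inv)
  qed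
  moreover have "\<exists>W F. sopen p 0 W \<and> mat_coords x \<in> W \<and> smor (open_sub (superspace p) W) (superspace q) F \<and>
           (\<forall>s. \<forall>y\<in>over E ?U s. mat_coords y \<in> over (superspace p) W s \<longrightarrow> F s (mat_coords y) = entries k y)"
    if "x \<in> ?U" for x
  proof (intro exI conjI)
    show "sopen p 0 (space_pts p 0)" by simp
    show "mat_coords x \<in> space_pts p 0" using that pts by blast
    \<comment> \<open>The linear projection onto the selected coordinates, one extension on the
      whole ambient space that serves every point of the domain.\<close>
    have "smor (superspace p) (superspace q) (\<lambda>s. ?T)"
      unfolding smor_superspace_iff[OF satlas_superspace superspace_cover]
    proof
      show "sfun (superspace p) (q i) (\<lambda>s w. ?T w $ i)" for i
        using sfun_nth[of p "k i"] k[of i] by simp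
    qed
    then show "smor (open_sub (superspace p) (space_pts p 0)) (superspace q) (\<lambda>s. ?T)"
      by (intro smor_open_sub_incl[OF satlas_superspace _ _ satlas_superspace]) simp_all
  qed (simp add: entT)
  ultimately show ?thesis
    unfolding embedded_charts imU using chart by simp
qed

text \<open>Only covering has to be supplied. Transitions are smooth because the identity has smooth
  entries, and the separation and countability conditions are inherited from the ambient reduced
  space through the topological inclusion \<open>mat_coords\<close>.\<close>

lemma supermanifold_embedded:
  assumes "(\<Union>(U, c)\<in>charts E. U) = P 0"
  shows "supermanifold E"
proof -
  have cover: "(\<Union>(U, c)\<in>charts E. U) = sman.pts E 0" using assms by (simp add: embedded_simps)
  have "smor E E (\<lambda>s x. x)"
    by (rule smor_into_embedded[OF satlas_embedded cover]) (simp_all add: embedded_simps embedded_sfun_entry)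
  then have tr: "sdiff_in_charts E E (\<lambda>s x. x)" unfolding smor_def by blast
  have cm: "continuous_map (base E) (base (superspace p)) mat_coords"
  proof -
    have "continuous_map (base E) euclidean (id \<circ> mat_coords)"
      unfolding embedded_simps by (rule continuous_map_pullback) simp
    then show ?thesis using pts embedded_topspace by (auto simp: continuous_map_in_subtopology)
  qed
  have "inj_on mat_coords (topspace (base E))" by (simp add: inj_on_def inj_mat_coords)
  then have "Hausdorff_space (base E)"
    by (rule Hausdorff_space_injective_preimage[OF Hausdorff_superspace cm])
  moreover have "second_countable (base E)"
  proof -
    let ?S = "mat_coords ` P 0"
    have "homeomorphic_maps (base E) (subtopology (base (superspace p)) ?S) mat_coords (inv_into (P 0) mat_coords)"
      unfolding homeomorphic_maps_def
    proof (intro conjI ballI)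
      show "continuous_map (base E) (subtopology (base (superspace p)) ?S) mat_coords"
        using cm embedded_topspace by (auto simp: continuous_map_in_subtopology)
      show "continuous_map (subtopology (base (superspace p)) ?S) (base E) (inv_into (P 0) mat_coords)"
        unfolding embedded_simps
      proof (rule continuous_map_pullback')
        have "continuous_map (subtopology (base (superspace p)) ?S) euclidean id"
          by (simp add: continuous_map_from_subtopology subtopology_subtopology)
        then show "continuous_map (subtopology (base (superspace p)) ?S) euclidean (mat_coords \<circ> inv_into (P 0) mat_coords)"
          by (rule continuous_map_eq) (simp add: f_inv_into_f)
        show "topspace (subtopology (base (superspace p)) ?S) \<subseteq> inv_into (P 0) mat_coords -` P 0"
          by (auto intro: inv_into_into)
      qed
      show "inv_into (P 0) mat_coords (mat_coords x) = x" if "x \<in> topspace (base E)" for x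
        using that embedded_topspace by (intro inv_into_f_f) (auto simp: inj_on_def inj_mat_coords)
      show "mat_coords (inv_into (P 0) mat_coords y) = y"
        if "y \<in> topspace (subtopology (base (superspace p)) ?S)" for y
        using that by (simp add: f_inv_into_f)
    qed
    then have "base E homeomorphic_space subtopology (base (superspace p)) ?S"
      unfolding homeomorphic_space_def by blast
    then show ?thesis
      using homeomorphic_space_second_countability second_countable_subtopology[OF second_countable_superspace]
      by blast
  qed
  ultimately show ?thesis
    unfolding supermanifold_def using spoint_functor_embedded embedded_topspace embedded_simps tr cover
      satlasD(3)[OF satlas_embedded] by auto
qed

end

subsection \<open>Products\<close>

definition vjoin :: "grassmann ^ 'i::finite \<Rightarrow> grassmann ^ 'j::finite \<Rightarrow> grassmann ^ ('i + 'j)" where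
  "vjoin u w = (\<chi> k. case_sum (\<lambda>i. u $ i) (\<lambda>j. w $ j) k)"

definition vleft :: "grassmann ^ ('i::finite + 'j::finite) \<Rightarrow> grassmann ^ 'i" where
  "vleft v = (\<chi> i. v $ Inl i)"

definition vright :: "grassmann ^ ('i::finite + 'j::finite) \<Rightarrow> grassmann ^ 'j" where
  "vright v = (\<chi> j. v $ Inr j)"

lemma vjoin_nth [simp]: "vjoin u w $ Inl i = u $ i" "vjoin u w $ Inr j = w $ j"
  by (simp_all add: vjoin_def)

lemma vleft_nth [simp]: "vleft v $ i = v $ Inl i"
  and vright_nth [simp]: "vright v $ j = v $ Inr j"
  by (simp_all add: vleft_def vright_def)

lemma vec_sum_eq_iff: "v = w \<longleftrightarrow> (\<forall>i. v $ Inl i = w $ Inl i) \<and> (\<forall>j. v $ Inr j = w $ Inr j)"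
  unfolding vec_eq_iff by (metis sum.exhaust)

lemma vleft_vjoin [simp]: "vleft (vjoin u w) = u"
  and vright_vjoin [simp]: "vright (vjoin u w) = w"
  by (simp_all add: vec_eq_iff)

lemma vjoin_vleft_vright [simp]: "vjoin (vleft v) (vright v) = v"
  by (simp add: vec_sum_eq_iff)

lemma space_pts_case_sum:
  "v \<in> space_pts (case_sum p q) s \<longleftrightarrow> vleft v \<in> space_pts p s \<and> vright v \<in> space_pts q s"
proof
  assume "v \<in> space_pts (case_sum p q) s"
  then have "v $ k \<in> gpart (case_sum p q k) s" for k by (rule space_pts_nth)
  from this[of "Inl _"] this[of "Inr _"] show "vleft v \<in> space_pts p s \<and> vright v \<in> space_pts q s"
    by (simp add: space_pts_def)
next
  assume a: "vleft v \<in> space_pts p s \<and> vright v \<in> space_pts q s"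
  have "v $ k \<in> gpart (case_sum p q k) s" for k
    using a by (cases k) (simp_all add: space_pts_def)
  then show "v \<in> space_pts (case_sum p q) s" by (simp add: space_pts_def)
qed

lemma vleft_sbody [simp]: "vleft (sbody v) = sbody (vleft v)"
  and vright_sbody [simp]: "vright (sbody v) = sbody (vright v)"
  by (simp_all add: vec_eq_iff)

lemma bounded_linear_vleft: "bounded_linear vleft"
  unfolding vleft_def by (rule bounded_linear_vec_lambda) (rule bounded_linear_vec_nth)

lemma bounded_linear_vright: "bounded_linear vright"
  unfolding vright_def by (rule bounded_linear_vec_lambda) (rule bounded_linear_vec_nth)

lemma sderiv_vleft: "sderiv p s vleft x vleft"
  by (rule sderiv_linear[OF bounded_linear_vleft]) (simp add: vec_eq_iff)

lemma sderiv_vright: "sderiv p s vright x vright"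
  by (rule sderiv_linear[OF bounded_linear_vright]) (simp add: vec_eq_iff)

lemma sdiff1_chain:
  assumes f: "sderiv p s f x L" and A: "sopen p s A" "x \<in> A" "\<And>v. v \<in> A \<Longrightarrow> f v \<in> space_pts q s"
    and g: "sdiff1 q s g (f x)"
  shows "sdiff1 p s (\<lambda>v. g (f v)) x"
proof -
  have "\<exists>M. sderiv q s (\<lambda>v. \<chi> i::1. g v) (f x) M"
    unfolding sderiv_iff_sdiff1 using g by simp
  then obtain M where "sderiv q s (\<lambda>v. \<chi> i::1. g v) (f x) M" by blast
  from sderiv_chain[OF f A this] have "\<exists>M. sderiv p s (\<lambda>v. \<chi> i::1. g (f v)) x M" by blast
  then show ?thesis unfolding sderiv_iff_sdiff1 by simp
qed

lemma sdiff1_cong: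
  assumes "sopen p s A" "x \<in> A" "\<And>v. v \<in> A \<Longrightarrow> f v = g v"
  shows "sdiff1 p s f x \<longleftrightarrow> sdiff1 p s g x"
proof -
  have "(f has_derivative L) (at x within space_pts p s) \<longleftrightarrow> (g has_derivative L) (at x within space_pts p s)" for L
    by (rule has_derivative_cong_openin[OF assms])
  then show ?thesis unfolding sdiff1_def by simp
qed

lemma sprod_simps [simp]:
  "pts (sprod X Y) s = pts X s \<times> pts Y s" "act (sprod X Y) s t \<phi> (x, y) = (act X s t \<phi> x, act Y s t \<phi> y)"
  "base (sprod X Y) = prod_topology (base X) (base Y)" "par (sprod X Y) = case_sum (par X) (par Y)"
  by (simp_all add: sprod_def)

lemma charts_sprod:
  "(Z, e) \<in> charts (sprod X Y) \<longleftrightarrow> (\<exists>U c W d. Z = U \<times> W \<and> e = (\<lambda>s (x, y). vjoin (c s x) (d s y)) \<and>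
     (U, c) \<in> charts X \<and> (W, d) \<in> charts Y)"
  by (simp add: sprod_def vjoin_def)

lemma over_sprod: "over (sprod X Y) (U \<times> W) s = over X U s \<times> over Y W s"
  by (auto simp: over_def)

lemma spoint_functor_sprod: 
  assumes "spoint_functor X" "spoint_functor Y" shows "spoint_functor (sprod X Y)"
  unfolding spoint_functor_def
  using spoint_functorD[OF assms(1)] spoint_functorD[OF assms(2)] by auto

text \<open>The chart is the product of the two charts followed by \<open>vjoin\<close>, which glues
  the coordinate vectors; each is a homeomorphism onto its image over \<open>s = 0\<close>.\<close>

lemma is_chart_sprod:
  assumes X: "satlas X" "is_chart X U c" and Y: "satlas Y" "is_chart Y W d"
  shows "is_chart (sprod X Y) (U \<times> W) (\<lambda>s (x, y). vjoin (c s x) (d s y))"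
proof -
  let ?e = "\<lambda>s (x, y). vjoin (c s x) (d s y)"
  let ?p = "case_sum (par X) (par Y)"
  \<comment> \<open>The image is described by its two halves, so openness and the points over it can
    be treated factor by factor.\<close>
  let ?J = "{v \<in> space_pts ?p 0. vleft v \<in> c 0 ` U \<and> vright v \<in> d 0 ` W}"
  have cU: "c 0 ` U \<subseteq> space_pts (par X) 0" and dW: "d 0 ` W \<subseteq> space_pts (par Y) 0"
    using openin_imp_subset[OF chart_image_open[OF X]] openin_imp_subset[OF chart_image_open[OF Y]] by auto
  have im: "?e 0 ` (U \<times> W) = ?J"
  proof (intro equalityI subsetI)
    fix v assume "v \<in> ?J"
    then obtain x y where xy: "x \<in> U" "y \<in> W" "vleft v = c 0 x" "vright v = d 0 y" by auto
    have "v = ?e 0 (x, y)" by (simp flip: xy(3,4))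
    then show "v \<in> ?e 0 ` (U \<times> W)" using xy by blast
  next
    fix v assume "v \<in> ?e 0 ` (U \<times> W)"
    then obtain x y where "x \<in> U" "y \<in> W" "v = vjoin (c 0 x) (d 0 y)" by auto
    then show "v \<in> ?J" using cU dW by (auto simp: space_pts_case_sum)
  qed
  have overJ: "v \<in> over (superspace ?p) ?J s \<longleftrightarrow>
      vleft v \<in> over (superspace (par X)) (c 0 ` U) s \<and> vright v \<in> over (superspace (par Y)) (d 0 ` W) s" for v s
    using sbody_space_pts[of v ?p s 0] by (auto simp: over_superspace space_pts_case_sum)
  have bij: "bij_betw (?e s) (over (sprod X Y) (U \<times> W) s) (over (superspace ?p) ?J s)" for s
  proof (rule bij_betwI[where g = "\<lambda>v. (inv_into (over X U s) (c s) (vleft v), inv_into (over Y W s) (d s) (vright v))"])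
    note b1 = chart_bij[OF X, of s] and b2 = chart_bij[OF Y, of s]
    show "?e s \<in> over (sprod X Y) (U \<times> W) s \<rightarrow> over (superspace ?p) ?J s"
      using bij_betwE[OF b1] bij_betwE[OF b2] by (auto simp: over_sprod overJ)
    show "(\<lambda>v. (inv_into (over X U s) (c s) (vleft v), inv_into (over Y W s) (d s) (vright v)))
        \<in> over (superspace ?p) ?J s \<rightarrow> over (sprod X Y) (U \<times> W) s"
      using bij_betwE[OF bij_betw_inv_into[OF b1]] bij_betwE[OF bij_betw_inv_into[OF b2]]
      by (auto simp: over_sprod overJ)
    show "(inv_into (over X U s) (c s) (vleft (?e s z)), inv_into (over Y W s) (d s) (vright (?e s z))) = z"
      if "z \<in> over (sprod X Y) (U \<times> W) s" for z
      using that chart_inv[OF X] chart_inv[OF Y] by (auto simp: over_sprod)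
    show "?e s (inv_into (over X U s) (c s) (vleft v), inv_into (over Y W s) (d s) (vright v)) = v"
      if "v \<in> over (superspace ?p) ?J s" for v
      using that bij_betw_inv_into_right[OF b1] bij_betw_inv_into_right[OF b2] by (simp add: overJ)
  qed
  have cl: "continuous_on A vleft" and cr: "continuous_on B vright"
    for A B :: "(grassmann ^ ('b + 'd)) set"
    by (intro bounded_linear.continuous_on[OF bounded_linear_vleft] bounded_linear.continuous_on[OF bounded_linear_vright] continuous_on_id)+
  have Jo: "sopen ?p 0 ?J"
  proof -
    have "sopen ?p 0 (space_pts ?p 0 \<inter> vleft -` (c 0 ` U))"
      by (rule continuous_openin_preimage[OF cl _ chart_image_open[OF X]]) (auto simp: space_pts_case_sum)
    moreover have "sopen ?p 0 (space_pts ?p 0 \<inter> vright -` (d 0 ` W))"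
      by (rule continuous_openin_preimage[OF cr _ chart_image_open[OF Y]]) (auto simp: space_pts_case_sum)
    ultimately have "sopen ?p 0 ((space_pts ?p 0 \<inter> vleft -` (c 0 ` U)) \<inter> (space_pts ?p 0 \<inter> vright -` (d 0 ` W)))"
      by (rule openin_Int)
    moreover have "(space_pts ?p 0 \<inter> vleft -` (c 0 ` U)) \<inter> (space_pts ?p 0 \<inter> vright -` (d 0 ` W)) = ?J" by auto
    ultimately show ?thesis by simp
  qed
  have sub: "subtopology (top_of_set (space_pts (par X) 0)) (c 0 ` U) = top_of_set (c 0 ` U)"
    "subtopology (top_of_set (space_pts (par Y) 0)) (d 0 ` W) = top_of_set (d 0 ` W)"
    "subtopology (top_of_set (space_pts ?p 0)) ?J = top_of_set ?J"
    using cU dW by (simp_all add: subtopology_subtopology Int_absorb1 Collect_conj_eq)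
  obtain c' where c': "homeomorphic_maps (subtopology (base X) U) (top_of_set (c 0 ` U)) (c 0) c'"
    using chart_homeo[OF X] unfolding sub homeomorphic_map_maps by blast
  obtain d' where d': "homeomorphic_maps (subtopology (base Y) W) (top_of_set (d 0 ` W)) (d 0) d'"
    using chart_homeo[OF Y] unfolding sub homeomorphic_map_maps by blast
  have "homeomorphic_maps (prod_topology (subtopology (base X) U) (subtopology (base Y) W))
      (prod_topology (top_of_set (c 0 ` U)) (top_of_set (d 0 ` W))) (\<lambda>(x, y). (c 0 x, d 0 y)) (\<lambda>(x, y). (c' x, d' y))"
    unfolding homeomorphic_maps_prod using c' d' by blast
  then have h1: "homeomorphic_map (subtopology (prod_topology (base X) (base Y)) (U \<times> W))
      (top_of_set (c 0 ` U \<times> d 0 ` W)) (\<lambda>(x, y). (c 0 x, d 0 y))"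
    unfolding subtopology_Times[symmetric] prod_topology_euclidean by (rule homeomorphic_maps_imp_map)
  have h2: "homeomorphic_map (top_of_set (c 0 ` U \<times> d 0 ` W)) (top_of_set ?J) (\<lambda>(u, w). vjoin u w)"
  proof (rule homeomorphic_maps_imp_map)
    show "homeomorphic_maps (top_of_set (c 0 ` U \<times> d 0 ` W)) (top_of_set ?J) (\<lambda>(u, w). vjoin u w) (\<lambda>v. (vleft v, vright v))"
      unfolding homeomorphic_maps_def
    proof (intro conjI ballI)
      have "continuous_on A (\<lambda>z :: (grassmann ^ 'b) \<times> (grassmann ^ 'd). vjoin (fst z) (snd z))" for A
        unfolding vjoin_def
      proof (rule continuous_on_vec_lambda)
        fix k :: "'b + 'd"
        show "continuous_on A (\<lambda>z. case_sum (\<lambda>i. fst z $ i) (\<lambda>j. snd z $ j) k)"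
          by (cases k) (auto intro!: continuous_on_component continuous_on_fst continuous_on_snd continuous_on_id)
      qed
      then show "continuous_map (top_of_set (c 0 ` U \<times> d 0 ` W)) (top_of_set ?J) (\<lambda>(u, w). vjoin u w)"
        using cU dW by (auto simp: case_prod_unfold space_pts_case_sum)
      show "continuous_map (top_of_set ?J) (top_of_set (c 0 ` U \<times> d 0 ` W)) (\<lambda>v. (vleft v, vright v))"
        using cl cr by (auto intro!: continuous_on_Pair)
    qed auto
  qed
  have e0: "(\<lambda>(u, w). vjoin u w) \<circ> (\<lambda>(x, y). (c 0 x, d 0 y)) = ?e 0" by auto
  have homeo: "homeomorphic_map (subtopology (prod_topology (base X) (base Y)) (U \<times> W)) (top_of_set ?J) (?e 0)"
    using homeomorphic_map_compose[OF h1 h2] unfolding e0 .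
  have nat: "natural_on (over (sprod X Y) (U \<times> W)) (sprod X Y) (superspace ?p) ?e"
    unfolding natural_on_def using chart_natural[OF X] chart_natural[OF Y]
    by (auto simp: over_sprod vec_sum_eq_iff)
  show ?thesis
    unfolding is_chart_def sprod_simps im using chart_openin[OF X] chart_openin[OF Y] Jo bij nat homeo
    by (simp add: openin_prod_Times_iff sub)
qed

lemma satlas_sprod:
  assumes X: "satlas X" and Y: "satlas Y"
  shows "satlas (sprod X Y)"
proof -
  have "is_chart (sprod X Y) Z e" if "(Z, e) \<in> charts (sprod X Y)" for Z e
    using that satlasD(3)[OF X] satlasD(3)[OF Y] is_chart_sprod[OF X _ Y] unfolding charts_sprod by blast
  then show ?thesis
    unfolding satlas_def using spoint_functor_sprod[OF satlasD(1)[OF X] satlasD(1)[OF Y]]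
      satlasD(2)[OF X] satlasD(2)[OF Y] by auto
qed

lemma sprod_cover:
  assumes "(\<Union>(U, c)\<in>charts X. U) = pts X 0" "(\<Union>(U, c)\<in>charts Y. U) = pts Y 0"
  shows "(\<Union>(U, c)\<in>charts (sprod X Y). U) = pts (sprod X Y) 0"
proof -
  have "(\<Union>(U, c)\<in>charts (sprod X Y). U) = (\<Union>(U, c)\<in>charts X. U) \<times> (\<Union>(U, c)\<in>charts Y. U)"
  proof (intro equalityI subsetI)
    fix z assume "z \<in> (\<Union>(U, c)\<in>charts (sprod X Y). U)"
    then obtain Z e where Z: "(Z, e) \<in> charts (sprod X Y)" "z \<in> Z" by blast
    then obtain U c W d where "Z = U \<times> W" "(U, c) \<in> charts X" "(W, d) \<in> charts Y"
      unfolding charts_sprod by blast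
    then show "z \<in> (\<Union>(U, c)\<in>charts X. U) \<times> (\<Union>(U, c)\<in>charts Y. U)" using Z(2) by blast
  next
    fix z assume "z \<in> (\<Union>(U, c)\<in>charts X. U) \<times> (\<Union>(U, c)\<in>charts Y. U)"
    then obtain U c W d where u: "(U, c) \<in> charts X" "(W, d) \<in> charts Y" "z \<in> U \<times> W" by auto
    then have "(U \<times> W, \<lambda>s (x, y). vjoin (c s x) (d s y)) \<in> charts (sprod X Y)"
      unfolding charts_sprod by blast
    then show "z \<in> (\<Union>(U, c)\<in>charts (sprod X Y). U)" using u(3) by blast
  qed
  then show ?thesis using assms by simp
qed

text \<open>Tailored to the two projections of a product: in matching charts \<open>h\<close> is the
  linear map \<open>T\<close>, which is its own derivative, so the chain rule is immediate.\<close>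

lemma sfun_pullback:
  assumes Z: "satlas Z" and X: "satlas X" and f: "sfun X b f"
    and h: "\<And>s z. z \<in> pts Z s \<Longrightarrow> h z \<in> pts X s"
      "\<And>s t \<phi> z. \<phi> \<in> ghom s t \<Longrightarrow> z \<in> pts Z s \<Longrightarrow> h (act Z s t \<phi> z) = act X s t \<phi> (h z)"
    and T: "\<And>s v. sderiv (par Z) s T v T"
    and rep: "\<And>W e. (W, e) \<in> charts Z \<Longrightarrow> \<exists>U c. (U, c) \<in> charts X \<and>
      (\<forall>s. \<forall>z\<in>over Z W s. h z \<in> over X U s \<and> T (e s z) = c s (h z))"
  shows "sfun Z b (\<lambda>s z. f s (h z))"
proof (rule sfunI)
  show "f s (h z) \<in> gpart b s" if "z \<in> pts Z s" for s z by (rule sfunD(1)[OF f h(1)[OF that]])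
  show "f t (h (act Z s t \<phi> z)) = \<phi> (f s (h z))" if "\<phi> \<in> ghom s t" "z \<in> pts Z s" for s t \<phi> z
    unfolding h(2)[OF that] by (rule sfunD(2)[OF f that(1) h(1)[OF that(2)]])
  fix W e s z assume W: "(W, e) \<in> charts Z" "z \<in> over Z W s"
  obtain U c where U: "(U, c) \<in> charts X"
    and r: "\<forall>s. \<forall>z\<in>over Z W s. h z \<in> over X U s \<and> T (e s z) = c s (h z)" using rep[OF W(1)] by blast
  note c = satlasD(3)[OF X U] and e = satlasD(3)[OF Z W(1)]
  let ?A = "e s ` over Z W s" and ?g = "\<lambda>v. f s (inv_into (over X U s) (c s) v)"
  have A: "sopen (par Z) s ?A" by (rule chart_image_sopen[OF Z e chart_openin[OF Z e] order_refl])
  have zA: "e s z \<in> ?A" using W(2) by blast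
  have "sdiff1 (par Z) s (\<lambda>v. ?g (T v)) (e s z)"
  proof (rule sdiff1_chain[OF T A zA])
    show "T v \<in> space_pts (par X) s" if "v \<in> ?A" for v
      using that r chart_space_pts[OF X c] by auto
    show "sdiff1 (par X) s ?g (T (e s z))" using r W(2) sfunD(3)[OF f U] by simp
  qed
  moreover have "f s (h (inv_into (over Z W s) (e s) v)) = ?g (T v)" if "v \<in> ?A" for v
    using that r chart_inv[OF Z e] chart_inv[OF X c] by auto
  ultimately show "sdiff1 (par Z) s (\<lambda>v. f s (h (inv_into (over Z W s) (e s) v))) (e s z)"
    using sdiff1_cong[where f = "\<lambda>v. f s (h (inv_into (over Z W s) (e s) v))"
        and g = "\<lambda>v. ?g (T v)", OF A zA] by blast
qed

lemma sfun_fst: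
  assumes X: "satlas X" and Y: "satlas Y" and f: "sfun X b f"
  shows "sfun (sprod X Y) b (\<lambda>s z. f s (fst z))"
proof (rule sfun_pullback[OF satlas_sprod[OF X Y] X f _ _ sderiv_vleft])
  fix Z e assume "(Z, e) \<in> charts (sprod X Y)"
  then obtain U c W d where u: "Z = U \<times> W" "e = (\<lambda>s (x, y). vjoin (c s x) (d s y))" "(U, c) \<in> charts X"
    unfolding charts_sprod by blast
  show "\<exists>U c. (U, c) \<in> charts X \<and> (\<forall>s. \<forall>z\<in>over (sprod X Y) Z s. fst z \<in> over X U s \<and> vleft (e s z) = c s (fst z))"
    by (rule exI[of _ U], rule exI[of _ c]) (auto simp: u over_sprod)
qed auto

lemma sfun_snd:
  assumes X: "satlas X" and Y: "satlas Y" and f: "sfun Y b f"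
  shows "sfun (sprod X Y) b (\<lambda>s z. f s (snd z))"
proof (rule sfun_pullback[OF satlas_sprod[OF X Y] Y f _ _ sderiv_vright])
  fix Z e assume "(Z, e) \<in> charts (sprod X Y)"
  then obtain U c W d where u: "Z = U \<times> W" "e = (\<lambda>s (x, y). vjoin (c s x) (d s y))" "(W, d) \<in> charts Y"
    unfolding charts_sprod by blast
  show "\<exists>U c. (U, c) \<in> charts Y \<and> (\<forall>s. \<forall>z\<in>over (sprod X Y) Z s. snd z \<in> over Y U s \<and> vright (e s z) = c s (snd z))"
    by (rule exI[of _ W], rule exI[of _ d]) (auto simp: u over_sprod)
qed auto

section \<open>The matrix groups\<close>

definition scpar :: "3 \<times> 3 \<Rightarrow> bool" where
  "scpar = (\<lambda>(i, j). (i = 3) \<noteq> (j = 3))"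

text \<open>The even supermatrices of format 2|1. All entries are homogeneous, so any two of them
  can be exchanged with a known sign.\<close>

definition smat :: "nat \<Rightarrow> grassmann ^ 3 ^ 3 \<Rightarrow> bool" where
  "smat s M \<longleftrightarrow> (\<forall>i j. M $ i $ j \<in> gpart (scpar (i, j)) s)"

text \<open>The adjoint for the orthosymplectic form, so \<open>M ** scinv M = mat 1\<close> is another way to write the
  defining equations. It is an anti-automorphism, which gives closure under products.\<close>

definition scinv :: "grassmann ^ 3 ^ 3 \<Rightarrow> grassmann ^ 3 ^ 3" where
  "scinv M = vector [vector [M $ 2 $ 2, - M $ 1 $ 2, M $ 3 $ 2],
     vector [- M $ 2 $ 1, M $ 1 $ 1, - M $ 3 $ 1], vector [- M $ 2 $ 3, M $ 1 $ 3, M $ 3 $ 3]]"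

lemma smatD: "smat s M \<Longrightarrow> M $ i $ j \<in> gpart (scpar (i, j)) s"
  by (simp add: smat_def)

lemma smat_entries:
  assumes "smat s M"
  shows "M $ 1 $ 1 \<in> geven s" "M $ 1 $ 2 \<in> geven s" "M $ 2 $ 1 \<in> geven s" "M $ 2 $ 2 \<in> geven s"
    "M $ 3 $ 3 \<in> geven s" "M $ 1 $ 3 \<in> godd s" "M $ 2 $ 3 \<in> godd s" "M $ 3 $ 1 \<in> godd s" "M $ 3 $ 2 \<in> godd s"
  using smatD[OF assms, of 1 1] smatD[OF assms, of 1 2] smatD[OF assms, of 2 1] smatD[OF assms, of 2 2]
    smatD[OF assms, of 3 3] smatD[OF assms, of 1 3] smatD[OF assms, of 2 3] smatD[OF assms, of 3 1]
    smatD[OF assms, of 3 2]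
  by (simp_all add: scpar_def)

lemma smat_mult: 
  assumes "smat s M" "smat s N" shows "smat s (M ** N)"
proof -
  have "M $ i $ k * N $ k $ j \<in> gpart (scpar (i, j)) s" for i j k
  proof -
    have "(scpar (i, k) \<noteq> scpar (k, j)) = scpar (i, j)" by (auto simp: scpar_def)
    then show ?thesis using gpart_mult[OF smatD[OF assms(1), of i k] smatD[OF assms(2), of k j]] by simp
  qed
  then show ?thesis by (simp add: smat_def matrix_matrix_mult_def gpart_sum)
qed

lemma smat_scinv: "smat s M \<Longrightarrow> smat s (scinv M)"
  using smat_entries[of s M] unfolding smat_def[of s "scinv M"]
  by (simp add: forall_3 scinv_def scpar_def gpart_minus)

lemma scinv_scinv [simp]: "scinv (scinv M) = M"
  by (simp add: scinv_def vec_eq_iff forall_3)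

lemma scinv_nth33 [simp]: "scinv M $ 3 $ 3 = M $ 3 $ 3"
  by (simp add: scinv_def)

lemma scinv_one [simp]: "scinv (mat 1) = mat 1"
  by (simp add: scinv_def vec_eq_iff forall_3 mat_def)

text \<open>\<open>swap\<close> exchanges the factors of every product of entries; the signs caused
  by pairs of odd factors agree with those built into \<open>scinv\<close>.\<close>

lemma scinv_mult:
  assumes "smat s M" "smat s N"
  shows "scinv (M ** N) = scinv N ** scinv M"
proof -
  have swap: "M $ i $ j * N $ k $ l =
      (if scpar (i, j) \<and> scpar (k, l) then - (N $ k $ l * M $ i $ j) else N $ k $ l * M $ i $ j)" for i j k l
    by (rule gpart_commute[OF smatD[OF assms(1)] smatD[OF assms(2)]])
  show ?thesis
    by (simp add: scinv_def matrix_matrix_mult_def sum_3 vec_eq_iff forall_3 swap scpar_def)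
qed

text \<open>The nine entries of \<open>M ** scinv M\<close> amount to the four defining equations:
  the (1,2) and (2,1) entries vanish by commutativity and \<gamma>^2 = \<delta>^2 = 0, both (1,1)
  and (2,2) give the determinant equation, and the remaining off-diagonal ones repeat each other up
  to sign.\<close>

lemma SC_pts_iff:
  "M \<in> SC_pts s \<longleftrightarrow> smat s M \<and> M ** scinv M = mat 1 \<and> scinv M ** M = mat 1 \<and> gbody (M $ 3 $ 3) = 1"
proof -
  have eqs: "M ** scinv M = mat 1 \<longleftrightarrow>
      M$1$1 * M$2$2 - M$2$1 * M$1$2 - M$1$3 * M$2$3 = 1 \<and> (M$3$3)\<^sup>2 + 2 * M$3$1 * M$3$2 = 1 \<and>
      M$1$2 * M$3$1 - M$1$1 * M$3$2 = M$3$3 * M$1$3 \<and> M$2$2 * M$3$1 - M$2$1 * M$3$2 = M$3$3 * M$2$3"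
    if M: "smat s M"
  proof -
    note e = smat_entries[OF M]
    have com: "M$1$2 * M$1$1 = M$1$1 * M$1$2" "M$1$2 * M$2$1 = M$2$1 * M$1$2" "M$2$2 * M$1$1 = M$1$1 * M$2$2"
      "M$2$2 * M$2$1 = M$2$1 * M$2$2"
      "M$1$3 * M$3$3 = M$3$3 * M$1$3" "M$2$3 * M$3$3 = M$3$3 * M$2$3" "M$3$1 * M$1$2 = M$1$2 * M$3$1"
      "M$3$1 * M$2$2 = M$2$2 * M$3$1" "M$3$2 * M$1$1 = M$1$1 * M$3$2" "M$3$2 * M$2$1 = M$2$1 * M$3$2"
      by (rule geven_commute[OF _ e(1)] geven_commute[OF e(2) e(3)] geven_commute[OF e(4) e(1)] 
        geven_commute[OF e(4) e(3)] geven_commute[OF e(5), symmetric] geven_commute[OF e(2), symmetric]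
        geven_commute[OF e(4), symmetric] geven_commute[OF e(1), symmetric] geven_commute[OF e(3), symmetric], fact e)+
    have anti: "M$3$2 * M$3$1 = - (M$3$1 * M$3$2)" "M$2$3 * M$1$3 = - (M$1$3 * M$2$3)"
      "M$1$3 * M$1$3 = 0" "M$2$3 * M$2$3 = 0"
      using godd_anticommute[OF e(9) e(8)] godd_anticommute[OF e(7) e(6)] godd_square[OF e(6)] godd_square[OF e(7)]
      by simp_all
    have "M ** scinv M = mat 1 \<longleftrightarrow>
      M$1$1 * M$2$2 - M$2$1 * M$1$2 - M$1$3 * M$2$3 = 1 \<and>
      M$1$1 * M$3$2 - M$1$2 * M$3$1 + M$3$3 * M$1$3 = 0 \<and>
      M$2$1 * M$3$2 - M$2$2 * M$3$1 + M$3$3 * M$2$3 = 0 \<and>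
      M$2$2 * M$3$1 - M$2$1 * M$3$2 - M$3$3 * M$2$3 = 0 \<and>
      M$1$1 * M$3$2 - M$1$2 * M$3$1 + M$3$3 * M$1$3 = 0 \<and>
      M$3$1 * M$3$2 + M$3$1 * M$3$2 + M$3$3 * M$3$3 = 1"
      by (auto simp add: scinv_def matrix_matrix_mult_def sum_3 vec_eq_iff forall_3 mat_def com anti algebra_simps)
    also have "\<dots> \<longleftrightarrow> M$1$1 * M$2$2 - M$2$1 * M$1$2 - M$1$3 * M$2$3 = 1 \<and> (M$3$3)\<^sup>2 + 2 * M$3$1 * M$3$2 = 1 \<and>
      M$1$2 * M$3$1 - M$1$1 * M$3$2 = M$3$3 * M$1$3 \<and> M$2$2 * M$3$1 - M$2$1 * M$3$2 = M$3$3 * M$2$3"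
      by (auto simp: power2_eq_square mult_2 algebra_simps add_eq_0_iff diff_eq_eq eq_neg_iff_add_eq_0)
    finally show ?thesis .
  qed
  have repr: "M = vector [vector [M$1$1, M$1$2, M$1$3], vector [M$2$1, M$2$2, M$2$3], vector [M$3$1, M$3$2, M$3$3]]"
    by (simp add: vec_eq_iff forall_3)
  have "M \<in> SC_pts s \<longleftrightarrow> invertible M \<and> smat s M \<and>
      M$1$1 * M$2$2 - M$2$1 * M$1$2 - M$1$3 * M$2$3 = 1 \<and> (M$3$3)\<^sup>2 + 2 * M$3$1 * M$3$2 = 1 \<and>
      M$1$2 * M$3$1 - M$1$1 * M$3$2 = M$3$3 * M$1$3 \<and> M$2$2 * M$3$1 - M$2$1 * M$3$2 = M$3$3 * M$2$3 \<and>
      gbody (M$3$3) = 1" (is "_ \<longleftrightarrow> ?R")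
  proof
    assume "M \<in> SC_pts s"
    then show ?R by (auto simp: SC_pts_def smat_def forall_3 scpar_def)
  next
    assume R: ?R
    then have "smat s M" by blast
    note e = smat_entries[OF this]
    show "M \<in> SC_pts s"
      unfolding SC_pts_def mem_Collect_eq
      by (rule conjI, use R in blast, rule exI[of _ "M$1$1"], rule exI[of _ "M$2$1"], rule exI[of _ "M$1$2"],
        rule exI[of _ "M$2$2"], rule exI[of _ "M$3$3"], rule exI[of _ "M$3$1"], rule exI[of _ "M$3$2"],
        rule exI[of _ "M$1$3"], rule exI[of _ "M$2$3"], rule conjI, rule repr, use R e in simp)
  qed
  \<comment> \<open>Invertibility turns the right inverse into a two-sided one: a left inverse
    \<open>N\<close> must equal \<open>scinv M\<close>.\<close>
  moreover have "invertible M \<and> M ** scinv M = mat 1 \<longleftrightarrow> M ** scinv M = mat 1 \<and> scinv M ** M = mat 1"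
  proof (intro iffI conjI; elim conjE)
    assume "invertible M" "M ** scinv M = mat 1"
    then obtain N where N: "N ** M = mat 1" unfolding invertible_def by blast
    have "scinv M = N ** M ** scinv M" using N by simp
    also have "\<dots> = N" by (simp add: \<open>M ** scinv M = mat 1\<close> flip: matrix_mul_assoc)
    finally show "scinv M ** M = mat 1" using N by simp
  qed (auto simp: invertible_def)
  ultimately show ?thesis using eqs by blast
qed

lemma SC_pts_smat: "M \<in> SC_pts s \<Longrightarrow> smat s M"
  by (simp add: SC_pts_iff)

lemma SC_pts_one: "mat 1 \<in> SC_pts s"
  unfolding SC_pts_iff scinv_one matrix_mul_lid by (auto simp: smat_def scpar_def mat_def)

lemma SC_pts_scinv: "M \<in> SC_pts s \<Longrightarrow> scinv M \<in> SC_pts s"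
  unfolding SC_pts_iff scinv_scinv scinv_nth33 using smat_scinv by blast

lemma SC_pts_mult:
  assumes M: "M \<in> SC_pts s" and N: "N \<in> SC_pts s"
  shows "M ** N \<in> SC_pts s"
proof -
  note m = M[unfolded SC_pts_iff] and n = N[unfolded SC_pts_iff]
  have "M ** N ** (scinv N ** scinv M) = M ** (N ** scinv N) ** scinv M"
    "scinv N ** scinv M ** (M ** N) = scinv N ** (scinv M ** M) ** N"
    by (simp_all only: matrix_mul_assoc)
  then have "M ** N ** scinv (M ** N) = mat 1" "scinv (M ** N) ** (M ** N) = mat 1"
    using m n scinv_mult[of s M N] by simp_all
  \<comment> \<open>The products of odd entries have zero body, so the body of the corner entry is
    multiplicative.\<close>
  moreover have "gbody ((M ** N) $ 3 $ 3) = 1"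
    using m n gbody_odd[OF smat_entries(8)[of s M]] gbody_odd[OF smat_entries(9)[of s M]]
    by (simp add: matrix_matrix_mult_def sum_3)
  moreover have "smat s (M ** N)" using m n smat_mult by blast
  ultimately show ?thesis unfolding SC_pts_iff by blast
qed

lemma scinv_cancel: "M \<in> SC_pts s \<Longrightarrow> scinv M ** M = mat 1"
  unfolding SC_pts_iff by blast

lemma mat_grp_simps [simp]:
  "carrier (mat_grp P s) = P s" "x \<otimes>\<^bsub>mat_grp P s\<^esub> y = x ** y" "\<one>\<^bsub>mat_grp P s\<^esub> = mat 1"
  by (simp_all add: mat_grp_def)

lemma group_SC: "group (SC_grp s)"
proof (rule groupI)
  show "\<exists>N\<in>carrier (SC_grp s). N \<otimes>\<^bsub>SC_grp s\<^esub> M = \<one>\<^bsub>SC_grp s\<^esub>" if "M \<in> carrier (SC_grp s)" for M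
    using that SC_pts_scinv scinv_cancel by (intro bexI[of _ "scinv M"]) simp_all
qed (simp_all add: SC_pts_one SC_pts_mult matrix_mul_assoc)

lemma inv_SC:
  assumes "M \<in> SC_pts s" shows "inv\<^bsub>SC_grp s\<^esub> M = scinv M"
  by (rule group.inv_equality[OF group_SC])
    (simp_all add: assms SC_pts_scinv[OF assms] scinv_cancel[OF assms])

section \<open>Points of the special linear group and their block embedding\<close>

definition sl2inv :: "grassmann ^ 2 ^ 2 \<Rightarrow> grassmann ^ 2 ^ 2" where
  "sl2inv A = vector [vector [A $ 2 $ 2, - A $ 1 $ 2], vector [- A $ 2 $ 1, A $ 1 $ 1]]"

lemma SL2_pts_iff:
  "A \<in> SL2_pts s \<longleftrightarrow> (\<forall>i j. A $ i $ j \<in> geven s) \<and> A $ 1 $ 1 * A $ 2 $ 2 - A $ 2 $ 1 * A $ 1 $ 2 = 1"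
proof
  assume "A \<in> SL2_pts s"
  then show "(\<forall>i j. A $ i $ j \<in> geven s) \<and> A $ 1 $ 1 * A $ 2 $ 2 - A $ 2 $ 1 * A $ 1 $ 2 = 1"
    by (auto simp: SL2_pts_def forall_2)
next
  assume a: "(\<forall>i j. A $ i $ j \<in> geven s) \<and> A $ 1 $ 1 * A $ 2 $ 2 - A $ 2 $ 1 * A $ 1 $ 2 = 1"
  have repr: "A = vector [vector [A$1$1, A$1$2], vector [A$2$1, A$2$2]]"
    by (simp add: vec_eq_iff forall_2)
  show "A \<in> SL2_pts s"
    unfolding SL2_pts_def mem_Collect_eq
    by (rule exI[of _ "A$1$1"], rule exI[of _ "A$2$1"], rule exI[of _ "A$1$2"], rule exI[of _ "A$2$2"],
      rule conjI, rule repr, use a in simp)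
qed

lemma SL2_pts_even: "A \<in> SL2_pts s \<Longrightarrow> A $ i $ j \<in> geven s"
  by (simp add: SL2_pts_iff)

lemma sl2inv_pts: 
  assumes "A \<in> SL2_pts s" shows "sl2inv A \<in> SL2_pts s"
proof -
  note e = SL2_pts_even[OF assms]
  have "A$2$2 * A$1$1 = A$1$1 * A$2$2" "A$1$2 * A$2$1 = A$2$1 * A$1$2"
    by (rule geven_commute[OF e e])+
  then show ?thesis using assms by (auto simp: SL2_pts_iff sl2inv_def forall_2)
qed

lemma sl2inv_mult:
  assumes "A \<in> SL2_pts s" shows "A ** sl2inv A = mat 1" "sl2inv A ** A = mat 1"
proof -
  note e = SL2_pts_even[OF assms]
  have "A$2$2 * A$1$1 = A$1$1 * A$2$2" "A$1$2 * A$2$1 = A$2$1 * A$1$2" "A$1$2 * A$1$1 = A$1$1 * A$1$2"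
    "A$2$2 * A$2$1 = A$2$1 * A$2$2" "A$2$1 * A$1$1 = A$1$1 * A$2$1" "A$2$2 * A$1$2 = A$1$2 * A$2$2"
    by (rule geven_commute[OF e e])+
  then show "A ** sl2inv A = mat 1" "sl2inv A ** A = mat 1"
    using assms by (auto simp: SL2_pts_iff sl2inv_def matrix_matrix_mult_def sum_2 vec_eq_iff forall_2 mat_def)
qed

lemma SL2_emb_mult: "SL2_emb s (A ** B) = SL2_emb s A ** SL2_emb s B"
  by (simp add: SL2_emb_def matrix_matrix_mult_def sum_2 sum_3 vec_eq_iff forall_3)

text \<open>On block matrices \<open>scinv\<close> is the embedded adjugate, so both groups impose
  the same equation. The direction from \<open>SC_pts\<close> back to \<open>SL2_pts\<close> gives
  closure of \<open>SL2_pts\<close> under products and identifies the elements that relate two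
  points of a coset.\<close>

lemma SL2_emb_pts_iff: "SL2_emb s A \<in> SC_pts s \<longleftrightarrow> A \<in> SL2_pts s"
proof
  assume "SL2_emb s A \<in> SC_pts s"
  then have h: "smat s (SL2_emb s A)" "SL2_emb s A ** scinv (SL2_emb s A) = mat 1"
    unfolding SC_pts_iff by blast+
  then have "(SL2_emb s A ** scinv (SL2_emb s A)) $ 1 $ 1 = 1" by (simp add: mat_def)
  moreover from smat_entries[OF h(1)] have "A$1$2 * A$2$1 = A$2$1 * A$1$2"
    by (intro geven_commute) (auto simp: SL2_emb_def)
  ultimately show "A \<in> SL2_pts s"
    using smat_entries[OF h(1)]
    by (simp add: SL2_pts_iff forall_2 SL2_emb_def scinv_def matrix_matrix_mult_def sum_3)
next
  assume A: "A \<in> SL2_pts s"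
  have "scinv (SL2_emb s A) = SL2_emb s (sl2inv A)"
    by (simp add: scinv_def SL2_emb_def sl2inv_def vec_eq_iff forall_3)
  moreover have "SL2_emb s (mat 1) = mat 1" by (simp add: SL2_emb_def mat_def vec_eq_iff forall_3)
  ultimately have "SL2_emb s A ** scinv (SL2_emb s A) = mat 1" "scinv (SL2_emb s A) ** SL2_emb s A = mat 1"
    using sl2inv_mult[OF A] by (metis SL2_emb_mult)+
  moreover have "smat s (SL2_emb s A)"
    using SL2_pts_even[OF A] by (simp add: smat_def forall_3 SL2_emb_def scpar_def)
  moreover have "gbody (SL2_emb s A $ 3 $ 3) = 1" by (simp add: SL2_emb_def)
  ultimately show "SL2_emb s A \<in> SC_pts s" unfolding SC_pts_iff by blast
qed

lemma SL2_pts_mult: "A \<in> SL2_pts s \<Longrightarrow> B \<in> SL2_pts s \<Longrightarrow> A ** B \<in> SL2_pts s"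
  using SC_pts_mult[of "SL2_emb s A" s "SL2_emb s B"]
  unfolding SL2_emb_mult[symmetric] SL2_emb_pts_iff by blast

lemma SL2_pts_one: "mat 1 \<in> SL2_pts s"
  by (simp add: SL2_pts_iff mat_def)

lemma group_SL2: "group (SL2_grp s)"
proof (rule groupI)
  show "\<exists>N\<in>carrier (SL2_grp s). N \<otimes>\<^bsub>SL2_grp s\<^esub> M = \<one>\<^bsub>SL2_grp s\<^esub>" if "M \<in> carrier (SL2_grp s)" for M
    using that sl2inv_pts sl2inv_mult(2) by (intro bexI[of _ "sl2inv M"]) simp_all
qed (simp_all add: SL2_pts_one SL2_pts_mult matrix_mul_assoc)

lemma inv_SL2:
  assumes "M \<in> SL2_pts s" shows "inv\<^bsub>SL2_grp s\<^esub> M = sl2inv M"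
  by (rule group.inv_equality[OF group_SL2])
    (simp_all add: assms sl2inv_pts[OF assms] sl2inv_mult[OF assms])

section \<open>Normal form of superconformal matrices\<close>

definition scmat :: "grassmann \<Rightarrow> grassmann \<Rightarrow> grassmann \<Rightarrow> grassmann \<Rightarrow> grassmann \<Rightarrow> grassmann \<Rightarrow> grassmann ^ 3 ^ 3" where
  "scmat a b c d \<alpha> \<beta> = vector [vector [a, c, c * \<alpha> - a * \<beta>], vector [b, d, d * \<alpha> - b * \<beta>],
     vector [\<alpha>, \<beta>, 1 - \<alpha> * \<beta>]]"

text \<open>Both inverse identities are polynomial identities modulo the determinant relation and
  are decided by bringing every monomial to a normal form.\<close>

lemma scmat_SC_pts:
  assumes e: "a \<in> geven s" "b \<in> geven s" "c \<in> geven s" "d \<in> geven s" and od: "\<alpha> \<in> godd s" "\<beta> \<in> godd s"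
    and det: "a * d - b * c = 1 + \<alpha> * \<beta>"
  shows "scmat a b c d \<alpha> \<beta> \<in> SC_pts s"
proof -
  have comm: "x * y = y * x" "x * (y * z) = y * (x * z)" if "y \<in> geven s" "x \<in> gpart p s" for x y z p
    using geven_commute[OF that] by (simp, metis mult.assoc)
  have ad: "a * d = 1 + \<alpha> * \<beta> + b * c" "a * (d * z) = z + \<alpha> * (\<beta> * z) + b * (c * z)" for z
  proof -
    show *: "a * d = 1 + \<alpha> * \<beta> + b * c" using det by (simp add: algebra_simps)
    show "a * (d * z) = z + \<alpha> * (\<beta> * z) + b * (c * z)"
      using arg_cong[OF *, of "\<lambda>w. w * z"] by (simp add: algebra_simps)
  qed
  have oo: "\<beta> * \<alpha> = - (\<alpha> * \<beta>)" "\<beta> * (\<alpha> * z) = - (\<alpha> * (\<beta> * z))" "\<alpha> * \<alpha> = 0" "\<alpha> * (\<alpha> * z) = 0"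
    "\<beta> * \<beta> = 0" "\<beta> * (\<beta> * z) = 0" for z
    using godd_anticommute[OF od(2,1)] godd_square[OF od(1)] godd_square[OF od(2)]
    by (simp_all flip: mult.assoc)
  \<comment> \<open>The rules sort the factors in the order a, d, b, c, \<alpha>, \<beta>. Then a
    and d are adjacent and the determinant relation removes their product. Each rule also has a
    version with a trailing factor, because products are nested to the right.\<close>
  note rules = comm[OF e(1) e(4)] comm[OF e(1) e(2)] comm[OF e(1) e(3)] comm[OF e(4) e(2)] comm[OF e(4) e(3)]
    comm[OF e(2) e(3)] comm[OF e(1) od(1)] comm[OF e(2) od(1)] comm[OF e(3) od(1)] comm[OF e(4) od(1)]
    comm[OF e(1) od(2)] comm[OF e(2) od(2)] comm[OF e(3) od(2)] comm[OF e(4) od(2)] oo ad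
  have n: "\<alpha> * \<beta> \<in> geven s" using od by blast
  have "smat s (scmat a b c d \<alpha> \<beta>)"
  proof -
    have "c * \<alpha> - a * \<beta> \<in> godd s" "d * \<alpha> - b * \<beta> \<in> godd s" "1 - \<alpha> * \<beta> \<in> geven s"
      using n by (intro gpart_diff gpart_mult_even_odd(2) one_geven e od; assumption)+
    then show ?thesis using e od by (simp add: smat_def forall_3 scmat_def scpar_def)
  qed
  moreover have "scmat a b c d \<alpha> \<beta> ** scinv (scmat a b c d \<alpha> \<beta>) = mat 1"
    by (simp add: scmat_def scinv_def matrix_matrix_mult_def sum_3 vec_eq_iff forall_3 mat_def
        left_diff_distrib right_diff_distrib distrib_left distrib_right mult.assoc rules)
  moreover have "scinv (scmat a b c d \<alpha> \<beta>) ** scmat a b c d \<alpha> \<beta> = mat 1"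
    by (simp add: scmat_def scinv_def matrix_matrix_mult_def sum_3 vec_eq_iff forall_3 mat_def
        left_diff_distrib right_diff_distrib distrib_left distrib_right mult.assoc rules)
  moreover have "gbody (scmat a b c d \<alpha> \<beta> $ 3 $ 3) = 1"
    using od by (simp add: scmat_def gbody_odd)
  ultimately show ?thesis unfolding SC_pts_iff by blast
qed

text \<open>Together with \<open>scmat_SC_pts\<close> this parametrises the points by six entries
  under one relation, so later constructions need to check only that relation.\<close>

lemma SC_pts_scmat:
  assumes M: "M \<in> SC_pts s"
  shows "M = scmat (M$1$1) (M$2$1) (M$1$2) (M$2$2) (M$3$1) (M$3$2)"
    "M$1$1 * M$2$2 - M$2$1 * M$1$2 = 1 + M$3$1 * M$3$2"
proof -
  define a b c d e where "a = M$1$1" and "b = M$2$1" and "c = M$1$2" and "d = M$2$2" and "e = M$3$3"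
  define \<alpha> \<beta> \<gamma> \<delta> where "\<alpha> = M$3$1" and "\<beta> = M$3$2" and "\<gamma> = M$1$3" and "\<delta> = M$2$3"
  note defs = a_def b_def c_def d_def e_def \<alpha>_def \<beta>_def \<gamma>_def \<delta>_def
  have par: "a \<in> geven s" "c \<in> geven s" "b \<in> geven s" "d \<in> geven s" "e \<in> geven s"
    "\<gamma> \<in> godd s" "\<delta> \<in> godd s" "\<alpha> \<in> godd s" "\<beta> \<in> godd s"
    using smat_entries[OF SC_pts_smat[OF M]] by (simp_all add: defs)
  note M' = M[unfolded SC_pts_iff]
  have m1: "M ** scinv M = mat 1" "scinv M ** M = mat 1" using M' by auto
  have n: "\<alpha> * \<beta> \<in> geven s" using par by blast
  have anti: "\<beta> * \<alpha> = - (\<alpha> * \<beta>)" by (rule godd_anticommute[OF par(9,8)])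
  \<comment> \<open>The left inverse gives the determinant in terms of the third row directly; the
    right inverse would give it in terms of \<gamma> and \<delta>.\<close>
  have "(scinv M ** M) $ 1 $ 1 = 1" using m1(2) by (simp add: mat_def)
  then have "d * a - c * b + \<beta> * \<alpha> = 1"
    by (simp add: scinv_def matrix_matrix_mult_def sum_3 defs)
  then have det: "a * d - b * c = 1 + \<alpha> * \<beta>"
    using geven_commute[OF par(4,1)] geven_commute[OF par(2,3)] anti by (simp add: algebra_simps)
  then show "M$1$1 * M$2$2 - M$2$1 * M$1$2 = 1 + M$3$1 * M$3$2" by (simp add: defs)
  have "(M ** scinv M) $ 3 $ 3 = 1" using m1(1) by (simp add: mat_def)
  then have "\<alpha> * \<beta> - \<beta> * \<alpha> + e * e = 1"
    by (simp add: scinv_def matrix_matrix_mult_def sum_3 defs)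
  then have ee: "e * e = 1 - \<alpha> * \<beta> - \<alpha> * \<beta>" by (simp add: anti algebra_simps)
  have \<alpha>\<beta>0: "\<alpha> * (\<beta> * \<alpha>) = 0" "\<alpha> * (\<beta> * \<beta>) = 0" "\<alpha> * (\<beta> * (\<alpha> * \<beta>)) = 0"
  proof -
    show *: "\<alpha> * (\<beta> * \<alpha>) = 0" unfolding anti by (simp add: godd_square[OF par(8)] flip: mult.assoc)
    show "\<alpha> * (\<beta> * \<beta>) = 0" by (simp add: godd_square[OF par(9)])
    show "\<alpha> * (\<beta> * (\<alpha> * \<beta>)) = 0" using arg_cong[OF *, of "\<lambda>z. z * \<beta>"] by (simp add: mult.assoc)
  qed
  have e: "e = 1 - \<alpha> * \<beta>"
  proof -
    have ce: "\<alpha> * \<beta> * e = e * (\<alpha> * \<beta>)" by (rule geven_commute[OF n par(5)])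
    \<comment> \<open>A difference of squares, since (\<alpha>\<beta>)^2 = 0. The second factor has
      body 2 and is invertible, so the first one vanishes; this is where the condition on the body
      of e selects the root.\<close>
    have "(e - (1 - \<alpha> * \<beta>)) * (e + (1 - \<alpha> * \<beta>)) = 0"
      using ee ce by (simp add: algebra_simps \<alpha>\<beta>0)
    moreover have "gcoeff (e + (1 - \<alpha> * \<beta>)) {} \<noteq> 0"
    proof -
      have "gcoeff e {} = 1" using M' by (metis e_def gbody_simps(9) gcoeff_one)
      then show ?thesis using gcoeff_godd_empty[OF par(8)] by (simp add: gcoeff_times_empty gcoeff_one)
    qed
    moreover have "e + (1 - \<alpha> * \<beta>) \<in> geven s" using par n by (intro gpart_add gpart_diff) auto
    ultimately have "e - (1 - \<alpha> * \<beta>) = 0"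
      using ginv_right[of "e + (1 - \<alpha> * \<beta>)" s] by (metis mult.assoc mult_1_right mult_zero_left)
    then show ?thesis by simp
  qed
  have col: "w = x * \<alpha> - y * \<beta>" if "e * w = x * \<alpha> - y * \<beta>" "x \<in> geven s" "y \<in> geven s" for w x y
  proof -
    \<comment> \<open>1 + \<alpha>\<beta> is the inverse of e = 1 - \<alpha>\<beta>. On the
      right-hand side of the equation it acts as 1, because \<alpha>\<beta> annihilates multiples of
      \<alpha> and \<beta>.\<close>
    have "(1 + \<alpha> * \<beta>) * (e * w) = w"
      unfolding mult.assoc[symmetric] e by (simp add: algebra_simps \<alpha>\<beta>0 flip: mult.assoc) (simp add: mult.assoc \<alpha>\<beta>0)
    moreover have "\<alpha> * \<beta> * (x * \<alpha>) = 0" "\<alpha> * \<beta> * (y * \<beta>) = 0"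
      using geven_commute[OF that(2) n] geven_commute[OF that(3) n] \<alpha>\<beta>0 by (metis mult.assoc mult_zero_right)+
    ultimately show ?thesis using that(1) by (simp add: algebra_simps)
  qed
  have "(M ** scinv M) $ 1 $ 3 = 0" "(M ** scinv M) $ 2 $ 3 = 0" using m1(1) by (simp_all add: mat_def)
  then have "a * \<beta> - c * \<alpha> + \<gamma> * e = 0" "b * \<beta> - d * \<alpha> + \<delta> * e = 0"
    by (simp_all add: scinv_def matrix_matrix_mult_def sum_3 defs)
  then have "e * \<gamma> = c * \<alpha> - a * \<beta>" "e * \<delta> = d * \<alpha> - b * \<beta>"
    using geven_commute[OF par(5,6)] geven_commute[OF par(5,7)] by (simp_all add: algebra_simps)
  then have "\<gamma> = c * \<alpha> - a * \<beta>" "\<delta> = d * \<alpha> - b * \<beta>"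
    using col par by blast+
  then show "M = scmat (M$1$1) (M$2$1) (M$1$2) (M$2$2) (M$3$1) (M$3$2)"
    using e by (simp add: scmat_def vec_eq_iff forall_3 defs)
qed

lemma sfun_mult_parity:
  assumes "satlas X"
  shows "sfun X False f \<Longrightarrow> sfun X False g \<Longrightarrow> sfun X False (\<lambda>s x. f s x * g s x)"
    "sfun X False f \<Longrightarrow> sfun X True g \<Longrightarrow> sfun X True (\<lambda>s x. f s x * g s x)"
    "sfun X True f \<Longrightarrow> sfun X True g \<Longrightarrow> sfun X False (\<lambda>s x. f s x * g s x)"
  by (rule sfun_mult[OF assms]; simp)+

lemma sfun_sum:
  "(\<And>k. k \<in> A \<Longrightarrow> sfun X b (f k)) \<Longrightarrow> sfun X b (\<lambda>s x. \<Sum>k\<in>A. f k s x)"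
  by (induction A rule: infinite_finite_induct) (simp_all add: sfun_zero sfun_add)

lemma sfun_matrix_mult:
  fixes f g :: "nat \<Rightarrow> 'a \<Rightarrow> grassmann ^ 'n ^ 'n"
  assumes "satlas X" "\<And>i j. sfun X (p (i, j)) (\<lambda>s x. f s x $ i $ j)" "\<And>i j. sfun X (p (i, j)) (\<lambda>s x. g s x $ i $ j)"
    "\<And>i j k. p (i, j) = (p (i, k) \<noteq> p (k, j))"
  shows "sfun X (p (i, j)) (\<lambda>s x. (f s x ** g s x) $ i $ j)"
  unfolding matrix_matrix_mult_def
  by (simp only: vec_lambda_beta) (intro sfun_sum sfun_mult[OF assms(1-3)] assms(4))

subsection \<open>Coordinate domains where an even coordinate is invertible\<close>

text \<open>Invertibility of an even element depends only on its body, so the locus where an even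
  coordinate is invertible is given by an open set of the reduced space.\<close>

definition nzset :: "('i::finite \<Rightarrow> bool) \<Rightarrow> 'i \<Rightarrow> (grassmann ^ 'i) set" where
  "nzset q i = {v \<in> space_pts q 0. gcoeff (v $ i) {} \<noteq> 0}"

lemma sopen_nzset: "sopen q 0 (nzset q i)"
proof -
  have "open ((\<lambda>v. gcoeff (v $ i) {}) -` (- {0}) :: (grassmann ^ 'a) set)"
    by (intro open_vimage bounded_linear.continuous_on[OF bounded_linear_gcoeff] continuous_on_component
        continuous_on_id) auto
  moreover have "nzset q i = space_pts q 0 \<inter> (\<lambda>v. gcoeff (v $ i) {}) -` (- {0})"
    by (auto simp: nzset_def)
  ultimately show ?thesis by (simp add: openin_open_Int)
qed

lemma over_nzset: "v \<in> over (superspace q) (nzset q i) s \<longleftrightarrow> v \<in> space_pts q s \<and> gcoeff (v $ i) {} \<noteq> 0"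
  using sbody_space_pts[of v q s 0] by (auto simp: over_superspace nzset_def)

abbreviation "nzspace q i \<equiv> open_sub (superspace q) (nzset q i)"

lemma satlas_nzspace: "satlas (nzspace q i)"
  by (rule satlas_open_sub[OF satlas_superspace]) (simp add: sopen_nzset)

lemma sfun_nzspace_nth: 
  assumes "q j = b" shows "sfun (nzspace q i) b (\<lambda>s v. v $ j)"
proof -
  have "sfun (nzspace q i) (q j) (\<lambda>s v. v $ j)"
    by (rule sfun_open_sub[OF satlas_superspace superspace_cover _ sfun_nth]) (simp add: sopen_nzset)
  then show ?thesis using assms by simp
qed

lemma sfun_nzspace_ginv: "\<not> q i \<Longrightarrow> sfun (nzspace q i) False (\<lambda>s v. ginv (v $ i))"
  by (rule sfun_ginv[OF satlas_nzspace sfun_nzspace_nth]) (auto simp: over_nzset)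

subsection \<open>\<open>SL(2)\<close>\<close>

lemma SL2_coords: "M \<in> SL2_pts s \<Longrightarrow> mat_coords M \<in> space_pts (\<lambda>_. False) s"
  by (simp add: space_pts_def SL2_pts_even)

lemma SL2_act:
  assumes "\<phi> \<in> ghom s t" "M \<in> SL2_pts s" shows "mat_act s t \<phi> M \<in> SL2_pts t"
proof -
  note e = SL2_pts_even[OF assms(2)] and h = ghomD[OF assms(1)]
  have g: "M $ i $ j \<in> galg s" for i j using gpart_galg[OF e] .
  have "\<phi> (M$1$1 * M$2$2 - M$2$1 * M$1$2) = 1"
    using assms(2) h(4)[of 1] by (simp add: SL2_pts_iff)
  then show ?thesis
    using h(3)[OF g g] ghom_diff[OF assms(1) galg_mult[OF g g] galg_mult[OF g g]] h(5)[OF e]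
    by (simp add: SL2_pts_iff)
qed

lemmas SL2_ctx = SL2_coords SL2_act SL2_def

text \<open>Where a is invertible, the determinant equation is solved for d, which leaves a, b, c as
  coordinates.\<close>

lemma SL2_chart_a:
  defines "k \<equiv> \<lambda>i :: 3. if i = 1 then (1, 1) else if i = 2 then (2, 1) else (1, 2) :: 2 \<times> 2"
  shows "({M \<in> SL2_pts 0. entries k M \<in> nzset (\<lambda>_. False) 1},
    \<lambda>s. entries k) \<in> charts SL2"
proof (rule embedded_graph_chart[OF SL2_ctx, where
      \<Gamma> = "\<lambda>s v. vector [vector [v $ 1, v $ 3], vector [v $ 2, ginv (v $ 1) * (1 + v $ 2 * v $ 3)]]"])
  show "sopen (\<lambda>_. False) 0 (nzset (\<lambda>_. False) (1::3))" by (rule sopen_nzset)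
next
  fix s and v :: "grassmann ^ 3" assume "v \<in> over (superspace (\<lambda>_. False)) (nzset (\<lambda>_. False) 1) s"
  then have v: "v $ i \<in> geven s" "gcoeff (v $ 1) {} \<noteq> 0" for i
    using space_pts_nth[of v "\<lambda>_. False" s i] by (auto simp: over_nzset)
  note g = ginv_right[OF v] ginv_geven[OF v]
  have "v $ 1 * (ginv (v $ 1) * (1 + v $ 2 * v $ 3)) = 1 + v $ 2 * v $ 3"
    by (simp add: g flip: mult.assoc)
  moreover have "ginv (v $ 1) * (1 + v $ 2 * v $ 3) \<in> geven s"
    by (intro gpart_mult_even_odd(1) gpart_add g v one_geven)
  ultimately show "vector [vector [v $ 1, v $ 3], vector [v $ 2, ginv (v $ 1) * (1 + v $ 2 * v $ 3)]] \<in> SL2_pts s"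
    using v(1) by (simp add: SL2_pts_iff forall_2)
next
  fix s and M :: "grassmann ^ 2 ^ 2"
  assume M: "M \<in> SL2_pts s" "entries k M \<in> over (superspace (\<lambda>_. False)) (nzset (\<lambda>_. False) 1) s"
  note e = SL2_pts_even[OF M(1)]
  have a: "gcoeff (M$1$1) {} \<noteq> 0" using M(2) by (simp add: over_nzset k_def)
  have "1 + M$2$1 * M$1$2 = M$1$1 * M$2$2" using M(1) by (simp add: SL2_pts_iff algebra_simps)
  then have "ginv (M$1$1) * (1 + M$2$1 * M$1$2) = M$2$2"
    using ginv_left[OF e a] by (simp flip: mult.assoc)
  then show "vector [vector [entries k M $ 1, entries k M $ 3],
      vector [entries k M $ 2, ginv (entries k M $ 1) *
        (1 + entries k M $ 2 * entries k M $ 3)]] = M"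
    by (simp add: k_def vec_eq_iff forall_2)
next
  fix i j :: 2
  have "sfun (nzspace (\<lambda>_. False) 1) False (\<lambda>s v :: grassmann ^ 3. ginv (v $ 1) * (1 + v $ 2 * v $ 3))"
    by (intro sfun_mult_parity(1)[OF satlas_nzspace] sfun_add sfun_one sfun_nzspace_ginv sfun_nzspace_nth) simp_all
  moreover have "sfun (nzspace (\<lambda>_. False) 1) False (\<lambda>s v :: grassmann ^ 3. v $ l)" for l
    by (rule sfun_nzspace_nth) simp
  ultimately have "\<forall>i j. sfun (nzspace (\<lambda>_. False) 1) False (\<lambda>s v :: grassmann ^ 3.
      vector [vector [v $ 1, v $ 3], vector [v $ 2, ginv (v $ 1) * (1 + v $ 2 * v $ 3)] :: grassmann ^ 2] $ (i::2) $ j)"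
    by (simp add: forall_2)
  then show "sfun (nzspace (\<lambda>_. False) 1) False (\<lambda>s v :: grassmann ^ 3.
      (vector [vector [v $ 1, v $ 3], vector [v $ 2, ginv (v $ 1) * (1 + v $ 2 * v $ 3)]] :: grassmann ^ 2 ^ 2) $ i $ j)"
    by blast
qed (simp_all add: k_def vec_eq_iff forall_3)

text \<open>Where b is invertible, the determinant equation is solved for c, which leaves a, b, d as
  coordinates.\<close>

lemma SL2_chart_b:
  defines "k \<equiv> \<lambda>i :: 3. if i = 1 then (1, 1) else if i = 2 then (2, 1) else (2, 2) :: 2 \<times> 2"
  shows "({M \<in> SL2_pts 0. entries k M \<in> nzset (\<lambda>_. False) 2},
    \<lambda>s. entries k) \<in> charts SL2"
proof (rule embedded_graph_chart[OF SL2_ctx, where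
      \<Gamma> = "\<lambda>s v. vector [vector [v $ 1, ginv (v $ 2) * (v $ 1 * v $ 3 - 1)], vector [v $ 2, v $ 3]]"])
  show "sopen (\<lambda>_. False) 0 (nzset (\<lambda>_. False) (2::3))" by (rule sopen_nzset)
next
  fix s and v :: "grassmann ^ 3" assume "v \<in> over (superspace (\<lambda>_. False)) (nzset (\<lambda>_. False) 2) s"
  then have v: "v $ i \<in> geven s" "gcoeff (v $ 2) {} \<noteq> 0" for i
    using space_pts_nth[of v "\<lambda>_. False" s i] by (auto simp: over_nzset)
  note g = ginv_right[OF v] ginv_geven[OF v]
  have "v $ 2 * (ginv (v $ 2) * (v $ 1 * v $ 3 - 1)) = v $ 1 * v $ 3 - 1"
    by (simp add: g flip: mult.assoc)
  moreover have "ginv (v $ 2) * (v $ 1 * v $ 3 - 1) \<in> geven s"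
    by (intro gpart_mult_even_odd(1) gpart_diff g v one_geven)
  ultimately show "vector [vector [v $ 1, ginv (v $ 2) * (v $ 1 * v $ 3 - 1)], vector [v $ 2, v $ 3]] \<in> SL2_pts s"
    using v(1) by (simp add: SL2_pts_iff forall_2)
next
  fix s and M :: "grassmann ^ 2 ^ 2"
  assume M: "M \<in> SL2_pts s" "entries k M \<in> over (superspace (\<lambda>_. False)) (nzset (\<lambda>_. False) 2) s"
  note e = SL2_pts_even[OF M(1)]
  have b: "gcoeff (M$2$1) {} \<noteq> 0" using M(2) by (simp add: over_nzset k_def)
  have "M$1$1 * M$2$2 - 1 = M$2$1 * M$1$2" using M(1) by (simp add: SL2_pts_iff algebra_simps)
  then have "ginv (M$2$1) * (M$1$1 * M$2$2 - 1) = M$1$2"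
    using ginv_left[OF e b] by (simp flip: mult.assoc)
  then show "vector [vector [entries k M $ 1, ginv (entries k M $ 2) *
        (entries k M $ 1 * entries k M $ 3 - 1)],
      vector [entries k M $ 2, entries k M $ 3]] = M"
    by (simp add: k_def vec_eq_iff forall_2)
next
  fix i j :: 2
  have "sfun (nzspace (\<lambda>_. False) 2) False (\<lambda>s v :: grassmann ^ 3. ginv (v $ 2) * (v $ 1 * v $ 3 - 1))"
    by (intro sfun_mult_parity(1)[OF satlas_nzspace] sfun_diff sfun_one sfun_nzspace_ginv sfun_nzspace_nth) simp_all
  moreover have "sfun (nzspace (\<lambda>_. False) 2) False (\<lambda>s v :: grassmann ^ 3. v $ l)" for l
    by (rule sfun_nzspace_nth) simp
  ultimately have "\<forall>i j. sfun (nzspace (\<lambda>_. False) 2) False (\<lambda>s v :: grassmann ^ 3.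
      vector [vector [v $ 1, ginv (v $ 2) * (v $ 1 * v $ 3 - 1)], vector [v $ 2, v $ 3] :: grassmann ^ 2] $ (i::2) $ j)"
    by (simp add: forall_2)
  then show "sfun (nzspace (\<lambda>_. False) 2) False (\<lambda>s v :: grassmann ^ 3.
      (vector [vector [v $ 1, ginv (v $ 2) * (v $ 1 * v $ 3 - 1)], vector [v $ 2, v $ 3]] :: grassmann ^ 2 ^ 2) $ i $ j)"
    by blast
qed (simp_all add: k_def vec_eq_iff forall_3)

lemma SL2_cover: "(\<Union>(U, c)\<in>charts SL2. U) = SL2_pts 0"
proof (intro equalityI subsetI)
  fix M assume "M \<in> (\<Union>(U, c)\<in>charts SL2. U)"
  then obtain U c where "(U, c) \<in> charts SL2" "M \<in> U" by blast
  then show "M \<in> SL2_pts 0"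
    using chart_subset[OF satlas_embedded[OF SL2_ctx] satlasD(3)[OF satlas_embedded[OF SL2_ctx]]]
    by (auto simp: embedded_simps[OF SL2_ctx])
next
  fix M assume M: "M \<in> SL2_pts 0"
  \<comment> \<open>The first column (a, b) cannot have zero body, since every term of the
    determinant contains a or b.\<close>
  have "gcoeff (M$1$1 * M$2$2 - M$2$1 * M$1$2) {} = 1" using M by (simp add: SL2_pts_iff gcoeff_one)
  then have "gcoeff (M$1$1) {} \<noteq> 0 \<or> gcoeff (M$2$1) {} \<noteq> 0" by (auto simp: gcoeff_times_empty)
  then show "M \<in> (\<Union>(U, c)\<in>charts SL2. U)"
  proof
    assume "gcoeff (M$1$1) {} \<noteq> 0"
    then show ?thesis using M SL2_pts_even[OF M]
      by (intro UN_I[OF SL2_chart_a]) (simp add: nzset_def space_pts_def)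
  next
    assume "gcoeff (M$2$1) {} \<noteq> 0"
    then show ?thesis using M SL2_pts_even[OF M]
      by (intro UN_I[OF SL2_chart_b]) (simp add: nzset_def space_pts_def)
  qed
qed

lemma SL2_supermanifold: "supermanifold SL2"
  by (rule supermanifold_embedded[OF SL2_ctx SL2_cover])

subsection \<open>The superconformal group\<close>

lemma SC_coords: "M \<in> SC_pts s \<Longrightarrow> mat_coords M \<in> space_pts scpar s"
  using smatD[OF SC_pts_smat] by (simp add: space_pts_def)

text \<open>In normal form only the determinant relation has to be transported along the
  homomorphism; \<open>scmat_SC_pts\<close> then supplies the remaining equations.\<close>

lemma SC_act:
  assumes \<phi>: "\<phi> \<in> ghom s t" and M: "M \<in> SC_pts s" shows "mat_act s t \<phi> M \<in> SC_pts t"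
proof -
  define a b c d where "a = M$1$1" and "b = M$2$1" and "c = M$1$2" and "d = M$2$2"
  define \<alpha> \<beta> where "\<alpha> = M$3$1" and "\<beta> = M$3$2"
  have par: "a \<in> geven s" "c \<in> geven s" "b \<in> geven s" "d \<in> geven s" "\<alpha> \<in> godd s" "\<beta> \<in> godd s"
    using smat_entries[OF SC_pts_smat[OF M]] by (simp_all add: a_def b_def c_def d_def \<alpha>_def \<beta>_def)
  have eq: "M = scmat a b c d \<alpha> \<beta>" and det: "a * d - b * c = 1 + \<alpha> * \<beta>"
    unfolding a_def b_def c_def d_def \<alpha>_def \<beta>_def by (rule SC_pts_scmat[OF M])+
  have g: "a \<in> galg s" "b \<in> galg s" "c \<in> galg s" "d \<in> galg s" "\<alpha> \<in> galg s" "\<beta> \<in> galg s"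
    using par gpart_galg by blast+
  have one: "\<phi> 1 = 1" "1 \<in> galg s" "\<phi> 0 = 0"
    using ghomD(4)[OF \<phi>, of 1] ghomD(4)[OF \<phi>, of 0] gpart_galg[OF one_geven] by simp_all
  note hom = ghomD(2)[OF \<phi>] ghomD(3)[OF \<phi>] ghom_diff[OF \<phi>] galg_mult g one
  have "mat_act s t \<phi> M = scmat (\<phi> a) (\<phi> b) (\<phi> c) (\<phi> d) (\<phi> \<alpha>) (\<phi> \<beta>)"
    unfolding eq by (simp add: vec_eq_iff forall_3 scmat_def hom)
  moreover have "\<phi> a * \<phi> d - \<phi> b * \<phi> c = 1 + \<phi> \<alpha> * \<phi> \<beta>"
    using arg_cong[OF det, of \<phi>] by (simp add: hom)
  ultimately show ?thesis
    using scmat_SC_pts ghomD(5)[OF \<phi>] par by simp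
qed

lemmas SC_ctx = SC_coords SC_act SC_def[folded scpar_def]

abbreviation "q32 \<equiv> case_sum (\<lambda>_ :: 3. False) (\<lambda>_ :: 2. True)"

lemma sfun_scmat:
  assumes "satlas X" "sfun X False a" "sfun X False b" "sfun X False c" "sfun X False d"
    "sfun X True \<alpha>" "sfun X True \<beta>"
  shows "sfun X (scpar (i, j)) (\<lambda>s x. scmat (a s x) (b s x) (c s x) (d s x) (\<alpha> s x) (\<beta> s x) $ i $ j)"
proof -
  have "sfun X True (\<lambda>s x. c s x * \<alpha> s x - a s x * \<beta> s x)" "sfun X True (\<lambda>s x. d s x * \<alpha> s x - b s x * \<beta> s x)"
    "sfun X False (\<lambda>s x. 1 - \<alpha> s x * \<beta> s x)"
    by (intro sfun_diff sfun_one sfun_mult_parity[OF assms(1)] assms(2-))+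
  then have "\<forall>i j. sfun X (scpar (i, j)) (\<lambda>s x. scmat (a s x) (b s x) (c s x) (d s x) (\<alpha> s x) (\<beta> s x) $ i $ j)"
    using assms(2-) by (simp add: forall_3 scmat_def scpar_def)
  then show ?thesis by blast
qed

text \<open>Where a is invertible, ad - bc = 1 + \<alpha>\<beta> is solved for d; the other
  dependent entries are polynomials given by the normal form.\<close>

lemma SC_chart_a:
  defines "k \<equiv> case_sum (\<lambda>i :: 3. if i = 1 then (1, 1) else if i = 2 then (2, 1) else (1, 2))
      (\<lambda>j :: 2. if j = 1 then (3, 1) else (3, 2)) :: _ \<Rightarrow> 3 \<times> 3"
  shows "({M \<in> SC_pts 0. entries k M \<in> nzset q32 (Inl 1)},
    \<lambda>s. entries k) \<in> charts SC"
proof (rule embedded_graph_chart[OF SC_ctx, where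
      \<Gamma> = "\<lambda>s v. scmat (v $ Inl 1) (v $ Inl 2) (v $ Inl 3)
        (ginv (v $ Inl 1) * (1 + v $ Inr 1 * v $ Inr 2 + v $ Inl 2 * v $ Inl 3)) (v $ Inr 1) (v $ Inr 2)"])
  show "sopen q32 0 (nzset q32 (Inl 1))" by (rule sopen_nzset)
  show "scpar (k i) = q32 i" for i by (cases i) (simp_all add: k_def scpar_def)
next
  fix s v assume "v \<in> over (superspace q32) (nzset q32 (Inl 1)) s"
  then have v: "v $ Inl i \<in> geven s" "gcoeff (v $ Inl 1) {} \<noteq> 0" and od: "v $ Inr j \<in> godd s" for i j
    using space_pts_nth[of v q32 s "Inl i"] space_pts_nth[of v q32 s "Inr j"] by (auto simp: over_nzset)
  note g = ginv_right[OF v] ginv_geven[OF v]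
  let ?d = "ginv (v $ Inl 1) * (1 + v $ Inr 1 * v $ Inr 2 + v $ Inl 2 * v $ Inl 3)"
  have "v $ Inl 1 * ?d = 1 + v $ Inr 1 * v $ Inr 2 + v $ Inl 2 * v $ Inl 3"
    by (simp add: g flip: mult.assoc)
  moreover have "?d \<in> geven s"
    by (intro gpart_mult_even_odd(1) gpart_add g v one_geven gpart_mult_even_odd(4) od)
  ultimately show "scmat (v $ Inl 1) (v $ Inl 2) (v $ Inl 3) ?d (v $ Inr 1) (v $ Inr 2) \<in> SC_pts s"
    by (intro scmat_SC_pts v od) simp_all
next
  fix s M
  assume M: "M \<in> SC_pts s" "entries k M \<in> over (superspace q32) (nzset q32 (Inl 1)) s"
  note e = smat_entries[OF SC_pts_smat[OF M(1)]]
  have a: "gcoeff (M$1$1) {} \<noteq> 0" using M(2) by (simp add: over_nzset k_def)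
  have "1 + M$3$1 * M$3$2 + M$2$1 * M$1$2 = M$1$1 * M$2$2"
    using SC_pts_scmat(2)[OF M(1)] by (simp add: algebra_simps)
  then have "ginv (M$1$1) * (1 + M$3$1 * M$3$2 + M$2$1 * M$1$2) = M$2$2"
    using ginv_left[OF e(1) a] by (simp flip: mult.assoc)
  then show "scmat (entries k M $ Inl 1) (entries k M $ Inl 2)
      (entries k M $ Inl 3)
      (ginv (entries k M $ Inl 1) *
        (1 + entries k M $ Inr 1 * entries k M $ Inr 2 +
         entries k M $ Inl 2 * entries k M $ Inl 3))
      (entries k M $ Inr 1) (entries k M $ Inr 2) = M"
    using SC_pts_scmat(1)[OF M(1)] by (simp add: k_def)
next
  fix i j :: 3
  show "sfun (nzspace q32 (Inl 1)) (scpar (i, j)) (\<lambda>s v. scmat (v $ Inl 1) (v $ Inl 2) (v $ Inl 3)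
        (ginv (v $ Inl 1) * (1 + v $ Inr 1 * v $ Inr 2 + v $ Inl 2 * v $ Inl 3)) (v $ Inr 1) (v $ Inr 2) $ i $ j)"
    by (intro sfun_scmat satlas_nzspace sfun_mult_parity(1,3)[OF satlas_nzspace] sfun_add sfun_one
        sfun_nzspace_ginv sfun_nzspace_nth) simp_all
qed (simp_all add: k_def vec_sum_eq_iff forall_3 forall_2 scmat_def)

text \<open>Where b is invertible, ad - bc = 1 + \<alpha>\<beta> is solved for c instead.\<close>

lemma SC_chart_b:
  defines "k \<equiv> case_sum (\<lambda>i :: 3. if i = 1 then (1, 1) else if i = 2 then (2, 1) else (2, 2))
      (\<lambda>j :: 2. if j = 1 then (3, 1) else (3, 2)) :: _ \<Rightarrow> 3 \<times> 3"
  shows "({M \<in> SC_pts 0. entries k M \<in> nzset q32 (Inl 2)},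
    \<lambda>s. entries k) \<in> charts SC"
proof (rule embedded_graph_chart[OF SC_ctx, where
      \<Gamma> = "\<lambda>s v. scmat (v $ Inl 1) (v $ Inl 2)
        (ginv (v $ Inl 2) * (v $ Inl 1 * v $ Inl 3 - 1 - v $ Inr 1 * v $ Inr 2)) (v $ Inl 3) (v $ Inr 1) (v $ Inr 2)"])
  show "sopen q32 0 (nzset q32 (Inl 2))" by (rule sopen_nzset)
  show "scpar (k i) = q32 i" for i by (cases i) (simp_all add: k_def scpar_def)
next
  fix s v assume "v \<in> over (superspace q32) (nzset q32 (Inl 2)) s"
  then have v: "v $ Inl i \<in> geven s" "gcoeff (v $ Inl 2) {} \<noteq> 0" and od: "v $ Inr j \<in> godd s" for i j
    using space_pts_nth[of v q32 s "Inl i"] space_pts_nth[of v q32 s "Inr j"] by (auto simp: over_nzset)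
  note g = ginv_right[OF v] ginv_geven[OF v]
  let ?c = "ginv (v $ Inl 2) * (v $ Inl 1 * v $ Inl 3 - 1 - v $ Inr 1 * v $ Inr 2)"
  have "v $ Inl 2 * ?c = v $ Inl 1 * v $ Inl 3 - 1 - v $ Inr 1 * v $ Inr 2"
    by (simp add: g flip: mult.assoc)
  moreover have "?c \<in> geven s"
    by (intro gpart_mult_even_odd(1) gpart_diff g v one_geven gpart_mult_even_odd(4) od)
  ultimately show "scmat (v $ Inl 1) (v $ Inl 2) ?c (v $ Inl 3) (v $ Inr 1) (v $ Inr 2) \<in> SC_pts s"
    by (intro scmat_SC_pts v od) simp_all
next
  fix s M
  assume M: "M \<in> SC_pts s" "entries k M \<in> over (superspace q32) (nzset q32 (Inl 2)) s"
  note e = smat_entries[OF SC_pts_smat[OF M(1)]]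
  have a: "gcoeff (M$2$1) {} \<noteq> 0" using M(2) by (simp add: over_nzset k_def)
  have "M$1$1 * M$2$2 - 1 - M$3$1 * M$3$2 = M$2$1 * M$1$2"
    using SC_pts_scmat(2)[OF M(1)] by (simp add: algebra_simps)
  then have "ginv (M$2$1) * (M$1$1 * M$2$2 - 1 - M$3$1 * M$3$2) = M$1$2"
    using ginv_left[OF e(3) a] by (simp flip: mult.assoc)
  then show "scmat (entries k M $ Inl 1) (entries k M $ Inl 2)
      (ginv (entries k M $ Inl 2) *
        (entries k M $ Inl 1 * entries k M $ Inl 3 - 1 -
         entries k M $ Inr 1 * entries k M $ Inr 2))
      (entries k M $ Inl 3)
      (entries k M $ Inr 1) (entries k M $ Inr 2) = M"
    using SC_pts_scmat(1)[OF M(1)] by (simp add: k_def)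
next
  fix i j :: 3
  show "sfun (nzspace q32 (Inl 2)) (scpar (i, j)) (\<lambda>s v. scmat (v $ Inl 1) (v $ Inl 2)
        (ginv (v $ Inl 2) * (v $ Inl 1 * v $ Inl 3 - 1 - v $ Inr 1 * v $ Inr 2)) (v $ Inl 3) (v $ Inr 1) (v $ Inr 2) $ i $ j)"
    by (intro sfun_scmat satlas_nzspace sfun_mult_parity(1,3)[OF satlas_nzspace] sfun_diff sfun_one
        sfun_nzspace_ginv sfun_nzspace_nth) simp_all
qed (simp_all add: k_def vec_sum_eq_iff forall_3 forall_2 scmat_def)

lemma SC_cover: "(\<Union>(U, c)\<in>charts SC. U) = SC_pts 0"
proof (intro equalityI subsetI)
  fix M assume "M \<in> (\<Union>(U, c)\<in>charts SC. U)"
  then obtain U c where "(U, c) \<in> charts SC" "M \<in> U" by blast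
  then show "M \<in> SC_pts 0"
    using chart_subset[OF satlas_embedded[OF SC_ctx] satlasD(3)[OF satlas_embedded[OF SC_ctx]]]
    by (auto simp: embedded_simps[OF SC_ctx])
next
  fix M assume M: "M \<in> SC_pts 0"
  note e = smat_entries[OF SC_pts_smat[OF M]]
  \<comment> \<open>\<alpha>\<beta> has zero body, so the argument for \<open>SL2\<close> applies
    unchanged.\<close>
  have "gcoeff (M$1$1 * M$2$2 - M$2$1 * M$1$2) {} = 1"
    unfolding SC_pts_scmat(2)[OF M] using gcoeff_godd_empty[OF e(8)]
    by (simp add: gcoeff_one gcoeff_times_empty)
  then have "gcoeff (M$1$1) {} \<noteq> 0 \<or> gcoeff (M$2$1) {} \<noteq> 0" by (auto simp: gcoeff_times_empty)
  moreover have sp: "v \<in> space_pts q32 0" if "\<And>i. v $ Inl i \<in> geven 0" "\<And>j. v $ Inr j \<in> godd 0" for v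
    using that unfolding space_pts_case_sum by (simp add: space_pts_def)
  ultimately show "M \<in> (\<Union>(U, c)\<in>charts SC. U)"
  proof (elim disjE)
    assume "gcoeff (M$1$1) {} \<noteq> 0"
    then show ?thesis using M e
      by (intro UN_I[OF SC_chart_a]) (auto simp: nzset_def intro!: sp)
  next
    assume "gcoeff (M$2$1) {} \<noteq> 0"
    then show ?thesis using M e
      by (intro UN_I[OF SC_chart_b]) (auto simp: nzset_def intro!: sp)
  qed
qed

lemma SC_supermanifold: "supermanifold SC"
  by (rule supermanifold_embedded[OF SC_ctx SC_cover])

subsection \<open>Super Lie groups and the embedding\<close>

lemma SC_simps:
  "pts SC = SC_pts" "act SC = mat_act" "base SC = pullback_topology (SC_pts 0) mat_coords euclidean"
  "par SC = q32"
  by (simp_all add: embedded_simps[OF SC_ctx])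

lemma SL2_simps:
  "pts SL2 = SL2_pts" "act SL2 = mat_act" "base SL2 = pullback_topology (SL2_pts 0) mat_coords euclidean"
  "par SL2 = (\<lambda>_. False)"
  by (simp_all add: embedded_simps[OF SL2_ctx])

lemma satlas_SC: "satlas SC" and satlas_SL2: "satlas SL2"
  using SC_supermanifold SL2_supermanifold supermanifold_satlas by blast+

lemma sfun_SC_entry: "sfun SC (scpar (i, j)) (\<lambda>s M. M $ i $ j)"
  by (rule embedded_sfun_entry[OF SC_ctx])

lemma sfun_SL2_entry: "sfun SL2 False (\<lambda>s M. M $ i $ j)"
  by (rule embedded_sfun_entry[OF SL2_ctx])

lemma SC_covered: "(\<Union>(U, c)\<in>charts SC. U) = pts SC 0"
  using SC_cover by (simp add: SC_simps)

lemma SL2_covered: "(\<Union>(U, c)\<in>charts SL2. U) = pts SL2 0"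
  using SL2_cover by (simp add: SL2_simps)

text \<open>Products have entries polynomial in the entries of the factors, and \<open>scinv\<close>
  only permutes entries up to sign, so both operations are morphisms by the entry criterion.\<close>

lemma super_lie_group_SC: "super_lie_group SC SC_grp"
proof -
  note prod = satlas_sprod[OF satlas_SC satlas_SC]
  have "smor (sprod SC SC) SC (\<lambda>s (x, y). x \<otimes>\<^bsub>SC_grp s\<^esub> y)"
  proof (rule smor_into_embedded[OF SC_ctx prod sprod_cover[OF SC_covered SC_covered]])
    show "(case z of (x, y) \<Rightarrow> x \<otimes>\<^bsub>SC_grp s\<^esub> y) \<in> SC_pts s" if "z \<in> pts (sprod SC SC) s" for s z
      using that SC_pts_mult by (auto simp: SC_simps)
    fix i j
    have "scpar (i, j) = (scpar (i, k) \<noteq> scpar (k, j))" for i j k by (auto simp: scpar_def)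
    then have "sfun (sprod SC SC) (scpar (i, j)) (\<lambda>s z. (fst z ** snd z) $ i $ j)"
      by (intro sfun_matrix_mult[OF prod] sfun_fst[OF satlas_SC satlas_SC sfun_SC_entry]
          sfun_snd[OF satlas_SC satlas_SC sfun_SC_entry])
    then show "sfun (sprod SC SC) (scpar (i, j)) (\<lambda>s z. (case z of (x, y) \<Rightarrow> x \<otimes>\<^bsub>SC_grp s\<^esub> y) $ i $ j)"
      by (simp add: case_prod_unfold)
  qed
  moreover have "smor SC SC (\<lambda>s. m_inv (SC_grp s))"
  proof (rule smor_into_embedded[OF SC_ctx satlas_SC SC_covered])
    show "inv\<^bsub>SC_grp s\<^esub> M \<in> SC_pts s" if "M \<in> pts SC s" for s M
      using that SC_pts_scinv inv_SC by (simp add: SC_simps)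
    fix i j
    have e: "sfun SC b (\<lambda>s M. M $ k $ l)" if "b = scpar (k, l)" for b k l
      using sfun_SC_entry that by simp
    have "\<forall>i j. sfun SC (scpar (i, j)) (\<lambda>s M. scinv M $ i $ j)"
      by (simp add: forall_3 scinv_def scpar_def sfun_minus e)
    then have "sfun SC (scpar (i, j)) (\<lambda>s M. scinv M $ i $ j)" by blast
    \<comment> \<open>The group inverse is known to be \<open>scinv\<close> only on points of the
      group, which is all that \<open>sfun_cong\<close> asks for.\<close>
    then show "sfun SC (scpar (i, j)) (\<lambda>s M. (inv\<^bsub>SC_grp s\<^esub> M) $ i $ j)"
      by (rule sfun_cong[OF satlas_SC]) (simp add: inv_SC SC_simps)
  qed
  moreover have "\<forall>s. group (SC_grp s) \<and> carrier (SC_grp s) = pts SC s"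
    by (simp add: group_SC SC_simps)
  ultimately show ?thesis
    unfolding super_lie_group_def using SC_supermanifold by blast
qed

lemma super_lie_group_SL2: "super_lie_group SL2 SL2_grp"
proof -
  note prod = satlas_sprod[OF satlas_SL2 satlas_SL2]
  have "smor (sprod SL2 SL2) SL2 (\<lambda>s (x, y). x \<otimes>\<^bsub>SL2_grp s\<^esub> y)"
  proof (rule smor_into_embedded[OF SL2_ctx prod sprod_cover[OF SL2_covered SL2_covered]])
    show "(case z of (x, y) \<Rightarrow> x \<otimes>\<^bsub>SL2_grp s\<^esub> y) \<in> SL2_pts s" if "z \<in> pts (sprod SL2 SL2) s" for s z
      using that SL2_pts_mult by (auto simp: SL2_simps)
    fix i j
    have "sfun (sprod SL2 SL2) ((\<lambda>_. False) (i, j)) (\<lambda>s z. (fst z ** snd z) $ i $ j)"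
      by (rule sfun_matrix_mult[OF prod, where p = "\<lambda>_. False"])
        (simp_all add: sfun_fst[OF satlas_SL2 satlas_SL2 sfun_SL2_entry]
          sfun_snd[OF satlas_SL2 satlas_SL2 sfun_SL2_entry])
    then show "sfun (sprod SL2 SL2) False (\<lambda>s z. (case z of (x, y) \<Rightarrow> x \<otimes>\<^bsub>SL2_grp s\<^esub> y) $ i $ j)"
      by (simp add: case_prod_unfold)
  qed
  moreover have "smor SL2 SL2 (\<lambda>s. m_inv (SL2_grp s))"
  proof (rule smor_into_embedded[OF SL2_ctx satlas_SL2 SL2_covered])
    show "inv\<^bsub>SL2_grp s\<^esub> M \<in> SL2_pts s" if "M \<in> pts SL2 s" for s M
      using that sl2inv_pts inv_SL2 by (simp add: SL2_simps)
    fix i j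
    have "\<forall>i j. sfun SL2 False (\<lambda>s M. sl2inv M $ i $ j)"
      by (simp add: forall_2 sl2inv_def sfun_minus sfun_SL2_entry)
    then have "sfun SL2 False (\<lambda>s M. sl2inv M $ i $ j)" by blast
    then show "sfun SL2 False (\<lambda>s M. (inv\<^bsub>SL2_grp s\<^esub> M) $ i $ j)"
      by (rule sfun_cong[OF satlas_SL2]) (simp add: inv_SL2 SL2_simps)
  qed
  moreover have "\<forall>s. group (SL2_grp s) \<and> carrier (SL2_grp s) = pts SL2 s"
    by (simp add: group_SL2 SL2_simps)
  ultimately show ?thesis
    unfolding super_lie_group_def using SL2_supermanifold by blast
qed

lemma smor_SL2_emb: "smor SL2 SC SL2_emb"
proof (rule smor_into_embedded[OF SC_ctx satlas_SL2 SL2_covered])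
  show "SL2_emb s M \<in> SC_pts s" if "M \<in> pts SL2 s" for s M
    using that SL2_emb_pts_iff by (simp add: SL2_simps)
  fix i j
  have "\<forall>i j. sfun SL2 (scpar (i, j)) (\<lambda>s M. SL2_emb s M $ i $ j)"
    by (simp add: forall_3 SL2_emb_def scpar_def sfun_SL2_entry sfun_zero sfun_one)
  then show "sfun SL2 (scpar (i, j)) (\<lambda>s M. SL2_emb s M $ i $ j)" by blast
qed

section \<open>The block retraction: immersion and topological embedding\<close>

definition emb23 :: "2 \<Rightarrow> 3" where
  "emb23 i = (if i = 1 then 1 else 2)"

lemma emb23_simps [simp]: "emb23 1 = 1" "emb23 2 = 2"
  by (simp_all add: emb23_def)

lemma SL2_emb_block: "SL2_emb s A $ emb23 i $ emb23 j = A $ i $ j"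
proof -
  have "\<forall>i j. SL2_emb s A $ emb23 i $ emb23 j = A $ i $ j"
    by (simp add: forall_2 SL2_emb_def)
  then show ?thesis by blast
qed

text \<open>The upper left block retracts \<open>SC\<close> onto the ambient space of \<open>SL2\<close>, so the derivative of
  the embedding followed by that of the block is the derivative of a parametrisation of \<open>SL2\<close>.\<close>

lemma simmersion_SL2_emb: "simmersion SL2 SC SL2_emb"
proof -
  let ?g = "\<lambda>s M :: grassmann ^ 3 ^ 3. \<chi> k :: 2 \<times> 2. M $ emb23 (fst k) $ emb23 (snd k)"
  have "smor SC (superspace (\<lambda>_. False)) ?g"
    unfolding smor_superspace_iff[OF satlas_SC SC_covered]
  proof
    fix k :: "2 \<times> 2"
    have "scpar (emb23 (fst k), emb23 (snd k)) = False" by (simp add: scpar_def emb23_def)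
    then show "sfun SC False (\<lambda>s M. ?g s M $ k)"
      using sfun_SC_entry[of "emb23 (fst k)" "emb23 (snd k)"] by simp
  qed
  then have g: "\<And>s M. M \<in> pts SC s \<Longrightarrow> ?g s M \<in> space_pts (\<lambda>_. False) s"
    "\<And>s M. M \<in> pts SC s \<Longrightarrow> sdat SC (superspace (\<lambda>_. False)) ?g s M"
    unfolding smor_iff_sdat[OF satlas_SC satlas_superspace] by auto
  have f: "\<And>s. SL2_emb s \<in> pts SL2 s \<rightarrow> pts SC s" "natural_on (pts SL2) SL2 SC SL2_emb"
    "continuous_map (base SL2) (base SC) (SL2_emb 0)" "\<And>s x. x \<in> pts SL2 s \<Longrightarrow> sdat SL2 SC SL2_emb s x"
    using smor_SL2_emb unfolding smor_iff_sdat[OF satlas_SL2 satlas_SC] by blast+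
  have "\<exists>L. (local_rep SL2 SL2_emb U c d s has_derivative L)
              (at (c s x) within c s ` local_dom SL2 SC SL2_emb U W s) \<and>
            inj_on L (space_pts (par SL2) s)"
    if U: "(U, c) \<in> charts SL2" and W: "(W, d) \<in> charts SC" and x: "x \<in> local_dom SL2 SC SL2_emb U W s"
    for U c W d s x
  proof -
    note c = satlasD(3)[OF satlas_SL2 U] and d = satlasD(3)[OF satlas_SC W]
    let ?A = "c s ` local_dom SL2 SC SL2_emb U W s"
    have A: "sopen (par SL2) s ?A"
      by (rule local_dom_sopen[OF satlas_SL2 satlas_SC f(1-3) c chart_openin[OF satlas_SC d]])
    have xA: "c s x \<in> ?A" using x by blast
    have xU: "x \<in> over SL2 U s" and xW: "SL2_emb s x \<in> over SC W s" using x by (simp_all add: local_dom_def)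
    obtain L where L: "sderiv (par SL2) s (local_rep SL2 SL2_emb U c d s) (c s x) L"
      using f(4)[OF over_pts[OF xU]] U W xU xW unfolding sdat_def by blast
    have "\<exists>M. sderiv (par SC) s (\<lambda>u. ?g s (inv_into (over SC W s) (d s) u)) (d s (SL2_emb s x)) M"
      using g(2)[OF over_pts[OF xW]] W xW sdat_to_superspace[of SC s ?g "\<lambda>_. False" "SL2_emb s x"] g(1) by blast
    then obtain M where M: "sderiv (par SC) s (\<lambda>u. ?g s (inv_into (over SC W s) (d s) u)) (d s (SL2_emb s x)) M"
      by blast
    have A_inv: "\<exists>y. y \<in> over SL2 U s \<and> SL2_emb s y \<in> over SC W s \<and> inv_into (over SL2 U s) (c s) v = y"
      if v: "v \<in> ?A" for v
    proof -
      obtain y where "v = c s y" "y \<in> local_dom SL2 SC SL2_emb U W s" using v by blast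
      then show ?thesis using chart_inv[OF satlas_SL2 c, of y s] by (auto simp: local_dom_def)
    qed
    have "sderiv (par SL2) s (\<lambda>v. ?g s (inv_into (over SC W s) (d s) (local_rep SL2 SL2_emb U c d s v))) (c s x) (\<lambda>h. M (L h))"
    proof (rule sderiv_chain[OF L A xA])
      show "local_rep SL2 SL2_emb U c d s v \<in> space_pts (par SC) s" if "v \<in> ?A" for v
        using A_inv[OF that] chart_space_pts[OF satlas_SC d] by (auto simp: local_rep_def)
      show "sderiv (par SC) s (\<lambda>u. ?g s (inv_into (over SC W s) (d s) u)) (local_rep SL2 SL2_emb U c d s (c s x)) M"
        using M chart_inv[OF satlas_SL2 c xU] by (simp add: local_rep_def)
    qed
    moreover have "?g s (inv_into (over SC W s) (d s) (local_rep SL2 SL2_emb U c d s v)) =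
        mat_coords (inv_into (over SL2 U s) (c s) v)" if v: "v \<in> ?A" for v
    proof -
      obtain y where y: "SL2_emb s y \<in> over SC W s" "inv_into (over SL2 U s) (c s) v = y"
        using A_inv[OF v] by blast
      then have "inv_into (over SC W s) (d s) (local_rep SL2 SL2_emb U c d s v) = SL2_emb s y"
        using chart_inv[OF satlas_SC d y(1)] by (simp add: local_rep_def)
      then show ?thesis using y(2) by (simp add: vec_eq_iff SL2_emb_block)
    qed
    ultimately have "sderiv (par SL2) s (\<lambda>v. mat_coords (inv_into (over SL2 U s) (c s) v)) (c s x) (\<lambda>h. M (L h))"
      using sderiv_cong[OF A xA, of "\<lambda>v. ?g s (inv_into (over SC W s) (d s) (local_rep SL2 SL2_emb U c d s v))"
          "\<lambda>v. mat_coords (inv_into (over SL2 U s) (c s) v)"] by blast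
    then have "inj_on (\<lambda>h. M (L h)) (space_pts (par SL2) s)"
      using embedded_param_inj[OF SL2_ctx U xU, of "\<lambda>h. M (L h)"] by (simp add: SL2_simps)
    then have "inj_on L (space_pts (par SL2) s)"
      unfolding inj_on_def by metis
    moreover have "(local_rep SL2 SL2_emb U c d s has_derivative L) (at (c s x) within ?A)"
      using sderivD(1)[OF L] at_within_openin[OF A xA] by simp
    ultimately show ?thesis by blast
  qed
  then show ?thesis unfolding simmersion_def using smor_SL2_emb by blast
qed

text \<open>Extraction of the upper left block is continuous on all matrices and a left inverse of
  the embedding, so it restricts to a continuous inverse on the image.\<close>

lemma embedding_map_SL2_emb: "embedding_map (base SL2) (base SC) (SL2_emb 0)"
proof -
  let ?r = "\<lambda>M :: grassmann ^ 3 ^ 3. (\<chi> i j. M $ emb23 i $ emb23 j) :: grassmann ^ 2 ^ 2"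
  let ?I = "SL2_emb 0 ` topspace (base SL2)"
  have r: "?r (SL2_emb 0 A) = A" for A by (simp add: vec_eq_iff SL2_emb_block)
  have tL: "topspace (base SL2) = SL2_pts 0" by (rule embedded_topspace[OF SL2_ctx])
  have "homeomorphic_maps (base SL2) (subtopology (base SC) ?I) (SL2_emb 0) ?r"
    unfolding homeomorphic_maps_def
  proof (intro conjI ballI)
    have "continuous_map (base SL2) (base SC) (SL2_emb 0)" using smor_SL2_emb unfolding smor_def by blast
    then show "continuous_map (base SL2) (subtopology (base SC) ?I) (SL2_emb 0)"
      by (auto simp: continuous_map_in_subtopology)
    have "continuous_map (subtopology (base SC) ?I) (pullback_topology (SL2_pts 0) mat_coords euclidean) ?r"
    proof (rule continuous_map_pullback')
      let ?T = "\<lambda>w :: grassmann ^ (3 \<times> 3). (\<chi> k. w $ (emb23 (fst k), emb23 (snd k))) :: grassmann ^ (2 \<times> 2)"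
      have "continuous_on UNIV ?T"
        by (intro continuous_on_vec_lambda continuous_on_component continuous_on_id)
      then have "continuous_map (base SC) euclidean (?T \<circ> mat_coords)"
        unfolding SC_simps by (intro continuous_map_pullback) simp
      moreover have "?T \<circ> mat_coords = mat_coords \<circ> ?r" by (auto simp: vec_eq_iff)
      ultimately show "continuous_map (subtopology (base SC) ?I) euclidean (mat_coords \<circ> ?r)"
        by (simp add: continuous_map_from_subtopology)
      show "topspace (subtopology (base SC) ?I) \<subseteq> ?r -` SL2_pts 0"
        using r by (auto simp: tL)
    qed
    then show "continuous_map (subtopology (base SC) ?I) (base SL2) ?r" by (simp only: SL2_simps(3))
  qed (use r in auto)
  then show ?thesis unfolding embedding_map_def by (rule homeomorphic_maps_imp_map)
qed

lemma super_lie_embedding_SL2_emb: "super_lie_embedding SL2 SL2_grp SC SC_grp SL2_emb"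
proof -
  have "SL2_emb s \<in> hom (SL2_grp s) (SC_grp s)" for s
    unfolding hom_def using SL2_emb_pts_iff[of s] by (auto simp: SL2_emb_mult)
  then show ?thesis
    unfolding super_lie_embedding_def sembedding_def
    using super_lie_group_SL2 super_lie_group_SC simmersion_SL2_emb embedding_map_SL2_emb by blast
qed

section \<open>The coset space\<close>

abbreviation proj :: "nat \<Rightarrow> grassmann ^ 3 ^ 3 \<Rightarrow> (grassmann ^ 3 ^ 3) set" where
  "proj \<equiv> coset_proj SL2_grp SC_grp SL2_emb"

abbreviation odd2 :: "2 \<Rightarrow> bool" where
  "odd2 \<equiv> \<lambda>_. True"

definition trow :: "grassmann ^ 3 ^ 3 \<Rightarrow> grassmann ^ 2" where
  "trow M = (\<chi> j. M $ 3 $ emb23 j)"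

definition sec :: "grassmann ^ 2 \<Rightarrow> grassmann ^ 3 ^ 3" where
  "sec v = scmat 1 0 0 (1 + v $ 1 * v $ 2) (v $ 1) (v $ 2)"

text \<open>The choice of a representative is harmless because the third row is constant on a coset;
  this is the content of \<open>crow_proj\<close>.\<close>

definition crow :: "(grassmann ^ 3 ^ 3) set \<Rightarrow> grassmann ^ 2" where
  "crow C = trow (SOME M. M \<in> C)"

lemma proj_iff: "h \<in> proj s g \<longleftrightarrow> (\<exists>A\<in>SL2_pts s. h = SL2_emb s A ** g)"
  by (auto simp: coset_proj_def r_coset_def)

lemma trow_SL2_emb [simp]: "trow (SL2_emb s A ** g) = trow g"
proof -
  have "\<forall>j. (SL2_emb s A ** g) $ 3 $ j = g $ 3 $ j"
    by (simp add: SL2_emb_def matrix_matrix_mult_def sum_3)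
  then show ?thesis by (simp add: trow_def)
qed

lemma SL2_emb_one: "SL2_emb s (mat 1) = mat 1"
  by (simp add: SL2_emb_def mat_def vec_eq_iff forall_3)

lemma proj_self: "g \<in> proj s g"
  unfolding proj_iff using SL2_pts_one SL2_emb_one by (metis matrix_mul_lid)

lemma proj_translate:
  assumes "A \<in> SL2_pts s" shows "proj s (SL2_emb s A ** g) = proj s g"
proof -
  have sub: "proj s (SL2_emb s B ** h) \<subseteq> proj s h" if "B \<in> SL2_pts s" for B h
  proof
    fix k assume "k \<in> proj s (SL2_emb s B ** h)"
    then obtain A where A: "A \<in> SL2_pts s" "k = SL2_emb s A ** (SL2_emb s B ** h)" unfolding proj_iff by blast
    then have "k = SL2_emb s (A ** B) ** h" by (simp add: SL2_emb_mult matrix_mul_assoc)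
    then show "k \<in> proj s h" unfolding proj_iff using SL2_pts_mult[OF A(1) that] by blast
  qed
  have "SL2_emb s (sl2inv A) ** (SL2_emb s A ** g) = SL2_emb s (sl2inv A ** A) ** g"
    by (simp add: SL2_emb_mult matrix_mul_assoc)
  then have "SL2_emb s (sl2inv A) ** (SL2_emb s A ** g) = g"
    by (simp add: sl2inv_mult(2)[OF assms] SL2_emb_one)
  then show ?thesis using sub[OF assms, of g] sub[OF sl2inv_pts[OF assms], of "SL2_emb s A ** g"] by auto
qed

text \<open>The corner entry is determined by \<alpha> and \<beta>, so the full third rows of
  \<open>g\<close> and \<open>h\<close> agree. The third row of \<open>h ** scinv g\<close> is
  therefore that of the identity, and by the normal form such a point is a block matrix.\<close>

lemma trow_eq_imp:
  assumes g: "g \<in> SC_pts s" and h: "h \<in> SC_pts s" and t: "trow g = trow h"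
  obtains A where "A \<in> SL2_pts s" "h = SL2_emb s A ** g"
proof -
  define k where "k = h ** scinv g"
  have k: "k \<in> SC_pts s" unfolding k_def by (intro SC_pts_mult SC_pts_scinv g h)
  have "g $ 3 $ emb23 j = h $ 3 $ emb23 j" for j using t by (simp add: trow_def vec_eq_iff)
  from this[of 1] this[of 2] have t12: "g $ 3 $ 1 = h $ 3 $ 1" "g $ 3 $ 2 = h $ 3 $ 2" by simp_all
  have M33: "M $ 3 $ 3 = 1 - M $ 3 $ 1 * M $ 3 $ 2" if "M \<in> SC_pts s" for M
  proof -
    have "M $ 3 $ 3 = scmat (M$1$1) (M$2$1) (M$1$2) (M$2$2) (M$3$1) (M$3$2) $ 3 $ 3"
      using SC_pts_scmat(1)[OF that] by simp
    then show ?thesis by (simp add: scmat_def)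
  qed
  have "\<forall>j. g $ 3 $ j = h $ 3 $ j" using M33[OF g] M33[OF h] t12 by (simp add: forall_3)
  then have "k $ 3 $ j = (g ** scinv g) $ 3 $ j" for j by (simp add: k_def matrix_matrix_mult_def)
  moreover have "g ** scinv g = mat 1" using g unfolding SC_pts_iff by blast
  ultimately have k3: "k $ 3 $ 1 = 0" "k $ 3 $ 2 = 0" by (simp_all add: mat_def)
  let ?A = "vector [vector [k$1$1, k$1$2], vector [k$2$1, k$2$2]] :: grassmann ^ 2 ^ 2"
  have "k = scmat (k$1$1) (k$2$1) (k$1$2) (k$2$2) 0 0" using SC_pts_scmat(1)[OF k] k3 by simp
  also have "\<dots> = SL2_emb s ?A" by (simp add: scmat_def SL2_emb_def vec_eq_iff forall_3)
  finally have kA: "k = SL2_emb s ?A" .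
  then have "?A \<in> SL2_pts s" using k SL2_emb_pts_iff by metis
  moreover have "h = k ** g"
    by (simp add: k_def scinv_cancel[OF g] flip: matrix_mul_assoc)
  ultimately show thesis using that kA by metis
qed

lemma proj_eq_iff:
  assumes "g \<in> SC_pts s" "h \<in> SC_pts s"
  shows "proj s g = proj s h \<longleftrightarrow> trow g = trow h"
proof
  assume "proj s g = proj s h"
  then have "h \<in> proj s g" using proj_self by simp
  then show "trow g = trow h" unfolding proj_iff by auto
next
  assume "trow g = trow h"
  then obtain A where "A \<in> SL2_pts s" "h = SL2_emb s A ** g" by (rule trow_eq_imp[OF assms])
  then show "proj s g = proj s h" using proj_translate by simp
qed

lemma crow_proj [simp]: "crow (proj s g) = trow g"
proof -
  have "(SOME M. M \<in> proj s g) \<in> proj s g" by (rule someI[of _ g]) (rule proj_self)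
  then show ?thesis unfolding crow_def proj_iff by auto
qed

lemma space_pts_odd2: "v \<in> space_pts odd2 s \<longleftrightarrow> (\<forall>j. v $ j \<in> godd s)"
  by (simp add: space_pts_def)

lemma sec_SC_pts:
  assumes "v \<in> space_pts odd2 s" shows "sec v \<in> SC_pts s"
proof -
  have v: "v $ j \<in> godd s" for j using assms by (simp add: space_pts_odd2)
  show ?thesis unfolding sec_def
    by (rule scmat_SC_pts) (auto simp: v intro!: gpart_add gpart_mult_even_odd(4))
qed

lemma trow_sec [simp]: "trow (sec v) = v"
  by (simp add: trow_def sec_def scmat_def vec_eq_iff forall_2)

lemma trow_space_pts: "M \<in> SC_pts s \<Longrightarrow> trow M \<in> space_pts odd2 s"
  using smat_entries(8,9)[OF SC_pts_smat, of M s] by (simp add: space_pts_odd2 trow_def emb23_def)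

lemma trow_act: "trow (mat_act s t \<phi> M) = (\<chi> j. \<phi> (trow M $ j))"
  by (simp add: trow_def vec_eq_iff)

text \<open>The action on the quotient is defined as a union over all representatives; every
  representative contributes the same coset because \<open>trow\<close> commutes with the
  action.\<close>

lemma proj_act:
  assumes \<phi>: "\<phi> \<in> ghom s t" and M: "M \<in> SC_pts s"
  shows "(\<Union>g\<in>proj s M. proj t (mat_act s t \<phi> g)) = proj t (mat_act s t \<phi> M)"
proof -
  have "proj t (mat_act s t \<phi> g) = proj t (mat_act s t \<phi> M)" if g: "g \<in> proj s M" for g
  proof -
    obtain A where A: "A \<in> SL2_pts s" "g = SL2_emb s A ** M" using g unfolding proj_iff by blast
    have "g \<in> SC_pts s" unfolding A(2) using A(1) M by (intro SC_pts_mult) (simp_all add: SL2_emb_pts_iff)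
    then have "mat_act s t \<phi> g \<in> SC_pts t" "mat_act s t \<phi> M \<in> SC_pts t" using SC_act[OF \<phi>] M by blast+
    then show ?thesis using A(2) by (simp add: proj_eq_iff trow_act)
  qed
  then show ?thesis using proj_self by blast
qed

section \<open>The functor of points and the charts of the quotient\<close>

lemma topspace_quotient_topology: "topspace (quotient_topology T f) = f ` topspace T"
proof
  have "{x \<in> topspace T. f x \<in> f ` topspace T} = topspace T" by auto
  then have "openin (quotient_topology T f) (f ` topspace T)"
    unfolding openin_quotient_topology by simp
  then show "f ` topspace T \<subseteq> topspace (quotient_topology T f)" by (rule openin_subset)
  show "topspace (quotient_topology T f) \<subseteq> f ` topspace T"
    using openin_topspace[of "quotient_topology T f"] unfolding openin_quotient_topology by blast
qed

lemma SUSY_simps: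
  "pts SUSY s = proj s ` SC_pts s" "act SUSY s t \<phi> C = (\<Union>g\<in>C. proj t (mat_act s t \<phi> g))"
  "base SUSY = quotient_topology (base SC) (proj 0)" "par SUSY = odd2"
  by (auto simp: SUSY_def coset_space_def Let_def SC_simps RCOSETS_def coset_proj_def)

lemma SUSY_charts: "(U, c) \<in> charts SUSY \<longleftrightarrow> is_chart SUSY U c \<and>
        smor (open_sub SC {g \<in> pts SC 0. proj 0 g \<in> U}) (superspace odd2) (\<lambda>s g. c s (proj s g)) \<and>
        (\<forall>v\<in>c 0 ` U. \<exists>V \<sigma>. openin (base (superspace odd2)) V \<and> v \<in> V \<and> V \<subseteq> c 0 ` U \<and>
           smor (open_sub (superspace odd2) V) SC \<sigma> \<and>
           (\<forall>s. \<forall>w\<in>over (superspace odd2) V s.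
              proj s (\<sigma> s w) \<in> over SUSY U s \<and> c s (proj s (\<sigma> s w)) = w))"
  unfolding SUSY_def coset_space_def Let_def
  by (simp add: is_chart_def over_def natural_on_def del: superspace_simps(5))

lemma proj_SUSY: "M \<in> SC_pts s \<Longrightarrow> proj s M \<in> pts SUSY s"
  by (simp add: SUSY_simps)

lemma SUSY_act_proj: "\<phi> \<in> ghom s t \<Longrightarrow> M \<in> SC_pts s \<Longrightarrow> act SUSY s t \<phi> (proj s M) = proj t (mat_act s t \<phi> M)"
  unfolding SUSY_simps by (rule proj_act)

lemma natural_proj: "natural_on (pts SC) SC SUSY proj"
  unfolding natural_on_def using SUSY_act_proj by (simp add: SC_simps)

lemma SUSY_topspace: "topspace (base SUSY) = pts SUSY 0"
  unfolding SUSY_simps topspace_quotient_topology satlasD(2)[OF satlas_SC] by (simp add: SC_simps)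

lemma spoint_functor_SUSY: "spoint_functor SUSY"
proof -
  note F = spoint_functorD[OF satlasD(1)[OF satlas_SC], unfolded SC_simps]
  have 1: "act SUSY s t \<phi> x \<in> pts SUSY t" if "\<phi> \<in> ghom s t" "x \<in> pts SUSY s" for s t \<phi> x
    using that F(1)[OF that(1)] SUSY_act_proj[OF that(1)] proj_SUSY by (auto simp: SUSY_simps(1))
  have 2: "act SUSY s s (restrict id (galg s)) x = x" if "x \<in> pts SUSY s" for s x
  proof -
    have "restrict id (galg s) \<in> ghom s s"
      by (auto simp: ghom_def galg_add galg_mult gpart_galg gpart_galg[OF gscal_geven])
    then show ?thesis using that F(2) SUSY_act_proj by (auto simp: SUSY_simps(1))
  qed
  have 3: "act SUSY s u (compose (galg s) \<psi> \<phi>) x = act SUSY t u \<psi> (act SUSY s t \<phi> x)"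
    if a: "\<phi> \<in> ghom s t" "\<psi> \<in> ghom t u" "x \<in> pts SUSY s" for s t u \<phi> \<psi> x
  proof -
    obtain M where M: "x = proj s M" "M \<in> SC_pts s" using a(3) by (auto simp: SUSY_simps(1))
    show ?thesis
      unfolding M(1) SUSY_act_proj[OF a(1) M(2)] SUSY_act_proj[OF ghom_compose[OF a(1,2)] M(2)]
        SUSY_act_proj[OF a(2) F(1)[OF a(1) M(2)]] F(3)[OF a(1,2) M(2)] ..
  qed
  show ?thesis unfolding spoint_functor_def
  proof (intro conjI allI ballI)
    show "act SUSY s t \<phi> \<in> pts SUSY s \<rightarrow> pts SUSY t" if "\<phi> \<in> ghom s t" for s t \<phi>
      by (rule Pi_I) (rule 1[OF that])
  qed (rule 2 3; assumption)+
qed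

lemma space_pts_odd2_0: "space_pts odd2 0 = {0}"
  using godd_0 by (auto simp: space_pts_odd2 vec_eq_iff)

text \<open>Over \<open>s = 0\<close> all odd elements vanish, so all third rows coincide and there
  is one coset. The topological conditions on the quotient thereby become conditions on a
  point.\<close>

lemma pts_SUSY_0: "pts SUSY 0 = {proj 0 (mat 1)}"
proof -
  have eq: "proj 0 M = proj 0 (mat 1)" if "M \<in> SC_pts 0" for M
    using trow_space_pts[OF that] trow_space_pts[OF SC_pts_one[of 0]] that SC_pts_one
    by (simp add: proj_eq_iff space_pts_odd2_0)
  show ?thesis unfolding SUSY_simps(1)
  proof (intro equalityI image_subsetI subsetI)
    show "proj 0 M \<in> {proj 0 (mat 1)}" if "M \<in> SC_pts 0" for M unfolding singleton_iff by (rule eq[OF that])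
    show "C \<in> proj 0 ` SC_pts 0" if "C \<in> {proj 0 (mat 1)}" for C using that SC_pts_one by blast
  qed
qed

lemma smor_trow: "smor SC (superspace odd2) (\<lambda>s. trow)"
  unfolding smor_superspace_iff[OF satlas_SC SC_covered]
proof
  fix j :: 2
  have "scpar (3, emb23 j) = True" by (simp add: scpar_def emb23_def)
  then show "sfun SC True (\<lambda>s M. trow M $ j)" using sfun_SC_entry[of 3 "emb23 j"] by (simp add: trow_def)
qed

lemma smor_sec: "smor (superspace odd2) SC (\<lambda>s. sec)"
proof (rule smor_into_embedded[OF SC_ctx satlas_superspace superspace_cover])
  show "sec v \<in> SC_pts s" if "v \<in> pts (superspace odd2) s" for s v using that sec_SC_pts by simp
  show "sfun (superspace odd2) (scpar (i, j)) (\<lambda>s v. sec v $ i $ j)" for i j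
    unfolding sec_def
    by (intro sfun_scmat[OF satlas_superspace] sfun_one sfun_zero sfun_add sfun_mult_parity(3)[OF satlas_superspace]
        sfun_nth)
qed

lemma crow_SUSY:
  assumes C: "C \<in> pts SUSY s"
  shows "crow C \<in> space_pts odd2 s" "proj s (sec (crow C)) = C"
proof -
  obtain M where M: "C = proj s M" "M \<in> SC_pts s" using C by (auto simp: SUSY_simps(1))
  show "crow C \<in> space_pts odd2 s" using trow_space_pts[OF M(2)] M(1) by simp
  show "proj s (sec (crow C)) = C" using sec_SC_pts[OF trow_space_pts[OF M(2)]] M by (simp add: proj_eq_iff)
qed

lemma natural_crow: "natural_on (pts SUSY) SUSY (superspace odd2) (\<lambda>s. crow)"
  unfolding natural_on_def
proof (intro allI ballI)
  fix s t \<phi> C assume a: "\<phi> \<in> ghom s t" "C \<in> pts SUSY s"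
  then obtain M where M: "C = proj s M" "M \<in> SC_pts s" by (auto simp: SUSY_simps(1))
  show "crow (act SUSY s t \<phi> C) = act (superspace odd2) s t \<phi> (crow C)"
    unfolding M(1) SUSY_act_proj[OF a(1) M(2)] by (simp add: trow_act)
qed

text \<open>The section condition holds globally through \<open>sec\<close>, and the condition on
  the projection is the smoothness of the third row.\<close>

lemma SUSY_global_chart: "(pts SUSY 0, \<lambda>s. crow) \<in> charts SUSY"
proof -
  let ?O = "pts SUSY 0"
  have im: "crow ` ?O = space_pts odd2 0"
    using trow_space_pts[OF SC_pts_one, of 0] by (simp add: pts_SUSY_0 space_pts_odd2_0)
  have over: "over SUSY ?O s = pts SUSY s" for s by (rule over_all[OF spoint_functor_SUSY])
  have bij: "bij_betw crow (pts SUSY s) (space_pts odd2 s)" for s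
  proof (rule bij_betwI[where g = "\<lambda>v. proj s (sec v)"])
    show "crow \<in> pts SUSY s \<rightarrow> space_pts odd2 s" using crow_SUSY by blast
    show "(\<lambda>v. proj s (sec v)) \<in> space_pts odd2 s \<rightarrow> pts SUSY s" using sec_SC_pts by (auto simp: SUSY_simps(1))
  qed (simp_all add: crow_SUSY)
  have homeo: "homeomorphic_map (subtopology (base SUSY) ?O) (subtopology (top_of_set (space_pts odd2 0)) (space_pts odd2 0)) crow"
  proof (rule homeomorphic_maps_imp_map)
    have top: "topspace (subtopology (base SUSY) ?O) = {proj 0 (mat 1)}" using SUSY_topspace by (simp add: pts_SUSY_0)
    have c0: "crow (proj 0 (mat 1)) = 0" using im by (simp add: pts_SUSY_0 space_pts_odd2_0)
    show "homeomorphic_maps (subtopology (base SUSY) ?O) (subtopology (top_of_set (space_pts odd2 0)) (space_pts odd2 0))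
        crow (\<lambda>_. proj 0 (mat 1))"
      unfolding homeomorphic_maps_def
    proof (intro conjI ballI)
      have "continuous_map (subtopology (base SUSY) ?O) (subtopology (top_of_set (space_pts odd2 0)) (space_pts odd2 0)) (\<lambda>_. 0)"
        by (simp add: space_pts_odd2_0)
      then show "continuous_map (subtopology (base SUSY) ?O) (subtopology (top_of_set (space_pts odd2 0)) (space_pts odd2 0)) crow"
      proof (rule continuous_map_eq)
        show "0 = crow x" if "x \<in> topspace (subtopology (base SUSY) ?O)" for x
          using that c0 unfolding top by simp
      qed
      show "continuous_map (subtopology (top_of_set (space_pts odd2 0)) (space_pts odd2 0)) (subtopology (base SUSY) ?O) (\<lambda>_. proj 0 (mat 1))"
        using top by simp
      show "proj 0 (mat 1) = x" if "x \<in> topspace (subtopology (base SUSY) ?O)" for x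
        using that unfolding top by simp
      show "crow (proj 0 (mat 1)) = y" if "y \<in> topspace (subtopology (top_of_set (space_pts odd2 0)) (space_pts odd2 0))" for y
        using that c0 by (simp add: space_pts_odd2_0)
    qed
  qed
  have "is_chart SUSY ?O (\<lambda>s. crow)"
    unfolding is_chart_def SUSY_simps(4) im
    using openin_topspace[of "base SUSY"] SUSY_topspace bij homeo natural_crow
    by (simp add: over natural_on_def)
  \<comment> \<open>The preimage of the chart domain is the whole reduced group, so the smoothness
    condition is that of \<open>trow\<close> on all of \<open>SC\<close>.\<close>
  moreover have "{g \<in> pts SC 0. proj 0 g \<in> ?O} = topspace (base SC)"
    using satlasD(2)[OF satlas_SC] proj_SUSY by (auto simp: SC_simps)
  then have "smor (open_sub SC {g \<in> pts SC 0. proj 0 g \<in> ?O}) (superspace odd2) (\<lambda>s g. crow (proj s g))"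
    using smor_open_sub_incl[OF satlas_SC openin_topspace smor_trow satlas_superspace] by simp
  moreover have V: "openin (base (superspace odd2)) (space_pts odd2 0)" by simp
  have "\<exists>V \<sigma>. openin (base (superspace odd2)) V \<and> v \<in> V \<and> V \<subseteq> space_pts odd2 0 \<and>
           smor (open_sub (superspace odd2) V) SC \<sigma> \<and>
           (\<forall>s. \<forall>w\<in>over (superspace odd2) V s.
              proj s (\<sigma> s w) \<in> over SUSY ?O s \<and> crow (proj s (\<sigma> s w)) = w)"
    if v: "v \<in> space_pts odd2 0" for v
  proof (intro exI conjI allI ballI)
    show "openin (base (superspace odd2)) (space_pts odd2 0)" by (rule V)
    show "smor (open_sub (superspace odd2) (space_pts odd2 0)) SC (\<lambda>s. sec)"
      by (rule smor_open_sub_incl[OF satlas_superspace V smor_sec satlas_SC])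
    fix s w assume "w \<in> over (superspace odd2) (space_pts odd2 0) s"
    then show "proj s (sec w) \<in> over SUSY ?O s"
      unfolding over by (intro proj_SUSY sec_SC_pts) simp
  qed (simp_all add: v)
  ultimately show ?thesis unfolding SUSY_charts im by (intro conjI ballI)
qed

lemma satlas_SUSY: "satlas SUSY"
  unfolding satlas_def using spoint_functor_SUSY SUSY_topspace SUSY_charts by auto

lemma SUSY_covered: "(\<Union>(U, c)\<in>charts SUSY. U) = pts SUSY 0"
proof
  show "pts SUSY 0 \<subseteq> (\<Union>(U, c)\<in>charts SUSY. U)" using SUSY_global_chart by blast
  show "(\<Union>(U, c)\<in>charts SUSY. U) \<subseteq> pts SUSY 0"
    using chart_subset[OF satlas_SUSY satlasD(3)[OF satlas_SUSY]] by blast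
qed

lemma continuous_proj: "continuous_map (base SC) (base SUSY) (proj 0)"
  unfolding continuous_map_def SUSY_simps topspace_quotient_topology openin_quotient_topology by auto

section \<open>Smoothness of the projection and descent along it\<close>

text \<open>Charts of the quotient are required to be smooth after composition with the projection
  on the preimage of their domain; it remains to pass from that open part to
  \<open>SC\<close>.\<close>

lemma sdat_proj:
  assumes g: "g \<in> SC_pts s" shows "sdat SC SUSY proj s g"
  unfolding sdat_def
proof (intro allI impI)
  fix U c W d
  assume U: "(U, c) \<in> charts SC" and W: "(W, d) \<in> charts SUSY"
    and gU: "g \<in> over SC U s" and gW: "proj s g \<in> over SUSY W s"
  let ?S = "{g \<in> pts SC 0. proj 0 g \<in> W}"
  have "openin (base SUSY) W" by (rule chart_openin[OF satlas_SUSY satlasD(3)[OF satlas_SUSY W]])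
  from openin_continuous_map_preimage[OF continuous_proj this]
  have S: "openin (base SC) ?S" using satlasD(2)[OF satlas_SC] by simp
  have "body_pt SUSY s (proj s g) = proj 0 (body_pt SC s g)"
    using SUSY_act_proj[OF bodyhom_ghom g] by (simp add: SC_simps)
  then have gS: "g \<in> over SC ?S s"
    using gW g body_pt_pts[OF satlasD(1)[OF satlas_SC]] by (simp add: over_def SC_simps)
  have "smor (open_sub SC ?S) (superspace odd2) (\<lambda>s g. d s (proj s g))" using W unfolding SUSY_charts by blast
  then have "sdat (open_sub SC ?S) (superspace odd2) (\<lambda>s g. d s (proj s g)) s g" "d s (proj s g) \<in> space_pts odd2 s"
    using gS unfolding smor_iff_sdat[OF satlas_open_sub[OF satlas_SC S] satlas_superspace] by auto
  then have "sdat SC (superspace odd2) (\<lambda>s g. d s (proj s g)) s g"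
    using sdat_open_sub[OF satlas_SC S gS, of "superspace odd2" "\<lambda>s g. d s (proj s g)"] by simp
  then have "\<exists>L. sderiv (par SC) s (local_rep SC (\<lambda>s g. d s (proj s g)) U c (\<lambda>s v. v) s) (c s g) L"
    using U gU \<open>d s (proj s g) \<in> space_pts odd2 s\<close> unfolding sdat_def by simp
  then show "\<exists>L. sderiv (par SC) s (local_rep SC proj U c d s) (c s g) L" by (simp add: local_rep_def)
qed

lemma smor_proj: "smor SC SUSY proj"
  unfolding smor_iff_sdat[OF satlas_SC satlas_SUSY]
  using natural_proj continuous_proj sdat_proj proj_SUSY by (auto simp: SC_simps)

text \<open>The section condition speaks of reduced points. Used at the body of
  \<open>c s x\<close>, it yields a section defined around the coordinate \<open>c s x\<close> over
  the given superpoint.\<close>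

lemma SUSY_chart_section:
  assumes U: "(U, c) \<in> charts SUSY" and x: "x \<in> over SUSY U s"
  obtains V \<sigma> where "openin (base (superspace odd2)) V" "c s x \<in> over (superspace odd2) V s"
    "smor (open_sub (superspace odd2) V) SC \<sigma>"
    "\<And>w. w \<in> over (superspace odd2) V s \<Longrightarrow> proj s (\<sigma> s w) \<in> over SUSY U s \<and> c s (proj s (\<sigma> s w)) = w"
proof -
  note c = satlasD(3)[OF satlas_SUSY U]
  have "sbody (c s x) = c 0 (body_pt SUSY s x)" by (rule chart_body[OF satlas_SUSY c x])
  moreover have "body_pt SUSY s x \<in> U" using x by (simp add: over_def)
  ultimately have "sbody (c s x) \<in> c 0 ` U" by simp
  then have "\<exists>V \<sigma>. openin (base (superspace odd2)) V \<and> sbody (c s x) \<in> V \<and> V \<subseteq> c 0 ` U \<and>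
           smor (open_sub (superspace odd2) V) SC \<sigma> \<and>
           (\<forall>s. \<forall>w\<in>over (superspace odd2) V s.
              proj s (\<sigma> s w) \<in> over SUSY U s \<and> c s (proj s (\<sigma> s w)) = w)"
    using U unfolding SUSY_charts by (elim conjE) (erule bspec)
  then obtain V \<sigma> where V: "openin (base (superspace odd2)) V" "sbody (c s x) \<in> V"
    "smor (open_sub (superspace odd2) V) SC \<sigma>"
    "\<forall>s. \<forall>w\<in>over (superspace odd2) V s. proj s (\<sigma> s w) \<in> over SUSY U s \<and> c s (proj s (\<sigma> s w)) = w"
    by blast
  have "c s x \<in> over (superspace odd2) V s"
    using V(2) chart_space_pts[OF satlas_SUSY c x] by (simp add: over_superspace SUSY_simps(4))
  then show thesis using V by (intro that[of V \<sigma>]) auto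
qed

text \<open>Charts of the quotient have smooth local sections, so smoothness descends along the projection.\<close>

lemma sdat_descend:
  assumes f: "\<And>g. g \<in> SC_pts s \<Longrightarrow> sdat SC Y (\<lambda>s g. f s (proj s g)) s g" and x: "x \<in> pts SUSY s"
  shows "sdat SUSY Y f s x"
  unfolding sdat_def
proof (intro allI impI)
  fix U c W d
  assume U: "(U, c) \<in> charts SUSY" and W: "(W, d) \<in> charts Y"
    and xU: "x \<in> over SUSY U s" and fW: "f s x \<in> over Y W s"
  note c = satlasD(3)[OF satlas_SUSY U]
  obtain V \<sigma> where V: "openin (base (superspace odd2)) V" "c s x \<in> over (superspace odd2) V s"
    "smor (open_sub (superspace odd2) V) SC \<sigma>"
    "\<And>w. w \<in> over (superspace odd2) V s \<Longrightarrow> proj s (\<sigma> s w) \<in> over SUSY U s \<and> c s (proj s (\<sigma> s w)) = w"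
    by (rule SUSY_chart_section[OF U xU], rule that)
  \<comment> \<open>The section composed with the projection computes the inverse of the chart, so
    \<open>f\<close> in the chart is the smooth function \<open>f\<close> after projection, composed
    with \<open>\<sigma>\<close>.\<close>
  have inv: "inv_into (over SUSY U s) (c s) w = proj s (\<sigma> s w)" if "w \<in> over (superspace odd2) V s" for w
    using V(4)[OF that] chart_inv[OF satlas_SUSY c, of "proj s (\<sigma> s w)" s] by simp
  have px: "proj s (\<sigma> s (c s x)) = x" using inv[OF V(2)] chart_inv[OF satlas_SUSY c xU] by simp
  have \<sigma>: "\<sigma> s (c s x) \<in> SC_pts s" using V(2,3) unfolding smor_def by (auto simp: SC_simps)
  have "sdat (open_sub (superspace odd2) V) Y (\<lambda>s w. f s (proj s (\<sigma> s w))) s (c s x)"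
    by (rule sdat_comp[OF satlas_open_sub[OF satlas_superspace V(1)] satlas_SC SC_covered V(3) _ f[OF \<sigma>]])
      (simp add: V(2))
  then have "sdat (superspace odd2) Y (\<lambda>s w. f s (proj s (\<sigma> s w))) s (c s x)"
    using sdat_open_sub[OF satlas_superspace V(1,2), of Y "\<lambda>s w. f s (proj s (\<sigma> s w))"] by simp
  moreover have "c s x \<in> space_pts odd2 s" using over_pts[OF V(2)] by simp
  ultimately have "\<exists>L. sderiv odd2 s (local_rep (superspace odd2) (\<lambda>s w. f s (proj s (\<sigma> s w)))
      (space_pts odd2 0) (\<lambda>s v. v) d s) (c s x) L"
    using W fW px unfolding sdat_def by simp
  then obtain L where L: "sderiv odd2 s (local_rep (superspace odd2) (\<lambda>s w. f s (proj s (\<sigma> s w)))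
      (space_pts odd2 0) (\<lambda>s v. v) d s) (c s x) L"
    by blast
  have "sopen odd2 s (over (superspace odd2) V s)" using V(1) by (intro sopen_over_superspace) simp
  moreover have "local_rep SUSY f U c d s w = local_rep (superspace odd2) (\<lambda>s w. f s (proj s (\<sigma> s w)))
      (space_pts odd2 0) (\<lambda>s v. v) d s w" if w: "w \<in> over (superspace odd2) V s" for w
  proof -
    have "inv_into (space_pts odd2 s) (\<lambda>v. v) w = w"
      using over_pts[OF w] inv_into_f_f[of "\<lambda>v. v" "space_pts odd2 s" w] by (simp add: inj_on_def)
    then show ?thesis using inv[OF w] by (simp add: local_rep_def)
  qed
  ultimately have "sderiv odd2 s (local_rep SUSY f U c d s) (c s x) L"
    using L V(2) sderiv_cong[of odd2 s "over (superspace odd2) V s" "c s x" "local_rep SUSY f U c d s"] by blast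
  then show "\<exists>L. sderiv (par SUSY) s (local_rep SUSY f U c d s) (c s x) L" by (auto simp: SUSY_simps(4))
qed

text \<open>Transitions are smooth because the identity of the quotient descends from the
  projection; the topological conditions hold because the reduced space is one point.\<close>

lemma SUSY_supermanifold: "supermanifold SUSY"
proof -
  have "smor SUSY SUSY (\<lambda>s x. x)"
    unfolding smor_iff_sdat[OF satlas_SUSY satlas_SUSY] natural_on_def
    using sdat_descend[of _ SUSY "\<lambda>s x. x"] sdat_proj continuous_map_id[of "base SUSY"] by (simp add: id_def)
  then have tr: "sdiff_in_charts SUSY SUSY (\<lambda>s x. x)" unfolding smor_def by blast
  have top: "topspace (base SUSY) = {proj 0 (mat 1)}" using SUSY_topspace pts_SUSY_0 by simp
  then have "Hausdorff_space (base SUSY)" by (simp add: Hausdorff_space_def)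
  moreover have "second_countable (base SUSY)"
    unfolding second_countable_def
  proof (intro exI[of _ "{topspace (base SUSY)}"] conjI allI impI)
    fix U x assume "openin (base SUSY) U \<and> x \<in> U"
    then show "\<exists>V\<in>{topspace (base SUSY)}. x \<in> V \<and> V \<subseteq> U"
      using openin_subset[of "base SUSY" U] top by auto
  qed auto
  ultimately show ?thesis
    unfolding supermanifold_def
    using spoint_functor_SUSY SUSY_topspace SUSY_covered satlasD(3)[OF satlas_SUSY] tr by auto
qed

section \<open>Submersivity of the projection and the global isomorphism\<close>

lemma sdiff1_sum: "(\<And>k. k \<in> A \<Longrightarrow> sdiff1 p s (f k) x) \<Longrightarrow> sdiff1 p s (\<lambda>v. \<Sum>k\<in>A. f k v) x"
  by (induction A rule: infinite_finite_induct) (simp_all add: sdiff1_const sdiff1_add)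

text \<open>Surjectivity of the derivative at \<open>x\<close>: translate a local section by the element of \<open>SL2\<close>
  that moves its value in the coset of \<open>x\<close> to \<open>x\<close>. The translated section is defined only over
  one superpoint, but this is enough to differentiate it there.\<close>

lemma ssubmersion_proj: "ssubmersion SC SUSY proj"
proof -
  have "\<exists>L. (local_rep SC proj U c d s has_derivative L)
              (at (c s x) within c s ` local_dom SC SUSY proj U W s) \<and>
            L ` space_pts (par SC) s = space_pts (par SUSY) s"
    if U: "(U, c) \<in> charts SC" and W: "(W, d) \<in> charts SUSY" and x: "x \<in> local_dom SC SUSY proj U W s"
    for U c W d s x
  proof -
    note c = satlasD(3)[OF satlas_SC U] and d = satlasD(3)[OF satlas_SUSY W]
    let ?A = "c s ` local_dom SC SUSY proj U W s"
    have fp: "\<And>s. proj s \<in> pts SC s \<rightarrow> pts SUSY s" using proj_SUSY by (auto simp: SC_simps)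
    have A: "sopen (par SC) s ?A"
      by (rule local_dom_sopen[OF satlas_SC satlas_SUSY fp natural_proj continuous_proj c chart_openin[OF satlas_SUSY d]])
    have xA: "c s x \<in> ?A" using x by blast
    have xU: "x \<in> over SC U s" and xW: "proj s x \<in> over SUSY W s" using x by (simp_all add: local_dom_def)
    have xS: "x \<in> SC_pts s" using over_pts[OF xU] by (simp add: SC_simps)
    obtain L where L: "sderiv (par SC) s (local_rep SC proj U c d s) (c s x) L"
      using sdat_proj[OF xS] U W xU xW unfolding sdat_def by blast
    define w0 where "w0 = d s (proj s x)"
    obtain V \<sigma> where V: "openin (base (superspace odd2)) V" "w0 \<in> over (superspace odd2) V s"
      "smor (open_sub (superspace odd2) V) SC \<sigma>"
      "\<And>w. w \<in> over (superspace odd2) V s \<Longrightarrow> proj s (\<sigma> s w) \<in> over SUSY W s \<and> d s (proj s (\<sigma> s w)) = w"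
      by (rule SUSY_chart_section[OF W xW, folded w0_def], rule that)
    let ?D = "over (superspace odd2) V s"
    have D: "sopen odd2 s ?D" using V(1) by (intro sopen_over_superspace) simp
    have \<sigma>: "\<sigma> s w \<in> SC_pts s" if "w \<in> ?D" for w using V(3) that unfolding smor_def by (auto simp: SC_simps)
    have "inv_into (over SUSY W s) (d s) w0 = proj s (\<sigma> s w0)"
      using V(4)[OF V(2)] chart_inv[OF satlas_SUSY d, of "proj s (\<sigma> s w0)" s] by simp
    then have "proj s (\<sigma> s w0) = proj s x"
      using chart_inv[OF satlas_SUSY d xW] by (simp add: w0_def)
    then obtain B where B: "B \<in> SL2_pts s" "x = SL2_emb s B ** \<sigma> s w0"
      using proj_self[of x s] unfolding proj_iff[of x s "\<sigma> s w0", symmetric] by (metis proj_iff)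
    define \<phi> where "\<phi> w = SL2_emb s B ** \<sigma> s w" for w
    have \<phi>S: "\<phi> w \<in> SC_pts s" if "w \<in> ?D" for w
      unfolding \<phi>_def using B(1) \<sigma>[OF that] by (intro SC_pts_mult) (simp_all add: SL2_emb_pts_iff)
    have \<phi>p: "proj s (\<phi> w) = proj s (\<sigma> s w)" for w unfolding \<phi>_def by (rule proj_translate[OF B(1)])
    have \<phi>0: "\<phi> w0 = x" using B(2) by (simp add: \<phi>_def)
    note atV = satlas_open_sub[OF satlas_superspace V(1)]
    have \<sigma>D: "sdiff1 odd2 s (\<lambda>w. \<sigma> s w $ i $ j) w" if w: "w \<in> ?D" for w i j
    proof -
      have "sfun (open_sub (superspace odd2) V) (scpar ij) (\<lambda>s w. mat_coords (\<sigma> s w) $ ij)" for ij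
        using sfun_comp[OF atV open_sub_cover[OF satlas_superspace superspace_cover V(1)] satlas_SC SC_covered V(3)
            sfun_SC_entry[of "fst ij" "snd ij"]] by simp
      then have "smor (open_sub (superspace odd2) V) (superspace scpar) (\<lambda>s w. mat_coords (\<sigma> s w))"
        unfolding smor_superspace_iff[OF atV open_sub_cover[OF satlas_superspace superspace_cover V(1)]] by blast
      then have "sdat (open_sub (superspace odd2) V) (superspace scpar) (\<lambda>s w. mat_coords (\<sigma> s w)) s w"
        using w unfolding smor_iff_sdat[OF atV satlas_superspace] by simp
      then have "sdat (superspace odd2) (superspace scpar) (\<lambda>s w. mat_coords (\<sigma> s w)) s w"
        using sdat_open_sub[OF satlas_superspace V(1) w, of "superspace scpar" "\<lambda>s w. mat_coords (\<sigma> s w)"] by simp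
      then have "\<exists>K. sderiv odd2 s (\<lambda>w. mat_coords (\<sigma> s w)) w K"
        using sdat_superspaces[of w odd2 s "\<lambda>s w. mat_coords (\<sigma> s w)" scpar] over_pts[OF w] SC_coords[OF \<sigma>[OF w]]
        by simp
      then have "sdiff1 odd2 s (\<lambda>w. mat_coords (\<sigma> s w) $ (i, j)) w" unfolding sderiv_iff_sdiff1 by (rule spec)
      then show ?thesis by simp
    qed
    have \<phi>D: "\<exists>K. sderiv odd2 s (\<lambda>w. mat_coords (\<phi> w)) w K" if w: "w \<in> ?D" for w
      unfolding sderiv_iff_sdiff1
    proof
      fix ij
      have "SL2_emb s B \<in> SC_pts s" using B(1) by (simp add: SL2_emb_pts_iff)
      \<comment> \<open>The constant left factor has homogeneous entries, which the product rule
        over the even part requires.\<close>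
      then have par: "SL2_emb s B $ i $ j \<in> gpart (scpar (i, j)) s" for i j by (rule smatD[OF SC_pts_smat])
      show "sdiff1 odd2 s (\<lambda>w. mat_coords (\<phi> w) $ ij) w"
        unfolding \<phi>_def mat_coords_nth matrix_matrix_mult_def
        by (simp only: vec_lambda_beta) (intro sdiff1_sum sdiff1_mult[OF sdiff1_const \<sigma>D[OF w] par])
    qed
    obtain K where K: "sderiv odd2 s (\<lambda>w. mat_coords (\<phi> w)) w0 K" using \<phi>D[OF V(2)] by blast
    have \<phi>U: "\<phi> w0 \<in> over SC U s" using \<phi>0 xU by simp
    obtain A' N where A': "sopen odd2 s A'" "w0 \<in> A'" "A' \<subseteq> ?D" "\<And>w. w \<in> A' \<Longrightarrow> \<phi> w \<in> over SC U s"
      "sderiv odd2 s (\<lambda>w. c s (\<phi> w)) w0 N"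
    \<comment> \<open>This criterion asks for the map over the single superpoint \<open>s\<close>,
      so the translate by the fixed point \<open>B\<close> is admissible although it is not
      natural.\<close>
    proof (rule embedded_chart_comp[OF SC_ctx U D V(2) _ K])
      show "\<phi> w \<in> SC_pts s" if "w \<in> ?D" for w by (rule \<phi>S[OF that])
      show "\<exists>K. sderiv odd2 s (\<lambda>w. mat_coords (\<phi> w)) w K" if "w \<in> ?D" for w by (rule \<phi>D[OF that])
      show "\<phi> w0 \<in> over SC U s" by (rule \<phi>U)
    qed (assumption | rule that)+
    have csp: "c s (\<phi> w) \<in> space_pts (par SC) s" if "w \<in> A'" for w
      by (rule chart_space_pts[OF satlas_SC c A'(4)[OF that]])
    have "sderiv odd2 s (\<lambda>w. local_rep SC proj U c d s (c s (\<phi> w))) w0 (\<lambda>h. L (N h))"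
      by (rule sderiv_chain[OF A'(5,1,2) csp]) (use L \<phi>0 in simp_all)
    moreover have "local_rep SC proj U c d s (c s (\<phi> w)) = w" if w: "w \<in> A'" for w
      using chart_inv[OF satlas_SC c A'(4)[OF w]] V(4) A'(3) w \<phi>p by (auto simp: local_rep_def)
    \<comment> \<open>The projection read along the translated section is the identity in
      coordinates, so \<open>L (N h) = h\<close>: the vector \<open>N h\<close> is the required
      preimage of \<open>h\<close>.\<close>
    ultimately have id: "sderiv odd2 s (\<lambda>w. w) w0 (\<lambda>h. L (N h))"
      using sderiv_cong[OF A'(1,2), of "\<lambda>w. local_rep SC proj U c d s (c s (\<phi> w))" "\<lambda>w. w"] by blast
    have w0: "w0 \<in> space_pts odd2 s" using over_pts[OF V(2)] by simp
    have "L ` space_pts (par SC) s = space_pts odd2 s"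
    proof (intro equalityI subsetI)
      fix k assume "k \<in> L ` space_pts (par SC) s"
      then obtain h where h: "k = L h" "h \<in> space_pts (par SC) s" by blast
      show "k \<in> space_pts odd2 s"
        unfolding h(1)
      proof (rule sderiv_space_pts[OF L A xA _ h(2)])
        fix v assume "v \<in> ?A"
        then obtain y where y: "v = c s y" "y \<in> over SC U s" "proj s y \<in> over SUSY W s"
          by (auto simp: local_dom_def)
        then show "local_rep SC proj U c d s v \<in> space_pts odd2 s"
          using chart_inv[OF satlas_SC c y(2)] chart_space_pts[OF satlas_SUSY d y(3)]
          by (simp add: local_rep_def SUSY_simps(4))
      qed
    next
      fix h assume h: "h \<in> space_pts odd2 s"
      have "L (N h) = h" by (rule sderiv_unique[OF id sderiv_id w0 h])
      moreover have "N h \<in> space_pts (par SC) s"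
        by (rule sderiv_space_pts[OF A'(5,1,2) csp h])
      ultimately show "h \<in> L ` space_pts (par SC) s" by (metis imageI)
    qed
    moreover have "(local_rep SC proj U c d s has_derivative L) (at (c s x) within ?A)"
      using sderivD(1)[OF L] at_within_openin[OF A xA] by simp
    ultimately show ?thesis by (auto simp: SUSY_simps(4))
  qed
  then show ?thesis unfolding ssubmersion_def using smor_proj by blast
qed

text \<open>The inverse morphisms are \<open>crow\<close> and the projection after
  \<open>sec\<close>. The first is smooth because its composite with the projection is
  \<open>trow\<close>; the second is a composite of morphisms.\<close>

lemma sisomorphic_SUSY: "sisomorphic SUSY (superspace odd2)"
proof -
  have trow_sdat: "sdat SC (superspace odd2) (\<lambda>s. trow) s g" if "g \<in> SC_pts s" for s g
    using smor_trow that unfolding smor_iff_sdat[OF satlas_SC satlas_superspace] by (simp add: SC_simps)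
  \<comment> \<open>The reduced target consists of 0 alone, so \<open>crow\<close> agrees there with
    the zero map.\<close>
  have "continuous_map (base SUSY) (top_of_set (space_pts odd2 0)) (\<lambda>_. 0)"
    by (simp add: space_pts_odd2_0)
  then have cont: "continuous_map (base SUSY) (top_of_set (space_pts odd2 0)) crow"
    by (rule continuous_map_eq) (use crow_SUSY(1)[of _ 0] SUSY_topspace space_pts_odd2_0 in auto)
  have f: "smor SUSY (superspace odd2) (\<lambda>s. crow)"
    unfolding smor_iff_sdat[OF satlas_SUSY satlas_superspace]
    using crow_SUSY(1) natural_crow cont sdat_descend[of _ "superspace odd2" "\<lambda>s. crow"] trow_sdat by auto
  have sec: "\<And>s v. v \<in> space_pts odd2 s \<Longrightarrow> sec v \<in> SC_pts s" "natural_on (space_pts odd2) (superspace odd2) SC (\<lambda>s. sec)"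
    "continuous_map (top_of_set (space_pts odd2 0)) (base SC) sec"
    using smor_sec sec_SC_pts unfolding smor_def by simp_all
  have "sdat (superspace odd2) SUSY (\<lambda>s v. proj s (sec v)) s v" if "v \<in> space_pts odd2 s" for s v
    by (rule sdat_comp[OF satlas_superspace satlas_SC SC_covered smor_sec _ sdat_proj[OF sec(1)[OF that]]])
      (simp add: that)
  moreover have "continuous_map (top_of_set (space_pts odd2 0)) (base SUSY) (\<lambda>v. proj 0 (sec v))"
    using continuous_map_compose[OF sec(3) continuous_proj] by (simp add: comp_def)
  moreover have "natural_on (space_pts odd2) (superspace odd2) SUSY (\<lambda>s v. proj s (sec v))"
    using sec(2) SUSY_act_proj sec(1) unfolding natural_on_def SC_simps by simp
  ultimately have g: "smor (superspace odd2) SUSY (\<lambda>s v. proj s (sec v))"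
    unfolding smor_iff_sdat[OF satlas_superspace satlas_SUSY] using sec(1) proj_SUSY by auto
  show ?thesis
    unfolding sisomorphic_def
    by (intro exI[of _ "\<lambda>s. crow"] exI[of _ "\<lambda>s v. proj s (sec v)"] conjI f g) (simp_all add: crow_SUSY)
qed

theorem lemma3p2:
  shows "super_lie_embedding SL2 SL2_grp SC SC_grp SL2_emb
    \<and> supermanifold SUSY \<and> ssubmersion SC SUSY (coset_proj SL2_grp SC_grp SL2_emb)
    \<and> sisomorphic SUSY (superspace (\<lambda>_ :: 2. True))"
  using super_lie_embedding_SL2_emb SUSY_supermanifold ssubmersion_proj sisomorphic_SUSY by blast

end
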